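(* Let $s\in(0,1)$, $\gamma=2$, $T>0$, and let $\mathscr{U}$ solve the extended problem $$\begin{cases}-\mathrm{div}(y^\alpha\mathbf{A}\nabla\mathscr{U})+y^\alpha c\,\mathscr{U}=0\ \text{ in }\mathcal{C}\times(0,T),\qquad \mathscr{U}=0\ \text{ on }\partial_L\mathcal{C}\times(0,T),\\ d_s\partial_t^2\mathscr{U}+\partial_\nu^\alpha\mathscr{U}=d_sf\ \text{ on }(\Omega\times\{0\})\times(0,T),\\ \mathscr{U}=g,\quad\partial_t\mathscr{U}=h\ \text{ on }\Omega\times\{0\},\ t=0.\end{cases}$$ Let $0\le\theta<2\sqrt{\lambda_1}$, $0\le\sigma<s$ and $0\le\nu<1+s$. Then there exist $\kappa>1$ and $C>0$, with $C$ independent of $\ell$ and of the data $f,g,h$, such that for every integer $\ell\ge0$, $$\|\partial_y^{\ell+1}\mathscr{U}\|^2_{L^2(0,T;L^2(\omega_{\alpha+2\ell-2\sigma,\theta},\mathcal{C}))}\le C\kappa^{2(\ell+1)}((\ell+1)!)^2\left(\|g\|^2_{\mathbb{H}^{\sigma+s}(\Omega)}+\|h\|^2_{\mathbb{H}^{\sigma}(\Omega)}+\|f\|^2_{L^2(0,T;\mathbb{H}^{\sigma}(\Omega))}\right),$$ $$\|\nabla_{x'}\partial_y^{\ell+1}\mathscr{U}\|^2_{L^2(0,T;L^2(\omega_{\alpha+2(\ell+1)-2\nu,\theta},\mathcal{C}))}\le C\kappa^{2(\ell+1)}((\ell+1)!)^2\left(\|g\|^2_{\mathbb{H}^{\nu+s}(\Omega)}+\|h\|^2_{\mathbb{H}^{\nu}(\Omega)}+\|f\|^2_{L^2(0,T;\mathbb{H}^{\nu}(\Omega))}\right),$$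 and $$\|\mathcal{L}_{x'}\partial_y^{\ell+1}\mathscr{U}\|^2_{L^2(0,T;L^2(\omega_{\alpha+2(\ell+1)-2\nu,\theta},\mathcal{C}))}\le C\kappa^{2(\ell+1)}((\ell+1)!)^2\left(\|g\|^2_{\mathbb{H}^{1+\nu+s}(\Omega)}+\|h\|^2_{\mathbb{H}^{1+\nu}(\Omega)}+\|f\|^2_{L^2(0,T;\mathbb{H}^{1+\nu}(\Omega))}\right),$$ each bound being understood whenever its right-hand side is finite.
   Context: $\Omega\subset\mathbb{R}^n$ ($n\ge1$) is open, bounded and convex. $\mathcal{L}w=-\mathrm{div}(A\nabla w)+cw$ with homogeneous Dirichlet boundary conditions, where $0\le c\in L^\infty(\Omega)$ and $A$ is a Lipschitz ($C^{0,1}$), symmetric, uniformly positive definite matrix field on $\Omega$; $\mathcal{L}_{x'}$ denotes $\mathcal{L}$ acting in $x'\in\Omega$. $\{(\lambda_k,\varphi_k)\}_{k\ge1}\subset\mathbb{R}_+\times H_0^1(\Omega)$ are the eigenpairs of $\mathcal{L}$, with $\lambda_1$ the smallest eigenvalue and $\{\varphi_k\}$ an orthonormal basis of $L^2(\Omega)$. For $r\ge0$, $\mathbb{H}^r(\Omega)=\{w=\sum_kw_k\varphi_k:\|w\|_{\mathbb{H}^r(\Omega)}^2=\sum_k\lambda_k^r|w_k|^2<\infty\}$. Extension notation: $\mathcal{C}=\Omega\times(0,\infty)$ with points $(x',y)$; $\partial_L\mathcal{C}=\partial\Omega\times[0,\infty)$; $\alpha=1-2s$; $d_s=2^\alpha\Gamma(1-s)/\Gamma(s)$;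 $\mathbf{A}=\mathrm{diag}\{A,1\}$; $\partial_\nu^\alpha\mathscr{U}=-\lim_{y\downarrow0}y^\alpha\mathscr{U}_y$. The solution is $\mathscr{U}(x',y,t)=\sum_{k\ge1}u_k(t)\varphi_k(x')\psi_k(y)$. Here, with $g_k,h_k,f_k(t)$ the coefficients of $g,h,f(\cdot,t)$ with respect to $\varphi_k$, $$u_k(t)=g_k\cos(\lambda_k^{s/2}t)+\frac{h_k}{\lambda_k^{s/2}}\sin(\lambda_k^{s/2}t)+\frac1{\lambda_k^{s/2}}\int_0^tf_k(r)\sin(\lambda_k^{s/2}(t-r))\,dr,$$ and $\psi_k$ solves $\psi_k''+\frac\alpha y\psi_k'=\lambda_k\psi_k$ on $(0,\infty)$, $\psi_k(0)=1$, $\lim_{y\to\infty}\psi_k(y)=0$; explicitly $\psi_k(y)=c_s(\sqrt{\lambda_k}y)^sK_s(\sqrt{\lambda_k}y)$, $c_s=2^{1-s}/\Gamma(s)$, $K_s$ the modified Bessel function of the second kind. Weights: $\omega_{\beta,\theta}(y)=y^\beta e^{\theta y}$ and $\|v\|_{L^2(\omega_{\beta,\theta},\mathcal{C})}^2=\int_0^\infty\int_\Omega\omega_{\beta,\theta}(y)|v(x',y)|^2\,dx'\,dy$. *)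

theory Defs
  imports "HOL-Analysis.Analysis"
begin

text \<open>
  Elements of Lebesgue and Sobolev spaces are represented by functions that are Borel measurable on
  the set in question (every class has such a representative). Squared norms that may be infinite
  take values in \<^typ>\<open>ennreal\<close>. The eigenpairs are indexed from 0, so \<open>lam 0\<close> is the
  smallest eigenvalue. Points of the space-time cylinder are triples \<open>(x, y, t)\<close>.
\<close>

definition dderiv :: "'a::euclidean_space \<Rightarrow> ('a \<Rightarrow> real) \<Rightarrow> 'a \<Rightarrow> real" where
  "dderiv b f = (\<lambda>x. frechet_derivative f (at x) b)"

primrec Ck :: "nat \<Rightarrow> ('a::euclidean_space \<Rightarrow> real) \<Rightarrow> bool" where
  "Ck 0 f \<longleftrightarrow> continuous_on UNIV f"
| "Ck (Suc m) f \<longleftrightarrow> (\<forall>x. f differentiable (at x)) \<and> (\<forall>b\<in>Basis. Ck m (dderiv b f))"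

definition test_fun :: "'a::euclidean_space set \<Rightarrow> ('a \<Rightarrow> real) \<Rightarrow> bool" where
  "test_fun S \<eta> \<longleftrightarrow>
     (\<forall>m. Ck m \<eta>) \<and> compact (closure {x. \<eta> x \<noteq> 0}) \<and> closure {x. \<eta> x \<noteq> 0} \<subseteq> S"

definition grad :: "(real^'n \<Rightarrow> real) \<Rightarrow> real^'n \<Rightarrow> real^'n" where
  "grad \<eta> x = (\<chi> i. dderiv (axis i 1) \<eta> x)"

type_synonym 'n spacetime = "(real^'n) \<times> real \<times> real"

definition grad_x :: "('n::finite spacetime \<Rightarrow> real) \<Rightarrow> 'n spacetime \<Rightarrow> real^'n" where
  "grad_x \<eta> p = (\<chi> i. dderiv (axis i 1, 0, 0) \<eta> p)"

definition d_y :: "('n::finite spacetime \<Rightarrow> real) \<Rightarrow> 'n spacetime \<Rightarrow> real" where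
  "d_y = dderiv (0, 1, 0)"

definition d_t :: "('n::finite spacetime \<Rightarrow> real) \<Rightarrow> 'n spacetime \<Rightarrow> real" where
  "d_t = dderiv (0, 0, 1)"

definition L2 :: "'a::euclidean_space set \<Rightarrow> ('a \<Rightarrow> 'b::euclidean_space) \<Rightarrow> bool" where
  "L2 S f \<longleftrightarrow> set_borel_measurable lborel S f \<and> set_integrable lborel S (\<lambda>x. (norm (f x))\<^sup>2)"

definition L2_tendsto ::
  "'a::euclidean_space set \<Rightarrow> (nat \<Rightarrow> 'a \<Rightarrow> 'b::euclidean_space) \<Rightarrow> ('a \<Rightarrow> 'b) \<Rightarrow> bool" where
  "L2_tendsto S F f \<longleftrightarrow>
     (\<lambda>j. \<integral>\<^sup>+ x\<in>S. ennreal ((norm (F j x - f x))\<^sup>2) \<partial>lborel) \<longlonglongrightarrow> 0"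

text \<open>\<open>H01_grad \<Omega> u G\<close>: the function \<open>u\<close> lies in the closure of the test functions in the
  \<open>H\<^sup>1(\<Omega>)\<close>-norm, with (weak) gradient \<open>G\<close>.\<close>

definition H01_grad :: "(real^'n) set \<Rightarrow> (real^'n \<Rightarrow> real) \<Rightarrow> (real^'n \<Rightarrow> real^'n) \<Rightarrow> bool" where
  "H01_grad \<Omega> u G \<longleftrightarrow> L2 \<Omega> u \<and> L2 \<Omega> G \<and>
     (\<exists>\<eta>. (\<forall>j. test_fun \<Omega> (\<eta> j)) \<and> L2_tendsto \<Omega> \<eta> u \<and> L2_tendsto \<Omega> (\<lambda>j. grad (\<eta> j)) G)"

definition loc_integrable :: "'a::euclidean_space set \<Rightarrow> ('a \<Rightarrow> 'b::euclidean_space) \<Rightarrow> bool" where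
  "loc_integrable S f \<longleftrightarrow> (\<forall>K. compact K \<and> K \<subseteq> S \<longrightarrow> set_integrable lborel K f)"

definition admissible_coeffs ::
  "(real^'n) set \<Rightarrow> (real^'n \<Rightarrow> real^'n^'n) \<Rightarrow> (real^'n \<Rightarrow> real) \<Rightarrow> bool" where
  "admissible_coeffs \<Omega> A c \<longleftrightarrow>
     (\<exists>K. K-lipschitz_on \<Omega> A) \<and>
     (\<forall>x\<in>\<Omega>. transpose (A x) = A x) \<and>
     (\<exists>a>0. \<forall>x\<in>\<Omega>. \<forall>\<xi>. a * (norm \<xi>)\<^sup>2 \<le> \<xi> \<bullet> (A x *v \<xi>)) \<and>
     set_borel_measurable lborel \<Omega> c \<and>
     (\<exists>M. AE x in lborel. x \<in> \<Omega> \<longrightarrow> 0 \<le> c x \<and> c x \<le> M)"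

definition coef :: "(real^'n) set \<Rightarrow> (nat \<Rightarrow> real^'n \<Rightarrow> real) \<Rightarrow> (real^'n \<Rightarrow> real) \<Rightarrow> nat \<Rightarrow> real" where
  "coef \<Omega> \<phi> w k = (LINT x:\<Omega>|lborel. w x * \<phi> k x)"

definition orthonormal_basis_L2 :: "(real^'n) set \<Rightarrow> (nat \<Rightarrow> real^'n \<Rightarrow> real) \<Rightarrow> bool" where
  "orthonormal_basis_L2 \<Omega> \<phi> \<longleftrightarrow>
     (\<forall>k. L2 \<Omega> (\<phi> k)) \<and>
     (\<forall>j k. (LINT x:\<Omega>|lborel. \<phi> j x * \<phi> k x) = (if j = k then 1 else 0)) \<and>
     (\<forall>w. L2 \<Omega> w \<longrightarrow> L2_tendsto \<Omega> (\<lambda>N x. \<Sum>k<N. coef \<Omega> \<phi> w k * \<phi> k x) w)"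

definition eigenpair ::
  "(real^'n) set \<Rightarrow> (real^'n \<Rightarrow> real^'n^'n) \<Rightarrow> (real^'n \<Rightarrow> real) \<Rightarrow> real \<Rightarrow> (real^'n \<Rightarrow> real) \<Rightarrow> bool" where
  "eigenpair \<Omega> A c l u \<longleftrightarrow>
     (\<exists>G. H01_grad \<Omega> u G \<and>
       (\<forall>v H. H01_grad \<Omega> v H \<longrightarrow>
          (LINT x:\<Omega>|lborel. (A x *v G x) \<bullet> H x + c x * u x * v x) = l * (LINT x:\<Omega>|lborel. u x * v x)))"

definition eigensystem ::
  "(real^'n) set \<Rightarrow> (real^'n \<Rightarrow> real^'n^'n) \<Rightarrow> (real^'n \<Rightarrow> real) \<Rightarrow> (nat \<Rightarrow> real)
     \<Rightarrow> (nat \<Rightarrow> real^'n \<Rightarrow> real) \<Rightarrow> bool" where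
  "eigensystem \<Omega> A c lam \<phi> \<longleftrightarrow>
     (\<forall>k. 0 < lam k \<and> lam 0 \<le> lam k \<and> eigenpair \<Omega> A c (lam k) (\<phi> k)) \<and>
     orthonormal_basis_L2 \<Omega> \<phi>"

text \<open>Squares of the norms of \<open>\<H>\<^sup>r(\<Omega>)\<close> and \<open>L\<^sup>2(0,T; \<H>\<^sup>r(\<Omega>))\<close>.\<close>

definition Hnorm2 ::
  "(real^'n) set \<Rightarrow> (nat \<Rightarrow> real) \<Rightarrow> (nat \<Rightarrow> real^'n \<Rightarrow> real) \<Rightarrow> real \<Rightarrow> (real^'n \<Rightarrow> real) \<Rightarrow> ennreal" where
  "Hnorm2 \<Omega> lam \<phi> r w = (\<Sum>k. ennreal (lam k powr r * (coef \<Omega> \<phi> w k)\<^sup>2))"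

definition L2Hnorm2 ::
  "(real^'n) set \<Rightarrow> (nat \<Rightarrow> real) \<Rightarrow> (nat \<Rightarrow> real^'n \<Rightarrow> real) \<Rightarrow> real \<Rightarrow> real
     \<Rightarrow> ((real^'n) \<times> real \<Rightarrow> real) \<Rightarrow> ennreal" where
  "L2Hnorm2 \<Omega> lam \<phi> T r f = (\<integral>\<^sup>+ t\<in>{0<..<T}. Hnorm2 \<Omega> lam \<phi> r (\<lambda>x. f (x, t)) \<partial>lborel)"

definition cyl :: "(real^'n::finite) set \<Rightarrow> real \<Rightarrow> 'n spacetime set" where
  "cyl \<Omega> T = \<Omega> \<times> {0<..} \<times> {0<..<T}"

definition weight :: "real \<Rightarrow> real \<Rightarrow> real \<Rightarrow> real" where
  "weight \<beta> \<theta> y = y powr \<beta> * exp (\<theta> * y)"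

text \<open>The squared norm of \<open>L\<^sup>2(0,T; L\<^sup>2(\<omega>\<^sub>\<beta>\<^sub>,\<^sub>\<theta>, C))\<close>.\<close>

definition wnorm2 ::
  "(real^'n::finite) set \<Rightarrow> real \<Rightarrow> real \<Rightarrow> real \<Rightarrow> ('n spacetime \<Rightarrow> 'b::euclidean_space) \<Rightarrow> ennreal" where
  "wnorm2 \<Omega> T \<beta> \<theta> v =
     (\<integral>\<^sup>+ t\<in>{0<..<T}. (\<integral>\<^sup>+ y\<in>{0<..}. (\<integral>\<^sup>+ x\<in>\<Omega>.
        ennreal (weight \<beta> \<theta> y * (norm (v (x, y, t)))\<^sup>2) \<partial>lborel) \<partial>lborel) \<partial>lborel)"

definition alpha :: "real \<Rightarrow> real" where
  "alpha s = 1 - 2 * s"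

definition d_const :: "real \<Rightarrow> real" where
  "d_const s = 2 powr (alpha s) * Gamma (1 - s) / Gamma s"

text \<open>
  Weak solutions of the extended problem. Here \<open>P\<close> is the gradient of \<open>U\<close> in \<open>x\<close>, \<open>Q\<close> its derivative
  in \<open>y\<close>, and \<open>u\<close> its trace on \<open>y = 0\<close>. The homogeneous condition on the lateral boundary is
  \<open>U(\<cdot>,y,t) \<in> H\<^sup>1\<^sub>0(\<Omega>)\<close>. In the first integral identity the test functions need not vanish on
  \<open>y = 0\<close>: those that do say that \<open>Q\<close> is the weak derivative of \<open>U\<close>, the others identify
  the trace. The second identity arises by multiplying the equation by a test function that need not
  vanish on \<open>y = 0\<close> or at \<open>t = 0\<close> and integrating by parts, once in space and twice in time; it
  contains the dynamic boundary condition on \<open>y = 0\<close> and both initial conditions.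
\<close>

definition weak_solution ::
  "(real^'n::finite) set \<Rightarrow> (real^'n \<Rightarrow> real^'n^'n) \<Rightarrow> (real^'n \<Rightarrow> real) \<Rightarrow> real \<Rightarrow> real
     \<Rightarrow> ((real^'n) \<times> real \<Rightarrow> real) \<Rightarrow> (real^'n \<Rightarrow> real) \<Rightarrow> (real^'n \<Rightarrow> real)
     \<Rightarrow> ('n spacetime \<Rightarrow> real) \<Rightarrow> bool" where
  "weak_solution \<Omega> A c s T f g h U \<longleftrightarrow>
     set_borel_measurable lborel (cyl \<Omega> T) U \<and> wnorm2 \<Omega> T (alpha s) 0 U < \<infinity> \<and>
     (\<exists>P Q u.
        set_borel_measurable lborel (cyl \<Omega> T) P \<and> wnorm2 \<Omega> T (alpha s) 0 P < \<infinity> \<and>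
        set_borel_measurable lborel (cyl \<Omega> T) Q \<and> wnorm2 \<Omega> T (alpha s) 0 Q < \<infinity> \<and>
        L2 (\<Omega> \<times> {0<..<T}) u \<and>
        (AE t in lborel. t \<in> {0<..<T} \<longrightarrow> (AE y in lborel. y > 0 \<longrightarrow>
           H01_grad \<Omega> (\<lambda>x. U (x, y, t)) (\<lambda>x. P (x, y, t)))) \<and>
        (\<forall>\<eta>. test_fun (\<Omega> \<times> UNIV \<times> {0<..<T}) \<eta> \<longrightarrow>
           (LINT p:cyl \<Omega> T|lborel. U p * d_y \<eta> p + Q p * \<eta> p)
             = - (LINT (x, t):\<Omega> \<times> {0<..<T}|lborel. u (x, t) * \<eta> (x, 0, t))) \<and>
        (\<forall>\<eta>. test_fun (\<Omega> \<times> UNIV \<times> {..<T}) \<eta> \<longrightarrow>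
           (LINT (x, y, t):cyl \<Omega> T|lborel. y powr (alpha s) *
               ((A x *v P (x, y, t)) \<bullet> grad_x \<eta> (x, y, t) + Q (x, y, t) * d_y \<eta> (x, y, t)
                 + c x * U (x, y, t) * \<eta> (x, y, t)))
           + d_const s * (LINT (x, t):\<Omega> \<times> {0<..<T}|lborel. u (x, t) * d_t (d_t \<eta>) (x, 0, t))
           + d_const s * (LINT x:\<Omega>|lborel. g x * d_t \<eta> (x, 0, 0) - h x * \<eta> (x, 0, 0))
           = d_const s * (LINT (x, t):\<Omega> \<times> {0<..<T}|lborel. f (x, t) * \<eta> (x, 0, t))))"

text \<open>The decaying solution
  \<open>2\<^sup>1\<^sup>-\<^sup>s / \<Gamma>(s) (\<surd>l y)\<^sup>s K\<^sub>s(\<surd>l y)\<close> of the Bessel-type equation, given by the boundary value problem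
  that determines it.\<close>

definition profile :: "real \<Rightarrow> real \<Rightarrow> (real \<Rightarrow> real) \<Rightarrow> bool" where
  "profile s l \<psi> \<longleftrightarrow>
     (\<exists>\<psi>'. \<forall>y>0. (\<psi> has_real_derivative \<psi>' y) (at y) \<and>
        (\<psi>' has_real_derivative (l * \<psi> y - alpha s / y * \<psi>' y)) (at y)) \<and>
     continuous_on {0..} \<psi> \<and> \<psi> 0 = 1 \<and> (\<psi> \<longlongrightarrow> 0) at_top"

definition mode ::
  "(real^'n) set \<Rightarrow> (nat \<Rightarrow> real) \<Rightarrow> (nat \<Rightarrow> real^'n \<Rightarrow> real) \<Rightarrow> real
     \<Rightarrow> ((real^'n) \<times> real \<Rightarrow> real) \<Rightarrow> (real^'n \<Rightarrow> real) \<Rightarrow> (real^'n \<Rightarrow> real) \<Rightarrow> nat \<Rightarrow> real \<Rightarrow> real" where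
  "mode \<Omega> lam \<phi> s f g h k t =
     coef \<Omega> \<phi> g k * cos (lam k powr (s/2) * t)
     + coef \<Omega> \<phi> h k / lam k powr (s/2) * sin (lam k powr (s/2) * t)
     + 1 / lam k powr (s/2) *
         (LINT r:{0..t}|lborel. coef \<Omega> \<phi> (\<lambda>x. f (x, r)) k * sin (lam k powr (s/2) * (t - r)))"

text \<open>\<open>U(\<cdot>,y,t) = \<Sum>\<^sub>k u\<^sub>k(t) \<psi>\<^sub>k(y) \<phi>\<^sub>k\<close> in \<open>L\<^sup>2(\<Omega>)\<close>, stated for almost every \<open>(y,t)\<close> so that it does not
  depend on the representative of \<open>U\<close>.\<close>

definition series_solution ::
  "(real^'n::finite) set \<Rightarrow> (nat \<Rightarrow> real) \<Rightarrow> (nat \<Rightarrow> real^'n \<Rightarrow> real) \<Rightarrow> (nat \<Rightarrow> real \<Rightarrow> real)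
     \<Rightarrow> real \<Rightarrow> real \<Rightarrow> ((real^'n) \<times> real \<Rightarrow> real) \<Rightarrow> (real^'n \<Rightarrow> real) \<Rightarrow> (real^'n \<Rightarrow> real)
     \<Rightarrow> ('n spacetime \<Rightarrow> real) \<Rightarrow> bool" where
  "series_solution \<Omega> lam \<phi> \<psi> s T f g h U \<longleftrightarrow>
     (AE t in lborel. t \<in> {0<..<T} \<longrightarrow> (AE y in lborel. y > 0 \<longrightarrow>
        L2_tendsto \<Omega> (\<lambda>N x. \<Sum>k<N. mode \<Omega> lam \<phi> s f g h k t * \<phi> k x * \<psi> k y) (\<lambda>x. U (x, y, t))))"

definition weak_dy ::
  "nat \<Rightarrow> 'n::finite spacetime set \<Rightarrow> ('n spacetime \<Rightarrow> real) \<Rightarrow> ('n spacetime \<Rightarrow> real) \<Rightarrow> bool" where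
  "weak_dy m S U V \<longleftrightarrow> loc_integrable S U \<and> loc_integrable S V \<and>
     (\<forall>\<eta>. test_fun S \<eta> \<longrightarrow>
        (LINT p:S|lborel. U p * (d_y ^^ m) \<eta> p) = (-1) ^ m * (LINT p:S|lborel. V p * \<eta> p))"

definition weak_grad_x ::
  "'n::finite spacetime set \<Rightarrow> ('n spacetime \<Rightarrow> real) \<Rightarrow> ('n spacetime \<Rightarrow> real^'n) \<Rightarrow> bool" where
  "weak_grad_x S V W \<longleftrightarrow> loc_integrable S V \<and> loc_integrable S W \<and>
     (\<forall>\<eta>. test_fun S \<eta> \<longrightarrow>
        (LINT p:S|lborel. V p *\<^sub>R grad_x \<eta> p) = - (LINT p:S|lborel. \<eta> p *\<^sub>R W p))"

text \<open>\<open>Z = -div\<^sub>x(A \<nabla>\<^sub>x V) + c V\<close> in the sense of distributions.\<close>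

definition weak_Lx ::
  "(real^'n \<Rightarrow> real^'n^'n) \<Rightarrow> (real^'n \<Rightarrow> real) \<Rightarrow> 'n::finite spacetime set
     \<Rightarrow> ('n spacetime \<Rightarrow> real) \<Rightarrow> ('n spacetime \<Rightarrow> real) \<Rightarrow> bool" where
  "weak_Lx A c S V Z \<longleftrightarrow> loc_integrable S Z \<and>
     (\<exists>W. weak_grad_x S V W \<and>
       (\<forall>\<eta>. test_fun S \<eta> \<longrightarrow>
          (LINT p:S|lborel. (A (fst p) *v W p) \<bullet> grad_x \<eta> p + c (fst p) * V p * \<eta> p)
            = (LINT p:S|lborel. Z p * \<eta> p)))"

end

theory Submission
  imports Defs
begin

text \<open>
  The estimates hold because \<open>U = \<Sum>\<^sub>k u\<^sub>k(t) \<phi>\<^sub>k(x) \<psi>\<^sub>k(y)\<close> separates the variables: every squared norm in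
  the statement is bounded by a sum over \<open>k\<close> of products of a factor from \<open>x\<close>, one from \<open>y\<close> and one from
  \<open>t\<close>, and the powers of \<open>lam k\<close> that these factors produce add up to those in the norms of the data.

  In \<open>y\<close>, the maximum principle makes the decaying solution of the Bessel-type equation unique
  (\<open>profile_unique\<close>), so that \<open>\<psi>\<^sub>k(y) = \<rho>(\<surd>(lam k) y)\<close> with a single function \<open>\<rho>\<close>. Comparison with
  exponentials and monotonicity of \<open>z\<^sup>\<alpha> \<rho>'(z)\<close> bound \<open>\<rho>\<close> and \<open>\<rho>'\<close> (\<open>profile_decay\<close>). Differentiating
  \<open>z \<rho>'' + \<alpha> \<rho>' = z \<rho>\<close> repeatedly gives a recursion for the derivatives of \<open>\<rho>\<close>, and a majorant for it gives
  \<open>\<bar>\<rho>\<^sup>(\<^sup>m\<^sup>)(z)\<bar> \<le> C K\<^sup>m m! z\<^sup>2\<^sup>s\<^sup>-\<^sup>m e\<^sup>-\<^sup>\<delta>\<^sup>z\<close> for any \<open>\<delta> < 1\<close> (\<open>unit_profile_derivs\<close>). In the weighted integral of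
  \<open>(\<psi>\<^sub>k\<^sup>(\<^sup>m\<^sup>))\<^sup>2\<close> the powers \<open>y\<^sup>\<plusminus>\<^sup>2\<^sup>m\<close> cancel and a Gamma integral that does not depend on \<open>m\<close> remains
  (\<open>profile_family_derivs\<close>). It converges at 0 because \<open>\<sigma> < s\<close> and \<open>\<nu> < 1 + s\<close>, and at infinity because
  \<open>\<theta> < 2 \<surd>(lam 0)\<close>.

  In \<open>t\<close>, the formula for \<open>u\<^sub>k\<close> and the Cauchy-Schwarz inequality bound
  \<open>\<Sum>\<^sub>k lam\<^sub>k\<^sup>r\<^sup>+\<^sup>s \<integral> u\<^sub>k\<^sup>2\<close> by the data (\<open>mode_L2_sum\<close>). In \<open>x\<close>, the \<open>\<phi>\<^sub>k\<close> are orthonormal and also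
  orthogonal in the energy form, with squares \<open>lam k\<close>, so that ellipticity controls their gradients
  (\<open>gradient_sum_norm\<close>).

  So the series differentiated term by term are Cauchy in the weighted spaces and have limits that
  satisfy the bounds (\<open>tensor_series_estimate\<close>). These limits are the weak derivatives of \<open>U\<close>: every
  partial sum satisfies the defining identities, by integration by parts in \<open>y\<close>, because
  \<open>\<phi>\<^sub>k \<in> H\<^sup>1\<^sub>0(\<Omega>)\<close>, and by the eigenvalue equation; and convergence in a weighted \<open>L\<^sup>2\<close> implies convergence of
  the integrals against test functions, whose support keeps away from \<open>y = 0\<close>.
\<close>

section \<open>The Bessel-type profile and its derivatives\<close>

text \<open>A positive value of \<open>w\<close> would force a positive interior maximum, where \<open>w' = 0\<close>; but then \<open>w'' > 0\<close> makes
\<open>w\<close> increase to the right of it.\<close>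

lemma max_principle:
  fixes w w' w'' :: "real \<Rightarrow> real"
  assumes cont: "continuous_on {a..} w" and w0: "w a \<le> 0" and lim: "(w \<longlongrightarrow> 0) at_top"
    and d1: "\<And>z. a < z \<Longrightarrow> (w has_real_derivative w' z) (at z)"
    and d2: "\<And>z. a < z \<Longrightarrow> (w' has_real_derivative w'' z) (at z)"
    and pos: "\<And>z. a < z \<Longrightarrow> 0 < w z \<Longrightarrow> w' z = 0 \<Longrightarrow> 0 < w'' z"
    and az: "a \<le> z"
  shows "w z \<le> 0"
proof (rule ccontr)
  assume "\<not> w z \<le> 0"
  hence wz: "0 < w z" by simp
  obtain b0 where b0: "\<And>x. b0 \<le> x \<Longrightarrow> w x < w z"
    using order_tendstoD(2)[OF lim wz] by (auto simp: eventually_at_top_linorder)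
  define b where "b = max b0 (z + 1)"
  have "{a..b} \<noteq> {}" using az by (auto simp: b_def)
  then obtain m where m: "m \<in> {a..b}" "\<And>x. x \<in> {a..b} \<Longrightarrow> w x \<le> w m"
    using continuous_attains_sup[of "{a..b}" w] continuous_on_subset[OF cont, of "{a..b}"] by fastforce
  have wm: "w z \<le> w m" using m(2)[of z] az by (auto simp: b_def)
  have am: "a < m" using m(1) w0 wm wz by (cases "m = a") auto
  have mb: "m < b" using m(1) wm b0[of b] by (cases "m = b") (auto simp: b_def)
  have 1: "w' m = 0"
  proof (rule DERIV_local_max[OF d1[OF am]])
    show "0 < min (m - a) (b - m)" using am mb by simp
    show "\<forall>y. \<bar>m - y\<bar> < min (m - a) (b - m) \<longrightarrow> w y \<le> w m"
    proof (intro allI impI m(2))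
      fix y assume "\<bar>m - y\<bar> < min (m - a) (b - m)"
      thus "y \<in> {a..b}" using am mb by (simp add: abs_less_iff)
    qed
  qed
  have "0 < w'' m" using pos[OF am _ 1] wm wz by simp
  from DERIV_pos_inc_right[OF d2[OF am] this] 1
  obtain d where d: "d > 0" "\<And>h. 0 < h \<Longrightarrow> h < d \<Longrightarrow> 0 < w' (m + h)" by auto
  define e where "e = min (d / 2) (b - m)"
  have e: "0 < e" "e < d" "e \<le> b - m" using d(1) mb by (auto simp: e_def)
  have "w m < w (m + e)"
  proof (rule DERIV_pos_imp_increasing_open[of m "m + e" w])
    show "m < m + e" using e by simp
    show "\<exists>y. (w has_real_derivative y) (at x) \<and> 0 < y" if "m < x" "x < m + e" for x
      using d1[of x] d(2)[of "x - m"] that am e by (intro exI[of _ "w' x"]) auto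
    show "continuous_on {m..m + e} w" using continuous_on_subset[OF cont] am by auto
  qed
  moreover have "w (m + e) \<le> w m" using m(1) e by (intro m(2)) auto
  ultimately show False by simp
qed

text \<open>The difference of two solutions satisfies the hypotheses of \<open>max_principle\<close>, and so does its negative.\<close>

lemma profile_unique:
  assumes "0 < l" and 1: "profile s l \<rho>" and 2: "profile s l \<tau>" and "0 \<le> z"
  shows "\<rho> z = \<tau> z"
proof -
  have le: "\<rho> z \<le> \<tau> z" if 1: "profile s l \<rho>" and 2: "profile s l \<tau>" for \<rho> \<tau>
  proof -
    obtain \<rho>' where c: "\<And>y. y > 0 \<Longrightarrow> (\<rho> has_real_derivative \<rho>' y) (at y)"
      "\<And>y. y > 0 \<Longrightarrow> (\<rho>' has_real_derivative (l * \<rho> y - alpha s / y * \<rho>' y)) (at y)"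
      using 1 unfolding profile_def by blast
    obtain \<tau>' where x: "\<And>y. y > 0 \<Longrightarrow> (\<tau> has_real_derivative \<tau>' y) (at y)"
      "\<And>y. y > 0 \<Longrightarrow> (\<tau>' has_real_derivative (l * \<tau> y - alpha s / y * \<tau>' y)) (at y)"
      using 2 unfolding profile_def by blast
    have "\<rho> z - \<tau> z \<le> 0"
    proof (rule max_principle[where a = 0 and w = "\<lambda>z. \<rho> z - \<tau> z" and w' = "\<lambda>z. \<rho>' z - \<tau>' z"
          and w'' = "\<lambda>y. (l * \<rho> y - alpha s / y * \<rho>' y) - (l * \<tau> y - alpha s / y * \<tau>' y)"])
      show "continuous_on {0..} (\<lambda>z. \<rho> z - \<tau> z)" "\<rho> 0 - \<tau> 0 \<le> 0"
        using 1 2 unfolding profile_def by (auto intro: continuous_on_diff)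
      show "((\<lambda>z. \<rho> z - \<tau> z) \<longlongrightarrow> 0) at_top"
        using tendsto_diff[of \<rho> 0 at_top \<tau> 0] 1 2 unfolding profile_def by simp
      show "((\<lambda>z. \<rho> z - \<tau> z) has_real_derivative \<rho>' y - \<tau>' y) (at y)" if "0 < y" for y
        using DERIV_diff[OF c(1) x(1)] that by blast
      show "((\<lambda>z. \<rho>' z - \<tau>' z) has_real_derivative
          (l * \<rho> y - alpha s / y * \<rho>' y) - (l * \<tau> y - alpha s / y * \<tau>' y)) (at y)" if "0 < y" for y
        using DERIV_diff[OF c(2) x(2)] that by blast
      show "0 < (l * \<rho> y - alpha s / y * \<rho>' y) - (l * \<tau> y - alpha s / y * \<tau>' y)"
        if "0 < y" "0 < \<rho> y - \<tau> y" "\<rho>' y - \<tau>' y = 0" for y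
        using that \<open>0 < l\<close> by simp
    qed fact
    thus ?thesis by simp
  qed
  show ?thesis using le[OF 1 2] le[OF 2 1] by simp
qed

lemma profile_rescale:
  assumes "0 < l" "profile s l \<psi>"
  shows "profile s 1 (\<lambda>z. \<psi> (z / sqrt l))"
proof -
  obtain \<psi>' where c: "\<And>y. y > 0 \<Longrightarrow> (\<psi> has_real_derivative \<psi>' y) (at y)"
      "\<And>y. y > 0 \<Longrightarrow> (\<psi>' has_real_derivative (l * \<psi> y - alpha s / y * \<psi>' y)) (at y)"
    and p: "continuous_on {0..} \<psi>" "\<psi> 0 = 1" "(\<psi> \<longlongrightarrow> 0) at_top"
    using assms unfolding profile_def by blast
  let ?r = "sqrt l"
  have r: "?r > 0" "?r * ?r = l" using assms by auto
  have d1: "((\<lambda>z. \<psi> (z / ?r)) has_real_derivative \<psi>' (z / ?r) / ?r) (at z)" if "z > 0" for z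
  proof -
    have "((\<lambda>z. z / ?r) has_real_derivative 1 / ?r) (at z)"
      by (rule DERIV_cdivide[OF DERIV_ident])
    from DERIV_chain2[OF c(1) this] show ?thesis using that r by simp
  qed
  have d2: "((\<lambda>z. \<psi>' (z / ?r) / ?r) has_real_derivative
      1 * \<psi> (z / ?r) - alpha s / z * (\<psi>' (z / ?r) / ?r)) (at z)" if "z > 0" for z
  proof -
    have "((\<lambda>z. z / ?r) has_real_derivative 1 / ?r) (at z)"
      by (rule DERIV_cdivide[OF DERIV_ident])
    from DERIV_cdivide[OF DERIV_chain2[OF c(2) this], of ?r]
    have "((\<lambda>z. \<psi>' (z / ?r) / ?r) has_real_derivative
      (l * \<psi> (z / ?r) - alpha s / (z / ?r) * \<psi>' (z / ?r)) * (1 / ?r) / ?r) (at z)"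
      using that r by simp
    moreover have "(l * \<psi> (z / ?r) - alpha s / (z / ?r) * \<psi>' (z / ?r)) * (1 / ?r) / ?r
       = 1 * \<psi> (z / ?r) - alpha s / z * (\<psi>' (z / ?r) / ?r)"
    proof -
      have "(l * \<psi> (z / ?r) - alpha s / (z / ?r) * \<psi>' (z / ?r)) * (1 / ?r) / ?r
        = (l * \<psi> (z / ?r) - alpha s / (z / ?r) * \<psi>' (z / ?r)) / (?r * ?r)" by simp
      also have "\<dots> = (?r * ?r * \<psi> (z / ?r) - alpha s / (z / ?r) * \<psi>' (z / ?r)) / (?r * ?r)"
        by (simp only: r(2))
      also have "\<dots> = 1 * \<psi> (z / ?r) - alpha s / z * (\<psi>' (z / ?r) / ?r)"
        using r(1) that by (simp add: divide_simps del: real_sqrt_mult_self) (simp add: algebra_simps del: real_sqrt_mult_self)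
      finally show ?thesis .
    qed
    ultimately show ?thesis by simp
  qed
  show ?thesis unfolding profile_def
  proof (intro conjI exI[of _ "\<lambda>z. \<psi>' (z / ?r) / ?r"] allI impI)
    show "continuous_on {0..} (\<lambda>z. \<psi> (z / ?r))"
      using r by (intro continuous_on_compose2[OF p(1)] continuous_intros) auto
    show "((\<lambda>z. \<psi> (z / ?r)) \<longlongrightarrow> 0) at_top"
    proof (rule filterlim_compose[OF p(3)])
      show "filterlim (\<lambda>z. z / ?r) at_top at_top"
        using filterlim_tendsto_pos_mult_at_top[OF tendsto_const[of "1 / ?r"] _ filterlim_ident] r by simp
    qed
  qed (use d1 d2 p in auto)
qed


text \<open>The behaviour of \<open>z\<^sup>s K\<^sub>s(z)\<close> at 0 and at infinity, read off from the equation. The flux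
\<open>q(z) = z\<^sup>\<alpha> \<rho>'(z)\<close> has derivative \<open>z\<^sup>\<alpha> \<rho>(z) \<ge> 0\<close>. It is therefore increasing; it is nonpositive, as \<open>\<rho>\<close> would
otherwise grow, and bounded near 0. Exponential decay of \<open>\<rho>\<close> comes from the supersolution
\<open>e\<^sup>-\<^sup>\<delta>\<^sup>z\<close> of the equation, \<open>\<delta> < 1\<close>, on a half-line, and is passed on to \<open>\<rho>'\<close> by the mean value theorem and
the monotonicity of \<open>q\<close>. The bounds are stated for \<open>z\<^sup>2 \<rho>\<close> and \<open>z \<rho>'\<close>, the form in which
\<open>profile_derivs_bound\<close> starts its induction.\<close>

lemma profile_decay:
  assumes s: "0 < s" "s < 1" and prof: "profile s 1 \<rho>" and \<delta>: "0 < \<delta>" "\<delta> < 1"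
  shows "\<exists>\<rho>' C. C > 0 \<and> (\<forall>z>0. (\<rho> has_real_derivative \<rho>' z) (at z) \<and>
    (\<rho>' has_real_derivative (\<rho> z - alpha s / z * \<rho>' z)) (at z) \<and> 0 \<le> \<rho> z \<and> \<rho> z \<le> 1 \<and>
    z\<^sup>2 * \<rho> z \<le> C * z powr (2 * s) * exp (- \<delta> * z) \<and>
    \<bar>z * \<rho>' z\<bar> \<le> C * z powr (2 * s) * exp (- \<delta> * z))"
proof -
  obtain \<rho>' where d1: "\<And>y. y > 0 \<Longrightarrow> (\<rho> has_real_derivative \<rho>' y) (at y)"
      and d2: "\<And>y. y > 0 \<Longrightarrow> (\<rho>' has_real_derivative (\<rho> y - alpha s / y * \<rho>' y)) (at y)"
      and cont: "continuous_on {0..} \<rho>" and r0: "\<rho> 0 = 1" and lim: "(\<rho> \<longlongrightarrow> 0) at_top"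
    using prof unfolding profile_def by auto
  define \<alpha> where "\<alpha> = alpha s"
  have \<alpha>: "\<bar>\<alpha>\<bar> < 1" "\<alpha> = 1 - 2 * s" using s by (auto simp: \<alpha>_def alpha_def)
  have nonneg: "0 \<le> \<rho> z" if "0 \<le> z" for z
  proof -
    have "- \<rho> z \<le> 0"
    proof (rule max_principle[where a = 0 and w = "\<lambda>z. - \<rho> z" and w' = "\<lambda>z. - \<rho>' z"
          and w'' = "\<lambda>y. - (\<rho> y - alpha s / y * \<rho>' y)"])
      show "continuous_on {0..} (\<lambda>z. - \<rho> z)" by (intro continuous_intros cont)
      show "((\<lambda>z. - \<rho> z) \<longlongrightarrow> 0) at_top" using tendsto_minus[OF lim] by simp
    qed (use that r0 DERIV_minus[OF d1] DERIV_minus[OF d2] in auto)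
    thus ?thesis by simp
  qed
  define q where "q z = z powr \<alpha> * \<rho>' z" for z
  have dq: "(q has_real_derivative z powr \<alpha> * \<rho> z) (at z)" if "z > 0" for z
  proof -
    have "(q has_real_derivative (\<alpha> * z powr (\<alpha> - 1)) * \<rho>' z + (\<rho> z - alpha s / z * \<rho>' z) * z powr \<alpha>) (at z)"
      unfolding q_def using that has_real_derivative_powr[OF that, of \<alpha>] d2[OF that]
      by (intro DERIV_mult) auto
    moreover have "(\<alpha> * z powr (\<alpha> - 1)) * \<rho>' z + (\<rho> z - alpha s / z * \<rho>' z) * z powr \<alpha> = z powr \<alpha> * \<rho> z"
      using that by (simp add: powr_diff \<alpha>_def[symmetric] field_simps)
    ultimately show ?thesis by simp
  qed
  have qmono: "q x \<le> q z" if "0 < x" "x \<le> z" for x z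
  proof (rule DERIV_nonneg_imp_nondecreasing[of x z q])
    show "\<exists>y. (q has_real_derivative y) (at u) \<and> 0 \<le> y" if "x \<le> u" "u \<le> z" for u
      using dq[of u] nonneg[of u] that \<open>0 < x\<close> by (intro exI[of _ "u powr \<alpha> * \<rho> u"]) auto
  qed fact
  have qneg: "q z \<le> 0" if "0 < z" for z
  proof (rule ccontr)
    assume a: "\<not> q z \<le> 0"
    have pos: "0 < \<rho>' x" if "z \<le> x" for x
      using a qmono[OF \<open>0 < z\<close> that] \<open>0 < z\<close> that unfolding q_def
      by (smt (verit) mult_nonneg_nonpos powr_ge_zero)
    have inc: "\<rho> x < \<rho> y" if "z \<le> x" "x < y" for x y
    proof (rule DERIV_pos_imp_increasing[of x y \<rho>])
      show "\<exists>k. (\<rho> has_real_derivative k) (at u) \<and> 0 < k" if "x \<le> u" "u \<le> y" for u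
        using d1[of u] pos[of u] that \<open>z \<le> x\<close> \<open>0 < z\<close> by (intro exI[of _ "\<rho>' u"]) auto
    qed fact
    have "0 < \<rho> (z + 1)" using inc[of z "z + 1"] nonneg[of z] \<open>0 < z\<close> by auto
    from order_tendstoD(2)[OF lim this] obtain b where "\<And>x. b \<le> x \<Longrightarrow> \<rho> x < \<rho> (z + 1)"
      by (auto simp: eventually_at_top_linorder)
    from this[of "max b (z + 2)"] inc[of "z + 1" "max b (z + 2)"] show False
      by (simp add: less_max_iff_disj)
  qed
  have neg: "\<rho>' z \<le> 0" if "0 < z" for z
    using qneg[OF that] that unfolding q_def by (simp add: mult_le_0_iff)
  have dec: "\<rho> y \<le> \<rho> x" if "0 \<le> x" "x \<le> y" for x y
  proof (rule DERIV_nonpos_imp_decreasing_open[of x y \<rho>])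
    show "\<exists>k. (\<rho> has_real_derivative k) (at u) \<and> k \<le> 0" if "x < u" "u < y" for u
      using d1[of u] neg[of u] that \<open>0 \<le> x\<close> by (intro exI[of _ "\<rho>' u"]) auto
    show "continuous_on {x..y} \<rho>" using \<open>0 \<le> x\<close> by (intro continuous_on_subset[OF cont]) auto
  qed fact
  have le1: "\<rho> z \<le> 1" if "0 \<le> z" for z using dec[of 0 z] that r0 by simp
  \<comment> \<open>As \<open>\<rho> \<le> 1\<close>, the function \<open>q(z) - z\<^sup>\<alpha>\<^sup>+\<^sup>1 / (\<alpha> + 1)\<close> is decreasing; this bounds \<open>q\<close> from below on \<open>(0, 2]\<close>.\<close>
  define Q where "Q = 2 powr (\<alpha> + 1) / (\<alpha> + 1) - q 2"
  have Q: "- q z \<le> Q" if "0 < z" "z \<le> 2" for z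
  proof -
    define e where "e z = q z - z powr (\<alpha> + 1) / (\<alpha> + 1)" for z
    have de: "(e has_real_derivative x powr \<alpha> * \<rho> x - x powr \<alpha>) (at x)" if "0 < x" for x
    proof -
      have "(e has_real_derivative x powr \<alpha> * \<rho> x - (\<alpha> + 1) * x powr (\<alpha> + 1 - 1) / (\<alpha> + 1)) (at x)"
        unfolding e_def by (intro DERIV_diff DERIV_cdivide dq has_real_derivative_powr that)
      thus ?thesis using \<alpha>(1) by simp
    qed
    have "e 2 \<le> e z"
    proof (rule DERIV_nonpos_imp_nonincreasing[of z 2 e])
      show "\<exists>k. (e has_real_derivative k) (at u) \<and> k \<le> 0" if "z \<le> u" "u \<le> 2" for u
        using de[of u] le1[of u] that \<open>0 < z\<close>
        by (intro exI[of _ "u powr \<alpha> * \<rho> u - u powr \<alpha>"]) (auto simp: mult_left_le)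
    qed fact
    moreover have "0 \<le> z powr (\<alpha> + 1) / (\<alpha> + 1)" using \<alpha>(1) by auto
    ultimately show ?thesis unfolding e_def Q_def by linarith
  qed
  define \<delta>' where "\<delta>' = (1 + \<delta>) / 2"
  define \<epsilon> where "\<epsilon> = \<delta>' - \<delta>"
  have \<delta>': "0 < \<delta>'" "\<delta>' < 1" "0 < \<epsilon>" using \<delta> by (auto simp: \<delta>'_def \<epsilon>_def field_simps)
  have sq1: "\<delta>'\<^sup>2 < 1" using \<delta>' by (simp add: abs_square_less_1)
  \<comment> \<open>Beyond \<open>z0\<close> the exponential is a supersolution: \<open>1 - \<delta>'\<^sup>2 + \<alpha> \<delta>' / z \<ge> 0\<close>.\<close>
  define z0 where "z0 = max 1 (\<bar>\<alpha>\<bar> * \<delta>' / (1 - \<delta>'\<^sup>2))"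
  define M where "M = exp (\<delta>' * z0)"
  have M: "M > 0" "z0 \<ge> 1" by (auto simp: M_def z0_def)
  have decay: "\<rho> z \<le> M * exp (- \<delta>' * z)" if "0 \<le> z" for z
  proof (cases "z \<le> z0")
    case True
    have "1 \<le> M * exp (- \<delta>' * z)"
      unfolding M_def exp_add[symmetric] using True \<delta>' by (simp add: algebra_simps)
    thus ?thesis using le1[OF that] by simp
  next
    case False
    have "\<rho> z - M * exp (- \<delta>' * z) \<le> 0"
    proof (rule max_principle[where a = z0 and w = "\<lambda>z. \<rho> z - M * exp (- \<delta>' * z)"
          and w' = "\<lambda>z. \<rho>' z - M * (exp (- \<delta>' * z) * (- \<delta>'))"
          and w'' = "\<lambda>y. (\<rho> y - alpha s / y * \<rho>' y) - M * (exp (- \<delta>' * y) * (- \<delta>') * (- \<delta>'))"])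
      show "continuous_on {z0..} (\<lambda>z. \<rho> z - M * exp (- \<delta>' * z))"
        using M by (intro continuous_intros continuous_on_subset[OF cont]) auto
      show "\<rho> z0 - M * exp (- \<delta>' * z0) \<le> 0"
        using le1[of z0] M by (simp add: M_def exp_add[symmetric])
      have "((\<lambda>z. exp (- \<delta>' * z)) \<longlongrightarrow> 0) at_top"
        using \<delta>'(1) by (intro filterlim_compose[OF exp_at_bot] filterlim_tendsto_neg_mult_at_bot[OF tendsto_const _ filterlim_ident]) auto
      thus "((\<lambda>z. \<rho> z - M * exp (- \<delta>' * z)) \<longlongrightarrow> 0) at_top"
        using tendsto_diff[OF lim tendsto_mult[OF tendsto_const[of M]]] by fastforce
      fix y assume y: "z0 < y"
      hence y0: "0 < y" using M by simp
      show "((\<lambda>z. \<rho> z - M * exp (- \<delta>' * z)) has_real_derivative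
          \<rho>' y - M * (exp (- \<delta>' * y) * (- \<delta>'))) (at y)"
        by (auto intro!: derivative_eq_intros d1[OF y0])
      show "((\<lambda>z. \<rho>' z - M * (exp (- \<delta>' * z) * (- \<delta>'))) has_real_derivative
          (\<rho> y - alpha s / y * \<rho>' y) - M * (exp (- \<delta>' * y) * (- \<delta>') * (- \<delta>'))) (at y)"
        by (auto intro!: derivative_eq_intros d2[OF y0])
      assume w: "0 < \<rho> y - M * exp (- \<delta>' * y)" and w': "\<rho>' y - M * (exp (- \<delta>' * y) * (- \<delta>')) = 0"
      have "\<rho>' y = - (M * exp (- \<delta>' * y) * \<delta>')" using w' by simp
      hence eq: "(\<rho> y - alpha s / y * \<rho>' y) - M * (exp (- \<delta>' * y) * (- \<delta>') * (- \<delta>'))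
        = (\<rho> y - M * exp (- \<delta>' * y)) + M * exp (- \<delta>' * y) * (1 - \<delta>'\<^sup>2 + \<alpha> * \<delta>' / y)"
        by (simp add: \<alpha>_def algebra_simps power2_eq_square)
      have "0 \<le> 1 - \<delta>'\<^sup>2 + \<alpha> * \<delta>' / y"
      proof -
        have "\<bar>\<alpha>\<bar> * \<delta>' / (1 - \<delta>'\<^sup>2) \<le> y" using y by (simp add: z0_def)
        hence "\<bar>\<alpha>\<bar> * \<delta>' / y \<le> 1 - \<delta>'\<^sup>2" using y0 sq1 by (simp add: field_simps)
        moreover have "- (\<bar>\<alpha>\<bar> * \<delta>' / y) \<le> \<alpha> * \<delta>' / y"
        proof -
          have "(- \<bar>\<alpha>\<bar>) * (\<delta>' / y) \<le> \<alpha> * (\<delta>' / y)" using \<delta>'(1) y0 by (intro mult_right_mono) auto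
          thus ?thesis by simp
        qed
        ultimately show ?thesis by linarith
      qed
      thus "0 < (\<rho> y - alpha s / y * \<rho>' y) - M * (exp (- \<delta>' * y) * (- \<delta>') * (- \<delta>'))"
        unfolding eq using w M(1) by (intro add_pos_nonneg mult_nonneg_nonneg) auto
    qed (use False in simp)
    thus ?thesis by simp
  qed
  have split: "exp (- \<delta>' * z) = exp (- \<epsilon> * z) * exp (- \<delta> * z)" for z
    by (simp add: exp_add[symmetric] \<epsilon>_def algebra_simps)
  have lin: "z * exp (- \<epsilon> * z) \<le> 1 / \<epsilon>" for z
  proof -
    have "\<epsilon> * z \<le> exp (\<epsilon> * z)" using exp_ge_add_one_self[of "\<epsilon> * z"] by linarith
    thus ?thesis using \<delta>' by (simp add: exp_minus field_simps)
  qed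
  have quad: "z\<^sup>2 * exp (- \<epsilon> * z) \<le> (2 / \<epsilon>)\<^sup>2" if "0 \<le> z" for z
  proof -
    have "\<epsilon> * z / 2 \<le> exp (\<epsilon> * z / 2)" using exp_ge_add_one_self[of "\<epsilon> * z / 2"] by linarith
    hence "(\<epsilon> * z / 2)\<^sup>2 \<le> (exp (\<epsilon> * z / 2))\<^sup>2" using that \<delta>' by (intro power_mono) auto
    also have "(exp (\<epsilon> * z / 2))\<^sup>2 = exp (\<epsilon> * z)" by (simp add: exp_double[symmetric])
    finally show ?thesis using \<delta>' by (simp add: exp_minus field_simps power2_eq_square)
  qed
  define C where "C = M + M * (2 / \<epsilon>)\<^sup>2 + \<bar>Q\<bar> * exp (2 * \<delta>) + M * exp \<delta>' / \<epsilon>"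
  have C: "C > 0" "M \<le> C" "M * (2 / \<epsilon>)\<^sup>2 \<le> C" "\<bar>Q\<bar> * exp (2 * \<delta>) \<le> C" "M * exp \<delta>' / \<epsilon> \<le> C"
    using M(1) \<delta>'(3) unfolding C_def by (auto intro!: add_pos_nonneg)
  have b0: "z\<^sup>2 * \<rho> z \<le> C * z powr (2 * s) * exp (- \<delta> * z)" if z: "0 < z" for z
  proof (cases "z \<le> 1")
    case True
    have "z\<^sup>2 = z powr 2" using z by (simp add: powr_numeral)
    also have "\<dots> \<le> z powr (2 * s)" using z True s by (intro powr_mono') auto
    finally have "z\<^sup>2 * \<rho> z \<le> z powr (2 * s) * (M * (exp (- \<epsilon> * z) * exp (- \<delta> * z)))"
      using decay[of z] nonneg[of z] z unfolding split by (intro mult_mono) auto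
    also have "\<dots> \<le> z powr (2 * s) * (C * (1 * exp (- \<delta> * z)))"
      using C M \<delta>' z by (intro mult_left_mono mult_mono) auto
    finally show ?thesis by (simp add: mult_ac)
  next
    case False
    have "z\<^sup>2 * \<rho> z \<le> z\<^sup>2 * (M * (exp (- \<epsilon> * z) * exp (- \<delta> * z)))"
      using decay[of z] z unfolding split by (intro mult_left_mono) auto
    also have "\<dots> = M * (z\<^sup>2 * exp (- \<epsilon> * z)) * exp (- \<delta> * z)" by (simp add: mult_ac)
    also have "\<dots> \<le> M * (2 / \<epsilon>)\<^sup>2 * exp (- \<delta> * z)"
      using quad[of z] z M by (intro mult_right_mono mult_left_mono) auto
    also have "\<dots> \<le> C * 1 * exp (- \<delta> * z)" using C by (intro mult_right_mono) auto
    also have "\<dots> \<le> C * z powr (2 * s) * exp (- \<delta> * z)"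
      using C False s by (intro mult_right_mono mult_left_mono ge_one_powr_ge_zero) auto
    finally show ?thesis .
  qed
  have b1: "\<bar>z * \<rho>' z\<bar> \<le> C * z powr (2 * s) * exp (- \<delta> * z)" if z: "0 < z" for z
  proof -
    have eq: "\<bar>z * \<rho>' z\<bar> = z powr (2 * s) * (- q z)"
    proof -
      have "z powr (2 * s) * z powr \<alpha> = z" using z \<alpha>(2) by (simp add: powr_add[symmetric])
      moreover have "\<bar>z * \<rho>' z\<bar> = - (z * \<rho>' z)" using neg[OF z] z by (simp add: mult_nonneg_nonpos)
      ultimately show ?thesis unfolding q_def by (metis mult.assoc mult_minus_right)
    qed
    have "- q z \<le> C * exp (- \<delta> * z)"
    proof (cases "z \<le> 2")
      case True
      have "- q z \<le> \<bar>Q\<bar> * 1" using Q[OF z True] by simp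
      also have "\<dots> \<le> \<bar>Q\<bar> * exp (2 * \<delta> - \<delta> * z)"
        using True \<delta> by (intro mult_left_mono) auto
      also have "\<dots> = \<bar>Q\<bar> * exp (2 * \<delta>) * exp (- \<delta> * z)" by (simp add: exp_add[symmetric])
      also have "\<dots> \<le> C * exp (- \<delta> * z)" using C by (intro mult_right_mono) auto
      finally show ?thesis .
    next
      case False
      obtain x where x: "z - 1 < x" "x < z" "\<rho> z - \<rho> (z - 1) = (z - (z - 1)) * \<rho>' x"
        using MVT2[of "z - 1" z \<rho> \<rho>'] d1 False by auto
      have "- q z \<le> - q x" using qmono[of x z] x False by simp
      also have "- q x = x powr \<alpha> * (- \<rho>' x)" by (simp add: q_def)
      also have "\<dots> \<le> z * (M * exp (- \<delta>' * (z - 1)))"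
      proof (rule mult_mono)
        have "x powr \<alpha> \<le> x powr 1" using x False \<alpha>(1) by (intro powr_mono) auto
        thus "x powr \<alpha> \<le> z" using x False by simp
        show "- \<rho>' x \<le> M * exp (- \<delta>' * (z - 1))"
          using x(3) nonneg[of z] decay[of "z - 1"] False by simp
      qed (use z neg[of x] x False in auto)
      also have "exp (- \<delta>' * (z - 1)) = exp \<delta>' * (exp (- \<epsilon> * z) * exp (- \<delta> * z))"
        by (simp add: exp_add[symmetric] \<epsilon>_def algebra_simps)
      also have "z * (M * (exp \<delta>' * (exp (- \<epsilon> * z) * exp (- \<delta> * z))))
         = M * exp \<delta>' * (z * exp (- \<epsilon> * z)) * exp (- \<delta> * z)" by (simp add: mult_ac)
      also have "\<dots> \<le> M * exp \<delta>' * (1 / \<epsilon>) * exp (- \<delta> * z)"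
        using lin[of z] M by (intro mult_right_mono mult_left_mono) auto
      also have "\<dots> \<le> C * exp (- \<delta> * z)" using C by (intro mult_right_mono) auto
      finally show ?thesis .
    qed
    hence "z powr (2 * s) * (- q z) \<le> z powr (2 * s) * (C * exp (- \<delta> * z))"
      by (intro mult_left_mono) auto
    thus ?thesis unfolding eq by (simp only: mult_ac)
  qed
  show ?thesis
    using C(1) d1 d2 nonneg le1 b0 b1 by (intro exI[of _ \<rho>'] exI[of _ C]) auto
qed

text \<open>The derivatives of a solution \<open>r\<close> of \<open>z r'' + a r' = z r\<close>: differentiating this equation \<open>n\<close> times and
solving for the highest order expresses \<open>r\<^sup>(\<^sup>n\<^sup>+\<^sup>2\<^sup>)\<close> by the three preceding derivatives. For \<open>n = 0\<close> the last
term carries the factor 0.\<close>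

fun profile_derivs :: "real \<Rightarrow> (real \<Rightarrow> real) \<Rightarrow> (real \<Rightarrow> real) \<Rightarrow> nat \<Rightarrow> real \<Rightarrow> real" where
  "profile_derivs a r r' 0 z = r z"
| "profile_derivs a r r' (Suc 0) z = r' z"
| "profile_derivs a r r' (Suc (Suc n)) z = - (real n + a) / z * profile_derivs a r r' (Suc n) z
     + profile_derivs a r r' n z + real n / z * profile_derivs a r r' (n - 1) z"

lemma profile_derivs_deriv:
  assumes d1: "\<And>y. y > 0 \<Longrightarrow> (r has_real_derivative r' y) (at y)"
    and d2: "\<And>y. y > 0 \<Longrightarrow> (r' has_real_derivative (r y - a / y * r' y)) (at y)"
    and "z > 0"
  shows "(profile_derivs a r r' m has_real_derivative profile_derivs a r r' (Suc m) z) (at z)"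
proof (induction m rule: less_induct)
  case (less m)
  let ?P = "profile_derivs a r r'"
  consider "m = 0" | "m = 1" | n where "m = Suc (Suc n)" by (metis One_nat_def not0_implies_Suc)
  thus ?case
  proof cases
    case 1
    have "?P 0 = r" "?P (Suc 0) = r'" by (auto simp: fun_eq_iff)
    thus ?thesis using d1[OF \<open>z > 0\<close>] 1 by simp
  next
    case 2
    have "?P 1 = r'" "?P (Suc 1) z = r z - a / z * r' z" by (auto simp: fun_eq_iff)
    thus ?thesis using d2[OF \<open>z > 0\<close>] 2 by simp
  next
    case 3
    have D1: "(?P (Suc n) has_real_derivative ?P (Suc (Suc n)) z) (at z)"
      and D0: "(?P n has_real_derivative ?P (Suc n) z) (at z)" using less.IH[of "Suc n"] less.IH[of n] 3 by (simp_all del: profile_derivs.simps)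
    have q: "((\<lambda>z. k / z) has_real_derivative - k / z^2) (at z)" for k
      using \<open>z > 0\<close> by (auto intro!: derivative_eq_intros simp: power2_eq_square)
    have Dm: "((\<lambda>z. real n / z * ?P (n - 1) z) has_real_derivative
        - real n / z^2 * ?P (n - 1) z + ?P n z * (real n / z)) (at z)"
    proof (cases n)
      case (Suc j)
      have "(?P (n - 1) has_real_derivative ?P n z) (at z)" using less.IH[of "n - 1"] 3 Suc
        by (simp del: profile_derivs.simps)
      from DERIV_mult[OF q this] show ?thesis .
    qed simp
    have eq: "?P m = (\<lambda>z. - (real n + a) / z * ?P (Suc n) z + ?P n z + real n / z * ?P (n - 1) z)"
      using 3 by (simp add: fun_eq_iff)
    have "(?P m has_real_derivative
       (- (- (real n + a)) / z^2 * ?P (Suc n) z + ?P (Suc (Suc n)) z * (- (real n + a) / z))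
       + ?P (Suc n) z + (- real n / z^2 * ?P (n - 1) z + ?P n z * (real n / z))) (at z)"
      unfolding eq by (intro DERIV_add DERIV_mult[OF q D1] D0 Dm)
    moreover have "(- (- (real n + a)) / z^2 * ?P (Suc n) z + ?P (Suc (Suc n)) z * (- (real n + a) / z))
       + ?P (Suc n) z + (- real n / z^2 * ?P (n - 1) z + ?P n z * (real n / z)) = ?P (Suc m) z"
      using \<open>z > 0\<close> 3 by (simp add: field_simps power2_eq_square)
    ultimately show ?thesis by simp
  qed
qed

definition exp_partial :: "nat \<Rightarrow> real \<Rightarrow> real" where
  "exp_partial m x = (\<Sum>j\<le>m. x ^ j / fact j)"

lemma exp_partial_ge_1: "0 \<le> x \<Longrightarrow> 1 \<le> exp_partial m x"
  unfolding exp_partial_def by (subst sum.atMost_shift) (auto intro!: sum_nonneg)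

lemma exp_partial_mono: "0 \<le> x \<Longrightarrow> m \<le> n \<Longrightarrow> exp_partial m x \<le> exp_partial n x"
  unfolding exp_partial_def by (intro sum_mono2) auto

lemma exp_partial_le_exp: "0 \<le> x \<Longrightarrow> exp_partial m x \<le> exp x"
proof -
  assume x: "0 \<le> x"
  have "(\<lambda>j. x ^ j / fact j) sums exp x"
    using exp_converges[of x] by (simp add: scaleR_conv_of_real field_simps)
  thus ?thesis unfolding exp_partial_def using x
    by (metis (no_types, lifting) finite_atMost sum_le_suminf sums_iff divide_nonneg_nonneg fact_ge_zero zero_le_power)
qed

text \<open>Comparing coefficients: \<open>x\<^sup>2 x\<^sup>j / j! = (j+1)(j+2) x\<^sup>j\<^sup>+\<^sup>2 / (j+2)!\<close>, and \<open>j \<le> n\<close>.\<close>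

lemma exp_partial_shift:
  assumes "0 \<le> x"
  shows "x\<^sup>2 * exp_partial n x \<le> (real n + 1) * (real n + 2) * exp_partial (n + 2) x"
proof -
  have "x\<^sup>2 * exp_partial n x = (\<Sum>j\<le>n. x\<^sup>2 * (x ^ j / fact j))"
    by (simp add: exp_partial_def sum_distrib_left)
  also have "\<dots> \<le> (\<Sum>j\<le>n. (real n + 1) * (real n + 2) * (x ^ (j + 2) / fact (j + 2)))"
  proof (rule sum_mono)
    fix j assume j: "j \<in> {..n}"
    have "x\<^sup>2 * (x ^ j / fact j) = (real j + 1) * (real j + 2) * (x ^ (j + 2) / fact (j + 2))"
    proof -
      define c where "c = (real j + 1) * (real j + 2)"
      have "fact (j + 2) = c * fact j" by (simp add: c_def algebra_simps)
      moreover have "c \<noteq> 0" unfolding c_def by (simp add: add_nonneg_pos less_imp_neq[symmetric])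
      ultimately have "fact (j + 2) = c * fact j" "c \<noteq> 0" by auto
      thus ?thesis unfolding c_def[symmetric] by (simp add: power_add power2_eq_square mult.commute del: fact_Suc)
    qed
    also have "\<dots> \<le> (real n + 1) * (real n + 2) * (x ^ (j + 2) / fact (j + 2))"
      using j assms by (intro mult_right_mono mult_mono) auto
    finally show "x\<^sup>2 * (x ^ j / fact j) \<le> (real n + 1) * (real n + 2) * (x ^ (j + 2) / fact (j + 2))" .
  qed
  also have "\<dots> = (real n + 1) * (real n + 2) * (\<Sum>j\<in>(\<lambda>j. j + 2) ` {..n}. x ^ j / fact j)"
    by (subst sum.reindex) (auto simp: sum_distrib_left inj_on_def)
  also have "\<dots> \<le> (real n + 1) * (real n + 2) * exp_partial (n + 2) x"
    unfolding exp_partial_def using assms by (intro mult_left_mono sum_mono2) auto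
  finally show ?thesis .
qed

text \<open>With \<open>a\<^sub>m = z\<^sup>m \<bar>r\<^sup>(\<^sup>m\<^sup>)(z)\<bar> / m!\<close> the recursion reads
\<open>a\<^sub>n\<^sub>+\<^sub>2 \<le> a\<^sub>n\<^sub>+\<^sub>1 + z\<^sup>2 (a\<^sub>n + a\<^sub>n\<^sub>-\<^sub>1) / ((n+1)(n+2))\<close>. A purely geometric bound \<open>K\<^sup>m\<close> fails for large \<open>z\<close> because of
the factor \<open>z\<^sup>2\<close>. The partial sums of \<open>e\<^sup>\<epsilon>\<^sup>z\<close> absorb it by \<open>exp_partial_shift\<close>, and cost only an
arbitrarily small exponential rate. The value \<open>r(z)\<close> enters only as \<open>z\<^sup>2 r(z)\<close>: for
a profile this is of order \<open>z\<^sup>2\<^sup>s\<close> near 0, like \<open>z r'(z)\<close>, whereas \<open>r(z)\<close> tends to 1. So the induction starts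
at \<open>m = 1\<close>, and the cases up to 3, where \<open>r\<close> itself occurs in the recursion, are done separately.\<close>

lemma profile_derivs_bound:
  fixes \<epsilon> :: real
  assumes \<epsilon>: "0 < \<epsilon>" and K: "2 + 2 / \<epsilon>\<^sup>2 \<le> K" and a: "\<bar>a\<bar> \<le> 1" and z: "0 < z"
    and r0: "z\<^sup>2 * \<bar>r z\<bar> \<le> D" and r1: "\<bar>z * r' z\<bar> \<le> D" and "1 \<le> m"
  shows "z ^ m * \<bar>profile_derivs a r r' m z\<bar> \<le> D * (fact m * K ^ m * exp_partial m (\<epsilon> * z))"
  using \<open>1 \<le> m\<close>
proof (induction m rule: less_induct)
  case (less m)
  let ?P = "\<lambda>m. \<bar>profile_derivs a r r' m z\<bar>" and ?E = "\<lambda>m. exp_partial m (\<epsilon> * z)"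
  have D: "0 \<le> D" using r1 by linarith
  have x: "0 \<le> \<epsilon> * z" using \<epsilon> z by simp
  have K2: "2 \<le> K" "2 / \<epsilon>\<^sup>2 \<le> K" using K \<epsilon> by (auto simp: add_increasing2 order_trans[rotated])
  have E1: "1 \<le> ?E m" for m using exp_partial_ge_1[OF x] .
  have E: "z\<^sup>2 * ?E n \<le> (real n + 1) * (real n + 2) * ?E (n + 2) / \<epsilon>\<^sup>2" for n
    using exp_partial_shift[OF x, of n] \<epsilon> by (simp add: power_mult_distrib field_simps)
  have rec: "z ^ Suc (Suc n) * ?P (Suc (Suc n)) \<le> (real n + 1) * (z ^ Suc n * ?P (Suc n))
      + z\<^sup>2 * (z ^ n * ?P n) + real n * (z ^ Suc n * ?P (n - 1))" for n
  proof -
    have "?P (Suc (Suc n)) \<le> \<bar>- (real n + a) / z * profile_derivs a r r' (Suc n) z\<bar> + ?P n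
       + \<bar>real n / z * profile_derivs a r r' (n - 1) z\<bar>"
      unfolding profile_derivs.simps
      by (intro order_trans[OF abs_triangle_ineq] add_right_mono abs_triangle_ineq)
    also have "\<dots> = \<bar>real n + a\<bar> / z * ?P (Suc n) + ?P n + real n / z * ?P (n - 1)"
      using z by (simp only: abs_mult abs_divide abs_minus_cancel) simp
    also have "\<dots> \<le> (real n + 1) / z * ?P (Suc n) + ?P n + real n / z * ?P (n - 1)"
      using z a by (intro add_right_mono mult_right_mono divide_right_mono) auto
    finally have "z ^ Suc (Suc n) * ?P (Suc (Suc n)) \<le> z ^ Suc (Suc n) *
        ((real n + 1) / z * ?P (Suc n) + ?P n + real n / z * ?P (n - 1))"
      using z by (intro mult_left_mono) auto
    also have "\<dots> = (real n + 1) * (z ^ Suc n * ?P (Suc n))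
      + z\<^sup>2 * (z ^ n * ?P n) + real n * (z ^ Suc n * ?P (n - 1))"
      using z by (simp add: field_simps power2_eq_square)
    finally show ?thesis .
  qed
  consider "m = 1" | "m = 2" | "m = 3" | n where "m = Suc (Suc n)" "2 \<le> n"
    using less.prems by (metis One_nat_def Suc_1 Suc_leI le_antisym not_less_eq_eq numeral_3_eq_3 Suc_le_D)
  thus ?case
  proof cases
    case 1
    have "1 * 1 \<le> K * ?E 1" using E1[of 1] K2 by (intro mult_mono) auto
    hence "D * 1 \<le> D * (K * ?E 1)" using D by (intro mult_left_mono) auto
    thus ?thesis using 1 r1 z by (simp add: abs_mult)
  next
    case 2
    have k: "1 * 1 \<le> K\<^sup>2 * ?E 2" using E1[of 2] K2 by (intro mult_mono one_le_power) auto
    have "z\<^sup>2 * ?P 2 \<le> \<bar>z * r' z\<bar> + z\<^sup>2 * \<bar>r z\<bar>"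
      using rec[of 0] z by (simp add: numeral_2_eq_2 abs_mult)
    also have "\<dots> \<le> D * (2 * 1)" using r0 r1 by simp
    also have "\<dots> \<le> D * (2 * (K\<^sup>2 * ?E 2))" using D k by (intro mult_left_mono) auto
    finally show ?thesis using 2 by simp
  next
    case 3
    have s3: "Suc (Suc 1) = m" "Suc 1 = 2" using 3 by auto
    have "z ^ 3 * ?P 3 \<le> 2 * (z\<^sup>2 * ?P 2) + z\<^sup>2 * (z * ?P 1) + z\<^sup>2 * ?P 0"
      using rec[of 1] unfolding s3 3 by simp
    also have "\<dots> \<le> 2 * (D * (2 * K\<^sup>2 * ?E 2)) + z\<^sup>2 * D + D"
      using less.IH[of 2] 3 r0 r1 z by (intro add_mono mult_left_mono) (auto simp: abs_mult)
    also have "\<dots> = D * (4 * (K\<^sup>2 * ?E 2) + z\<^sup>2 * 1 + 1)" by (simp add: algebra_simps)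
    also have "\<dots> \<le> D * (4 * (K\<^sup>2 * ?E 3) + 6 * ?E 3 / \<epsilon>\<^sup>2 + ?E 3)"
    proof (intro mult_left_mono add_mono D)
      show "?E 2 \<le> ?E 3" using exp_partial_mono[OF x] by simp
      have "z\<^sup>2 * 1 \<le> z\<^sup>2 * ?E 1" by (intro mult_left_mono E1) auto
      also have "\<dots> \<le> 6 * ?E 3 / \<epsilon>\<^sup>2" using E[of 1] by (simp add: numeral_3_eq_3)
      finally show "z\<^sup>2 * 1 \<le> 6 * ?E 3 / \<epsilon>\<^sup>2" .
    qed (use E1[of 3] in auto)
    also have "\<dots> = D * ((4 * K\<^sup>2 + 3 * (2 / \<epsilon>\<^sup>2) + 1) * ?E 3)" by (simp add: algebra_simps)
    also have "\<dots> \<le> D * ((6 * K ^ 3) * ?E 3)"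
    proof (intro mult_left_mono mult_right_mono D)
      have a: "2 * K \<le> K\<^sup>2" using mult_right_mono[of 2 K K] K2 by (simp add: power2_eq_square)
      have b: "2 * K\<^sup>2 \<le> K ^ 3"
        using mult_right_mono[OF K2(1), of "K\<^sup>2"] by (simp add: power3_eq_cube power2_eq_square)
      show "4 * K\<^sup>2 + 3 * (2 / \<epsilon>\<^sup>2) + 1 \<le> 6 * K ^ 3" using a b K2 by linarith
    qed (use E1[of 3] in auto)
    finally show ?thesis using 3 by (simp add: fact_numeral)
  next
    case 4
    have i1: "z ^ Suc n * ?P (Suc n) \<le> D * (fact (Suc n) * K ^ Suc n * ?E (Suc n))"
      and i0: "z ^ n * ?P n \<le> D * (fact n * K ^ n * ?E n)"
      and im: "z ^ (n - 1) * ?P (n - 1) \<le> D * (fact (n - 1) * K ^ (n - 1) * ?E (n - 1))"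
      using less.IH[of "Suc n"] less.IH[of n] less.IH[of "n - 1"] 4
      by (simp_all del: profile_derivs.simps fact_Suc power_Suc)
    obtain j where j: "n = Suc j" using 4 by (cases n) auto
    let ?F = "(real n + 1) * (real n + 2) * ?E (n + 2) / \<epsilon>\<^sup>2"
    have "z ^ m * ?P m \<le> (real n + 1) * (z ^ Suc n * ?P (Suc n)) + z\<^sup>2 * (z ^ n * ?P n)
        + real n * (z ^ Suc n * ?P (n - 1))" using rec[of n] 4 by simp
    also have "real n * (z ^ Suc n * ?P (n - 1)) = real n * z\<^sup>2 * (z ^ (n - 1) * ?P (n - 1))"
      using j by (simp add: power2_eq_square)
    also have "(real n + 1) * (z ^ Suc n * ?P (Suc n)) + z\<^sup>2 * (z ^ n * ?P n)
        + real n * z\<^sup>2 * (z ^ (n - 1) * ?P (n - 1))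
      \<le> (real n + 1) * (D * (fact (Suc n) * K ^ Suc n * ?E (Suc n))) + z\<^sup>2 * (D * (fact n * K ^ n * ?E n))
        + real n * z\<^sup>2 * (D * (fact (n - 1) * K ^ (n - 1) * ?E (n - 1)))"
      using z by (intro add_mono mult_left_mono i1 i0 im) auto
    also have "\<dots> = D * ((real n + 1) * fact (Suc n) * K ^ Suc n * ?E (Suc n)
        + fact n * K ^ n * (z\<^sup>2 * ?E n) + fact n * K ^ j * (z\<^sup>2 * ?E j))"
      using j by (simp add: algebra_simps)
    also have "\<dots> \<le> D * ((real n + 2) * fact (Suc n) * K ^ Suc n * ?E (n + 2)
        + fact n * K ^ n * ?F + fact n * K ^ n * ?F)"
    proof (intro mult_left_mono add_mono D)
      show "(real n + 1) * fact (Suc n) * K ^ Suc n * ?E (Suc n)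
         \<le> (real n + 2) * fact (Suc n) * K ^ Suc n * ?E (n + 2)"
        using K2 E1[of "Suc n"] exp_partial_mono[OF x, of "Suc n" "n + 2"]
        by (intro mult_mono) auto
      show "z\<^sup>2 * ?E n \<le> ?F" by (rule E)
      have "z\<^sup>2 * ?E j \<le> ?F"
        using E[of n] exp_partial_mono[OF x, of j n] j
        by (meson dual_order.trans le_SucI mult_left_mono order_refl zero_le_power2)
      moreover have "K ^ j \<le> K ^ n" using K2 j by (intro power_increasing) auto
      ultimately show "fact n * K ^ j * (z\<^sup>2 * ?E j) \<le> fact n * K ^ n * ?F"
        using K2 E1[of j] by (intro mult_mono) auto
    qed (use K2 in auto)
    also have "\<dots> = D * (fact m * ?E m * K ^ n * (K + 2 / \<epsilon>\<^sup>2))"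
      using 4 by (simp add: algebra_simps add_divide_distrib)
    also have "\<dots> \<le> D * (fact m * ?E m * K ^ n * (K * K))"
    proof (intro mult_left_mono D)
      show "K + 2 / \<epsilon>\<^sup>2 \<le> K * K" using mult_right_mono[of 2 K K] K2 by linarith
    qed (use K2 E1[of m] in auto)
    also have "\<dots> = D * (fact m * K ^ m * ?E m)" using 4 by (simp add: mult_ac)
    finally show ?thesis .
  qed
qed

text \<open>Apply \<open>profile_decay\<close> with a rate between \<open>\<delta>\<close> and 1 and spend the difference on the factor \<open>e\<^sup>\<epsilon>\<^sup>z\<close> of
\<open>profile_derivs_bound\<close>.\<close>

lemma unit_profile_derivs:
  assumes s: "0 < s" "s < 1" and prof: "profile s 1 \<rho>" and \<delta>: "0 < \<delta>" "\<delta> < 1"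
  shows "\<exists>P C K. 0 < C \<and> 1 < K \<and> P 0 = \<rho> \<and>
    (\<forall>m. \<forall>z>0. (P m has_real_derivative P (Suc m) z) (at z)) \<and> (\<forall>z>0. \<bar>\<rho> z\<bar> \<le> 1) \<and>
    (\<forall>m\<ge>1. \<forall>z>0. \<bar>P m z\<bar> \<le> C * K ^ m * fact m * z powr (2 * s - real m) * exp (- \<delta> * z))"
proof -
  define \<delta>' where "\<delta>' = (1 + \<delta>) / 2"
  define \<epsilon> where "\<epsilon> = \<delta>' - \<delta>"
  define K where "K = 2 + 2 / \<epsilon>\<^sup>2"
  have \<delta>': "0 < \<delta>'" "\<delta>' < 1" "0 < \<epsilon>" using \<delta> by (auto simp: \<delta>'_def \<epsilon>_def field_simps)
  obtain \<rho>' C where C: "C > 0" and r: "\<And>z. z > 0 \<Longrightarrow> (\<rho> has_real_derivative \<rho>' z) (at z)"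
      "\<And>z. z > 0 \<Longrightarrow> (\<rho>' has_real_derivative (\<rho> z - alpha s / z * \<rho>' z)) (at z)"
      and b: "\<And>z. z > 0 \<Longrightarrow> 0 \<le> \<rho> z" "\<And>z. z > 0 \<Longrightarrow> \<rho> z \<le> 1"
      "\<And>z. z > 0 \<Longrightarrow> z\<^sup>2 * \<rho> z \<le> C * z powr (2 * s) * exp (- \<delta>' * z)"
      "\<And>z. z > 0 \<Longrightarrow> \<bar>z * \<rho>' z\<bar> \<le> C * z powr (2 * s) * exp (- \<delta>' * z)"
    using profile_decay[OF s prof \<delta>'(1,2)] by blast
  have bnd: "\<bar>profile_derivs (alpha s) \<rho> \<rho>' m z\<bar> \<le> C * K ^ m * fact m * z powr (2 * s - real m) * exp (- \<delta> * z)"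
    if "1 \<le> m" "0 < z" for m z
  proof -
    let ?D = "C * z powr (2 * s) * exp (- \<delta>' * z)" and ?P = "\<bar>profile_derivs (alpha s) \<rho> \<rho>' m z\<bar>"
    have "z ^ m * ?P \<le> ?D * (fact m * K ^ m * exp_partial m (\<epsilon> * z))"
      using b[OF \<open>0 < z\<close>] s by (intro profile_derivs_bound \<delta>' that) (auto simp: K_def alpha_def)
    also have "\<dots> \<le> ?D * (fact m * K ^ m * exp (\<epsilon> * z))"
      using C that \<delta>' by (intro mult_left_mono exp_partial_le_exp) (auto simp: K_def)
    also have "\<dots> = C * K ^ m * fact m * z powr (2 * s) * (exp (- \<delta>' * z) * exp (\<epsilon> * z))"
      by (simp add: mult_ac)
    also have "exp (- \<delta>' * z) * exp (\<epsilon> * z) = exp (- \<delta> * z)"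
      by (simp add: exp_add[symmetric] \<epsilon>_def algebra_simps)
    also have "z powr (2 * s) = z ^ m * z powr (2 * s - real m)"
      using that by (simp add: powr_realpow[symmetric] powr_add[symmetric])
    finally have "z ^ m * ?P \<le> z ^ m * (C * K ^ m * fact m * z powr (2 * s - real m) * exp (- \<delta> * z))"
      by (simp only: mult_ac)
    thus ?thesis by (rule mult_left_le_imp_le) (use that in auto)
  qed
  have "1 < K" using \<delta>' by (auto simp: K_def add_pos_pos intro: add_strict_increasing)
  moreover have "profile_derivs (alpha s) \<rho> \<rho>' 0 = \<rho>" by (simp add: fun_eq_iff)
  moreover have "\<bar>\<rho> z\<bar> \<le> 1" if "0 < z" for z using b(1,2)[OF that] by simp
  ultimately show ?thesis using C bnd profile_derivs_deriv[of \<rho> \<rho>' "alpha s", OF r]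
    by (intro exI[of _ "profile_derivs (alpha s) \<rho> \<rho>'"] exI[of _ C] exI[of _ K]) auto
qed

lemma nn_integral_powr_exp:
  assumes "0 < p" "0 < \<mu>"
  shows "(\<integral>\<^sup>+ y\<in>{0<..}. ennreal (y powr (p - 1) * exp (- \<mu> * y)) \<partial>lborel) = ennreal (Gamma p * \<mu> powr (- p))"
proof -
  let ?f = "\<lambda>t::real. ennreal (indicat_real {0..} t * t powr (p - 1) / exp t)"
  have "ennreal (Gamma p) = \<bar>\<mu>\<bar> * (\<integral>\<^sup>+ y. ?f (0 + \<mu> * y) \<partial>lborel)"
    unfolding Gamma_conv_nn_integral_real[OF assms(1)]
    using assms by (intro nn_integral_real_affine) auto
  also have "(\<integral>\<^sup>+ y. ?f (0 + \<mu> * y) \<partial>lborel) =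
      (\<integral>\<^sup>+ y. ennreal (\<mu> powr (p - 1)) * (ennreal (y powr (p - 1) * exp (- \<mu> * y)) * indicator {0<..} y) \<partial>lborel)"
    using assms by (intro nn_integral_cong)
      (auto simp: indicator_def powr_mult exp_minus field_simps zero_le_mult_iff ennreal_mult[symmetric])
  also have "\<dots> = ennreal (\<mu> powr (p - 1)) * (\<integral>\<^sup>+ y\<in>{0<..}. ennreal (y powr (p - 1) * exp (- \<mu> * y)) \<partial>lborel)"
    by (rule nn_integral_cmult) auto
  finally have "ennreal (Gamma p) = ennreal (\<mu> powr p) * (\<integral>\<^sup>+ y\<in>{0<..}. ennreal (y powr (p - 1) * exp (- \<mu> * y)) \<partial>lborel)"
    using assms by (simp add: ennreal_mult[symmetric] mult.assoc[symmetric] powr_mult_base)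
  hence "ennreal (\<mu> powr (- p)) * ennreal (Gamma p) = ennreal (\<mu> powr (- p)) * ennreal (\<mu> powr p) *
     (\<integral>\<^sup>+ y\<in>{0<..}. ennreal (y powr (p - 1) * exp (- \<mu> * y)) \<partial>lborel)"
    by (simp add: mult.assoc)
  also have "ennreal (\<mu> powr (- p)) * ennreal (\<mu> powr p) = 1"
    using assms by (simp add: ennreal_mult[symmetric] powr_add[symmetric])
  finally show ?thesis using assms by (simp add: ennreal_mult[symmetric] Gamma_real_pos less_imp_le mult.commute)
qed

text \<open>All \<open>\<psi> k\<close> are rescalings of one profile, so the pointwise bounds hold with constants independent of \<open>k\<close>.
The exponent of the weight is written with a parameter \<open>p\<close> that remains as the exponent of a Gamma
integral after the powers of \<open>y\<close> cancel; this is why the constant \<open>C\<close> can be independent of \<open>m\<close>.\<close>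

lemma profile_family_derivs:
  fixes lam :: "nat \<Rightarrow> real"
  assumes s: "0 < s" "s < 1" and lam: "\<And>k. 0 < lam k" "\<And>k. lam 0 \<le> lam k"
    and prof: "\<And>k. profile s (lam k) (\<psi> k)" and \<theta>: "0 \<le> \<theta>" "\<theta> < 2 * sqrt (lam 0)"
  shows "\<exists>E K. 1 < K \<and>
    (\<forall>k m. \<forall>y>0. (E k m has_real_derivative E k (Suc m) y) (at y)) \<and>
    (\<forall>k. \<forall>y>0. E k 0 y = \<psi> k y \<and> \<bar>\<psi> k y\<bar> \<le> 1) \<and>
    (\<forall>p>0. \<exists>C>0. \<forall>k. \<forall>m\<ge>1.
      (\<integral>\<^sup>+ y\<in>{0<..}. ennreal (weight (p - 1 - 4 * s + 2 * real m) \<theta> y * (E k m y)\<^sup>2) \<partial>lborel)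
       \<le> ennreal (C * K ^ (2 * m) * (fact m)\<^sup>2 * lam k powr (2 * s - p / 2)))"
proof -
  \<comment> \<open>The midpoint between the rate at which \<open>(\<psi> 0)\<^sup>2\<close> would just balance \<open>e\<^sup>\<theta>\<^sup>y\<close>, and the limit rate 1 of the profile.\<close>
  define \<delta> where "\<delta> = (\<theta> / (2 * sqrt (lam 0)) + 1) / 2"
  have s0: "0 < sqrt (lam 0)" using lam(1) by simp
  have \<delta>: "0 < \<delta>" "\<delta> < 1" "\<theta> < 2 * \<delta> * sqrt (lam 0)"
    using s0 \<theta> by (auto simp: \<delta>_def field_simps add_nonneg_pos)
  define \<mu> where "\<mu> = 2 * \<delta> - \<theta> / sqrt (lam 0)"
  have \<mu>: "0 < \<mu>" using s0 \<delta> by (simp add: \<mu>_def field_simps)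
  define \<rho> where "\<rho> z = \<psi> 0 (z / sqrt (lam 0))" for z
  have prho: "profile s 1 \<rho>" unfolding \<rho>_def using profile_rescale[OF lam(1) prof] .
  have psi: "\<psi> k y = \<rho> (sqrt (lam k) * y)" if "0 \<le> y" for k y
  proof -
    have "\<psi> k (sqrt (lam k) * y / sqrt (lam k)) = \<rho> (sqrt (lam k) * y)"
      by (rule profile_unique[OF _ profile_rescale[OF lam(1) prof] prho])
        (use that lam(1)[of k] in auto)
    thus ?thesis using lam(1)[of k] by simp
  qed
  obtain P C K where C: "0 < C" and K: "1 < K" and P0: "P 0 = \<rho>"
    and dP: "\<And>m z. 0 < z \<Longrightarrow> (P m has_real_derivative P (Suc m) z) (at z)"
    and b0: "\<And>z. 0 < z \<Longrightarrow> \<bar>\<rho> z\<bar> \<le> 1"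
    and b: "\<And>m z. 1 \<le> m \<Longrightarrow> 0 < z \<Longrightarrow> \<bar>P m z\<bar> \<le> C * K ^ m * fact m * z powr (2 * s - real m) * exp (- \<delta> * z)"
    using unit_profile_derivs[OF s prho \<delta>(1,2)] by metis
  define E where "E k m y = sqrt (lam k) ^ m * P m (sqrt (lam k) * y)" for k m y
  have dE: "(E k m has_real_derivative E k (Suc m) y) (at y)" if "0 < y" for k m y
  proof -
    have "((\<lambda>y. sqrt (lam k) * y) has_real_derivative sqrt (lam k)) (at y)"
      using DERIV_cmult_Id .
    from DERIV_cmult[OF DERIV_chain2[OF dP this], of "sqrt (lam k) ^ m"]
    show ?thesis unfolding E_def using that lam(1)[of k] by (simp add: mult_ac)
  qed
  have int: "\<exists>C>0. \<forall>k. \<forall>m\<ge>1.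
      (\<integral>\<^sup>+ y\<in>{0<..}. ennreal (weight (p - 1 - 4 * s + 2 * real m) \<theta> y * (E k m y)\<^sup>2) \<partial>lborel)
       \<le> ennreal (C * K ^ (2 * m) * (fact m)\<^sup>2 * lam k powr (2 * s - p / 2))" if p: "0 < p" for p
  proof (intro exI[of _ "C\<^sup>2 * (Gamma p * \<mu> powr (- p))"] conjI allI impI)
    show "0 < C\<^sup>2 * (Gamma p * \<mu> powr (- p))" using C \<mu> p by (simp add: Gamma_real_pos)
    fix k m :: nat assume m: "1 \<le> m"
    define r where "r = sqrt (lam k)"
    have r: "0 < r" "sqrt (lam 0) \<le> r" using lam by (auto simp: r_def)
    define B where "B = C\<^sup>2 * K ^ (2 * m) * (fact m)\<^sup>2 * r powr (4 * s)"
    have B: "0 \<le> B" by (simp add: B_def)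
    have "weight (p - 1 - 4 * s + 2 * real m) \<theta> y * (E k m y)\<^sup>2 \<le> B * (y powr (p - 1) * exp (- (\<mu> * r) * y))"
      if y: "0 < y" for y
    proof -
      have "(E k m y)\<^sup>2 = (r ^ m)\<^sup>2 * \<bar>P m (r * y)\<bar>\<^sup>2" by (simp add: E_def r_def power_mult_distrib)
      also have "\<dots> \<le> (r ^ m)\<^sup>2 * (C * K ^ m * fact m * (r * y) powr (2 * s - real m) * exp (- \<delta> * (r * y)))\<^sup>2"
        using b[OF m, of "r * y"] r y by (intro mult_left_mono power_mono) auto
      also have "\<dots> = C\<^sup>2 * K ^ (2 * m) * (fact m)\<^sup>2 * ((r ^ m)\<^sup>2 * ((r * y) powr (2 * s - real m))\<^sup>2)
          * (exp (- \<delta> * (r * y)))\<^sup>2"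
        by (simp add: power_mult_distrib power_mult mult_ac power_even_eq)
      also have "(r ^ m)\<^sup>2 * ((r * y) powr (2 * s - real m))\<^sup>2 = r powr (4 * s) * y powr (4 * s - 2 * real m)"
      proof -
        have "(r ^ m)\<^sup>2 = r powr (2 * real m)"
          using r by (simp add: powr_realpow[symmetric] powr_powr power2_eq_square powr_add[symmetric])
        moreover have "((r * y) powr (2 * s - real m))\<^sup>2 = r powr (4 * s - 2 * real m) * y powr (4 * s - 2 * real m)"
          using r y by (simp add: powr_mult power2_eq_square powr_add[symmetric] algebra_simps)
        ultimately show ?thesis using r by (simp add: mult.assoc[symmetric] powr_add[symmetric])
      qed
      also have "(exp (- \<delta> * (r * y)))\<^sup>2 = exp (- (2 * \<delta> * r) * y)"
        by (simp add: exp_double[symmetric] mult_ac)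
      finally have "(E k m y)\<^sup>2 \<le> B * y powr (4 * s - 2 * real m) * exp (- (2 * \<delta> * r) * y)"
        by (simp add: B_def mult_ac)
      hence "weight (p - 1 - 4 * s + 2 * real m) \<theta> y * (E k m y)\<^sup>2
         \<le> (y powr (p - 1 - 4 * s + 2 * real m) * exp (\<theta> * y)) *
           (B * y powr (4 * s - 2 * real m) * exp (- (2 * \<delta> * r) * y))"
        unfolding weight_def by (intro mult_left_mono) auto
      also have "\<dots> = B * (y powr (p - 1 - 4 * s + 2 * real m) * y powr (4 * s - 2 * real m))
           * (exp (\<theta> * y) * exp (- (2 * \<delta> * r) * y))" by (simp add: mult_ac)
      also have "y powr (p - 1 - 4 * s + 2 * real m) * y powr (4 * s - 2 * real m) = y powr (p - 1)"
        by (simp add: powr_add[symmetric])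
      also have "exp (\<theta> * y) * exp (- (2 * \<delta> * r) * y) = exp ((\<theta> - 2 * \<delta> * r) * y)"
        by (simp add: exp_add[symmetric] algebra_simps)
      also have "B * y powr (p - 1) * exp ((\<theta> - 2 * \<delta> * r) * y) \<le> B * y powr (p - 1) * exp (- (\<mu> * r) * y)"
      proof -
        have "\<theta> / sqrt (lam 0) * sqrt (lam 0) \<le> \<theta> / sqrt (lam 0) * r"
          using r \<theta> s0 by (intro mult_left_mono) auto
        hence "\<theta> - 2 * \<delta> * r \<le> - (\<mu> * r)" using s0 by (simp add: \<mu>_def algebra_simps)
        hence "(\<theta> - 2 * \<delta> * r) * y \<le> - (\<mu> * r) * y" using y by (intro mult_right_mono) auto
        thus ?thesis using B by (intro mult_left_mono) auto
      qed
      finally show ?thesis by (simp add: mult.assoc)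
    qed
    hence "(\<integral>\<^sup>+ y\<in>{0<..}. ennreal (weight (p - 1 - 4 * s + 2 * real m) \<theta> y * (E k m y)\<^sup>2) \<partial>lborel)
      \<le> (\<integral>\<^sup>+ y. ennreal B * (ennreal (y powr (p - 1) * exp (- (\<mu> * r) * y)) * indicator {0<..} y) \<partial>lborel)"
      using B by (intro nn_integral_mono) (auto simp: indicator_def ennreal_mult[symmetric] ennreal_leI)
    also have "\<dots> = ennreal B * ennreal (Gamma p * (\<mu> * r) powr (- p))"
      using nn_integral_powr_exp[OF p, of "\<mu> * r"] \<mu> r by (subst nn_integral_cmult) auto
    also have "\<dots> = ennreal (C\<^sup>2 * (Gamma p * \<mu> powr (- p)) * K ^ (2 * m) * (fact m)\<^sup>2 * (r powr (4 * s) * r powr (- p)))"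
      using B \<mu> r by (simp add: ennreal_mult[symmetric] Gamma_real_pos p less_imp_le powr_mult B_def mult_ac)
    also have "r powr (4 * s) * r powr (- p) = lam k powr (2 * s - p / 2)"
      using lam(1)[of k] by (simp add: r_def powr_half_sqrt[symmetric] powr_powr powr_add[symmetric] algebra_simps)
    finally show "(\<integral>\<^sup>+ y\<in>{0<..}. ennreal (weight (p - 1 - 4 * s + 2 * real m) \<theta> y * (E k m y)\<^sup>2) \<partial>lborel)
       \<le> ennreal (C\<^sup>2 * (Gamma p * \<mu> powr (- p)) * K ^ (2 * m) * (fact m)\<^sup>2 * lam k powr (2 * s - p / 2))" .
  qed
  have "E k 0 y = \<psi> k y \<and> \<bar>\<psi> k y\<bar> \<le> 1" if "0 < y" for k y
    using psi[of y k] b0[of "sqrt (lam k) * y"] that lam(1)[of k] by (simp add: E_def P0)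
  thus ?thesis using K dE int by (intro exI[of _ E] exI[of _ K]) blast
qed

section \<open>Completeness of weighted square integrable functions\<close>

lemma suminf_ennreal_tail_tendsto_0:
  fixes b :: "nat \<Rightarrow> ennreal"
  assumes "(\<Sum>k. b k) < \<infinity>"
  shows "(\<lambda>n. \<Sum>k. b (k + n)) \<longlonglongrightarrow> 0"
proof -
  have fin: "b k < \<infinity>" for k
    using assms ennreal_suminf_lessD[of b \<infinity> k] by simp
  define c where "c k = enn2real (b k)" for k
  have bc: "b k = ennreal (c k)" for k using fin[of k] by (simp add: c_def)
  have c0: "0 \<le> c k" for k by (simp add: c_def)
  have "summable c" using assms c0 unfolding bc by (intro summable_suminf_not_top) auto
  hence "(\<lambda>n. \<Sum>k. c (k + n)) \<longlonglongrightarrow> 0" by (rule suminf_exist_split2)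
  hence "(\<lambda>n. ennreal (\<Sum>k. c (k + n))) \<longlonglongrightarrow> ennreal 0" by (intro tendsto_ennrealI)
  moreover have "ennreal (\<Sum>k. c (k + n)) = (\<Sum>k. b (k + n))" for n
    unfolding bc using c0 \<open>summable c\<close> by (intro suminf_ennreal2[symmetric]) auto
  ultimately show ?thesis by simp
qed

lemma sum_le_suminf_tail:
  fixes b :: "nat \<Rightarrow> ennreal"
  shows "(\<Sum>k\<in>{n..<m}. b k) \<le> (\<Sum>k. b (k + n))"
proof (cases "n \<le> m")
  case True
  hence "(\<Sum>k\<in>{n..<m}. b k) = (\<Sum>k<m - n. b (k + n))"
    using sum.shift_bounds_nat_ivl[of b 0 n "m - n"] by (simp add: lessThan_atLeast0)
  also have "\<dots> \<le> (\<Sum>k. b (k + n))" by (intro sum_le_suminf) auto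
  finally show ?thesis .
qed simp

text \<open>The increments are at most a multiple of \<open>2\<^sup>-\<^sup>j\<^sup>/\<^sup>2\<close>, hence summable.\<close>

lemma convergent_of_weighted_increments:
  fixes x :: "nat \<Rightarrow> 'b::euclidean_space"
  assumes "(\<Sum>j. ennreal (2 ^ j * (norm (x (Suc j) - x j))\<^sup>2)) < \<infinity>"
  shows "convergent x"
proof -
  let ?d = "\<lambda>j. norm (x (Suc j) - x j)"
  define S where "S = (\<Sum>j. ennreal (2 ^ j * (?d j)\<^sup>2))"
  define C where "C = enn2real S"
  have "S < top" using assms by (simp add: S_def)
  hence C: "C \<ge> 0" "(\<Sum>j. ennreal (2 ^ j * (?d j)\<^sup>2)) = ennreal C"
    unfolding S_def[symmetric] by (auto simp: C_def)
  have "2 ^ j * (?d j)\<^sup>2 \<le> C" for j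
  proof -
    have "ennreal (2 ^ j * (?d j)\<^sup>2) = (\<Sum>i\<in>{j}. ennreal (2 ^ i * (?d i)\<^sup>2))" by simp
    also have "\<dots> \<le> ennreal C" unfolding C(2)[symmetric] by (intro sum_le_suminf) auto
    finally show ?thesis using C(1) by (simp add: ennreal_le_iff)
  qed
  note bound = this
  have "?d j \<le> sqrt C * (1 / sqrt 2) ^ j" for j
  proof -
    have "(?d j)\<^sup>2 \<le> C / 2 ^ j" using bound[of j] by (simp add: field_simps)
    hence "?d j \<le> sqrt (C / 2 ^ j)" by (rule real_le_rsqrt)
    also have "\<dots> = sqrt C * (1 / sqrt 2) ^ j"
      by (simp only: real_sqrt_divide real_sqrt_power power_divide) simp
    finally show ?thesis .
  qed
  note bound' = this
  have "summable (\<lambda>j. sqrt C * (1 / sqrt 2) ^ j)"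
    by (intro summable_mult summable_geometric) simp
  hence "summable (\<lambda>j. x (Suc j) - x j)"
    by (rule summable_comparison_test'[where N = 0]) (rule bound')
  from summable_LIMSEQ[OF this]
  have "convergent (\<lambda>n. x n - x 0)"
    unfolding sum_lessThan_telescope convergent_def by blast
  from convergent_add[OF this convergent_const[of "x 0"]] show ?thesis by simp
qed

text \<open>A subsequence whose increments have squared norms at most \<open>8\<^sup>-\<^sup>j\<close> converges almost everywhere by
\<open>convergent_of_weighted_increments\<close>; Fatou's lemma gives convergence in the square mean and the bound
on the limit.\<close>

lemma L2_series_complete:
  fixes F :: "nat \<Rightarrow> 'a \<Rightarrow> 'b::euclidean_space" and b :: "nat \<Rightarrow> ennreal"
  assumes meas[measurable]: "\<And>n. F n \<in> borel_measurable M" and F0: "\<And>x. F 0 x = 0"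
    and incr: "\<And>n m. n \<le> m \<Longrightarrow>
      (\<integral>\<^sup>+ x. ennreal ((norm (F m x - F n x))\<^sup>2) \<partial>M) \<le> (\<Sum>k\<in>{n..<m}. b k)"
    and fin: "(\<Sum>k. b k) < \<infinity>"
  shows "\<exists>f\<in>borel_measurable M. (\<integral>\<^sup>+ x. ennreal ((norm (f x))\<^sup>2) \<partial>M) \<le> (\<Sum>k. b k) \<and>
    (\<lambda>n. \<integral>\<^sup>+ x. ennreal ((norm (F n x - f x))\<^sup>2) \<partial>M) \<longlonglongrightarrow> 0"
proof -
  define tail where "tail n = (\<Sum>k. b (k + n))" for n
  have tail0: "tail \<longlonglongrightarrow> 0" unfolding tail_def by (rule suminf_ennreal_tail_tendsto_0[OF fin])
  have incr': "(\<integral>\<^sup>+ x. ennreal ((norm (F m x - F n x))\<^sup>2) \<partial>M) \<le> tail n" if "n \<le> m" for n m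
    using order_trans[OF incr[OF that] sum_le_suminf_tail] by (simp add: tail_def)
  have "\<exists>N\<ge>j. \<forall>n\<ge>N. tail n \<le> ennreal ((1/8) ^ j)" for j
  proof -
    have "\<forall>\<^sub>F n in sequentially. tail n < ennreal ((1/8) ^ j)"
      using tail0 by (rule order_tendstoD) simp
    then obtain N where "\<And>n. n \<ge> N \<Longrightarrow> tail n < ennreal ((1/8) ^ j)"
      by (auto simp: eventually_sequentially)
    thus ?thesis by (intro exI[of _ "max N j"]) (auto intro: less_imp_le)
  qed
  then obtain r0 where r0: "\<And>j. r0 j \<ge> j" "\<And>j n. n \<ge> r0 j \<Longrightarrow> tail n \<le> ennreal ((1/8) ^ j)" by metis
  define r where "r j = (\<Sum>i\<le>j. r0 i)" for j
  have rmono: "r j \<le> r (Suc j)" for j by (simp add: r_def)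
  have r: "r0 j \<le> r j" for j unfolding r_def by (intro member_le_sum) auto
  have rj: "j \<le> r j" for j using r r0(1) order_trans by blast
  let ?d = "\<lambda>j x. ennreal (2 ^ j * (norm (F (r (Suc j)) x - F (r j) x))\<^sup>2)"
  have "(\<integral>\<^sup>+ x. (\<Sum>j. ?d j x) \<partial>M) = (\<Sum>j. \<integral>\<^sup>+ x. ?d j x \<partial>M)"
    by (intro nn_integral_suminf) simp
  also have "\<dots> \<le> (\<Sum>j. ennreal ((1/4) ^ j))"
  proof (intro suminf_le allI)
    fix j
    have "(\<integral>\<^sup>+ x. ?d j x \<partial>M) = ennreal (2 ^ j) * (\<integral>\<^sup>+ x. ennreal ((norm (F (r (Suc j)) x - F (r j) x))\<^sup>2) \<partial>M)"
      by (subst nn_integral_cmult[symmetric]) (auto simp: ennreal_mult)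
    also have "\<dots> \<le> ennreal (2 ^ j) * ennreal ((1/8) ^ j)"
      using order_trans[OF incr'[OF rmono] r0(2)[OF r]] by (intro mult_left_mono) auto
    also have "\<dots> = ennreal ((1/4) ^ j)"
      by (simp add: ennreal_mult[symmetric] power_mult_distrib[symmetric])
    finally show "(\<integral>\<^sup>+ x. ?d j x \<partial>M) \<le> ennreal ((1/4) ^ j)" .
  qed auto
  also have "\<dots> = ennreal (\<Sum>j. (1/4) ^ j)" by (intro suminf_ennreal2 summable_geometric) auto
  finally have "(\<integral>\<^sup>+ x. (\<Sum>j. ?d j x) \<partial>M) \<noteq> \<infinity>" by (auto simp: top_unique)
  hence "AE x in M. (\<Sum>j. ?d j x) \<noteq> \<infinity>" by (intro nn_integral_PInf_AE) auto
  hence conv: "AE x in M. convergent (\<lambda>j. F (r j) x)"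
    by eventually_elim (rule convergent_of_weighted_increments, metis infinity_ennreal_def top.not_eq_extremum)
  define f where "f x = lim (\<lambda>j. F (r j) x)" for x
  have f[measurable]: "f \<in> borel_measurable M" unfolding f_def by measurable
  have tl: "(\<integral>\<^sup>+ x. ennreal ((norm (F n x - f x))\<^sup>2) \<partial>M) \<le> tail n" for n
  proof -
    have "(\<integral>\<^sup>+ x. ennreal ((norm (F n x - f x))\<^sup>2) \<partial>M)
       = (\<integral>\<^sup>+ x. liminf (\<lambda>j. ennreal ((norm (F n x - F (r j) x))\<^sup>2)) \<partial>M)"
      using conv
    proof (intro nn_integral_cong_AE, eventually_elim)
      fix x assume "convergent (\<lambda>j. F (r j) x)"
      hence "(\<lambda>j. F (r j) x) \<longlonglongrightarrow> f x" by (simp add: convergent_LIMSEQ_iff f_def)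
      hence "(\<lambda>j. ennreal ((norm (F n x - F (r j) x))\<^sup>2)) \<longlonglongrightarrow> ennreal ((norm (F n x - f x))\<^sup>2)"
        by (intro tendsto_ennrealI tendsto_intros)
      thus "ennreal ((norm (F n x - f x))\<^sup>2) = liminf (\<lambda>j. ennreal ((norm (F n x - F (r j) x))\<^sup>2))"
        by (intro lim_imp_Liminf[symmetric]) auto
    qed
    also have "\<dots> \<le> liminf (\<lambda>j. \<integral>\<^sup>+ x. ennreal ((norm (F n x - F (r j) x))\<^sup>2) \<partial>M)"
      by (rule nn_integral_liminf) simp
    also have "\<dots> \<le> liminf (\<lambda>j. tail n)"
    proof (rule Liminf_mono)
      show "\<forall>\<^sub>F j in sequentially. (\<integral>\<^sup>+ x. ennreal ((norm (F n x - F (r j) x))\<^sup>2) \<partial>M) \<le> tail n"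
        using eventually_ge_at_top[of n]
      proof eventually_elim
        case (elim j)
        thus ?case using incr'[of n "r j"] rj[of j] by (simp add: norm_minus_commute)
      qed
    qed
    also have "\<dots> = tail n" by (simp add: Liminf_const)
    finally show ?thesis .
  qed
  have "(\<integral>\<^sup>+ x. ennreal ((norm (f x))\<^sup>2) \<partial>M) \<le> (\<Sum>k. b k)" using tl[of 0] by (simp add: F0 tail_def)
  moreover have "(\<lambda>n. \<integral>\<^sup>+ x. ennreal ((norm (F n x - f x))\<^sup>2) \<partial>M) \<longlonglongrightarrow> 0"
    by (rule tendsto_sandwich[OF _ _ tendsto_const tail0]) (auto simp: tl)
  ultimately show ?thesis using f by blast
qed

lemma nn_integral_spacetime:
  fixes f :: "'n::finite spacetime \<Rightarrow> ennreal"
  assumes [measurable]: "f \<in> borel_measurable borel"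
  shows "(\<integral>\<^sup>+ p. f p \<partial>lborel) = (\<integral>\<^sup>+ t. \<integral>\<^sup>+ y. \<integral>\<^sup>+ x. f (x, y, t) \<partial>lborel \<partial>lborel \<partial>lborel)"
proof -
  have [measurable]: "f \<in> borel_measurable (borel \<Otimes>\<^sub>M borel)" by (simp add: borel_prod)
  have "(\<integral>\<^sup>+ p. f p \<partial>lborel) = (\<integral>\<^sup>+ p. f p \<partial>(lborel \<Otimes>\<^sub>M lborel))" by (simp add: lborel_prod)
  also have "\<dots> = (\<integral>\<^sup>+ q. \<integral>\<^sup>+ x. f (x, q) \<partial>lborel \<partial>lborel)"
    by (rule lborel_pair.nn_integral_snd[symmetric]) simp
  also have "\<dots> = (\<integral>\<^sup>+ q. \<integral>\<^sup>+ x. f (x, q) \<partial>lborel \<partial>((lborel :: real measure) \<Otimes>\<^sub>M (lborel :: real measure)))"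
    by (simp add: lborel_prod)
  also have "\<dots> = (\<integral>\<^sup>+ t. \<integral>\<^sup>+ y. \<integral>\<^sup>+ x. f (x, y, t) \<partial>lborel \<partial>lborel \<partial>lborel)"
  proof (rule lborel_pair.nn_integral_snd[symmetric])
    have "(\<lambda>q. \<integral>\<^sup>+ x. f (x, q) \<partial>lborel) \<in> borel_measurable borel"
      by measurable
    thus "(\<lambda>q. \<integral>\<^sup>+ x. f (x, q) \<partial>lborel) \<in> borel_measurable (lborel \<Otimes>\<^sub>M lborel)"
      by (simp add: lborel_prod)
  qed
  finally show ?thesis .
qed

text \<open>The measure whose square norm is \<open>wnorm2\<close>.\<close>

definition wmeas :: "(real^'n::finite) set \<Rightarrow> real \<Rightarrow> real \<Rightarrow> real \<Rightarrow> 'n spacetime measure" where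
  "wmeas \<Omega> T \<beta> \<theta> = density lborel (\<lambda>p. indicator (cyl \<Omega> T) p * ennreal (weight \<beta> \<theta> (fst (snd p))))"

lemma open_cyl: "open \<Omega> \<Longrightarrow> open (cyl \<Omega> T)"
  unfolding cyl_def by (intro open_Times) auto

lemma measurable_cyl: "open \<Omega> \<Longrightarrow> cyl \<Omega> T \<in> sets borel"
  by (intro borel_open open_cyl)

lemma sets_wmeas [measurable_cong, simp]: "sets (wmeas \<Omega> T \<beta> \<theta>) = sets borel"
  by (simp add: wmeas_def)

lemma measurable_wmeas [simp]: "measurable (wmeas \<Omega> T \<beta> \<theta>) M = measurable borel M"
  by (intro measurable_cong_sets) auto

lemma weight_nonneg: "0 \<le> weight \<beta> \<theta> y"
  by (simp add: weight_def)

lemma measurable_weight [measurable]: "weight \<beta> \<theta> \<in> borel_measurable borel"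
  unfolding weight_def by measurable

lemma nn_integral_wmeas:
  assumes "open \<Omega>" and [measurable]: "f \<in> borel_measurable borel"
  shows "(\<integral>\<^sup>+ p. f p \<partial>wmeas \<Omega> T \<beta> \<theta>) =
    (\<integral>\<^sup>+ t\<in>{0<..<T}. (\<integral>\<^sup>+ y\<in>{0<..}. (\<integral>\<^sup>+ x\<in>\<Omega>. ennreal (weight \<beta> \<theta> y) * f (x, y, t) \<partial>lborel) \<partial>lborel) \<partial>lborel)"
proof -
  have [measurable]: "cyl \<Omega> T \<in> sets borel" by (rule measurable_cyl) fact
  have "(\<lambda>p. weight \<beta> \<theta> (fst (snd p))) \<in> borel_measurable (borel :: 'a spacetime measure)"
    by (intro measurable_compose[OF _ measurable_weight] borel_measurable_continuous_onI continuous_intros)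
  note [measurable] = this
  have "(\<integral>\<^sup>+ p. f p \<partial>wmeas \<Omega> T \<beta> \<theta>) =
      (\<integral>\<^sup>+ p. indicator (cyl \<Omega> T) p * ennreal (weight \<beta> \<theta> (fst (snd p))) * f p \<partial>lborel)"
    unfolding wmeas_def by (rule nn_integral_density) measurable
  also have "\<dots> = (\<integral>\<^sup>+ t. \<integral>\<^sup>+ y. \<integral>\<^sup>+ x. indicator (cyl \<Omega> T) (x, y, t) * ennreal (weight \<beta> \<theta> y) * f (x, y, t) \<partial>lborel \<partial>lborel \<partial>lborel)"
    by (subst nn_integral_spacetime) auto
  also have "\<dots> = (\<integral>\<^sup>+ t\<in>{0<..<T}. (\<integral>\<^sup>+ y\<in>{0<..}. (\<integral>\<^sup>+ x\<in>\<Omega>. ennreal (weight \<beta> \<theta> y) * f (x, y, t) \<partial>lborel) \<partial>lborel) \<partial>lborel)"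
  proof (rule nn_integral_cong)
    fix t
    show "(\<integral>\<^sup>+ y. \<integral>\<^sup>+ x. indicator (cyl \<Omega> T) (x, y, t) * ennreal (weight \<beta> \<theta> y) * f (x, y, t) \<partial>lborel \<partial>lborel) =
      (\<integral>\<^sup>+ y\<in>{0<..}. (\<integral>\<^sup>+ x\<in>\<Omega>. ennreal (weight \<beta> \<theta> y) * f (x, y, t) \<partial>lborel) \<partial>lborel) * indicator {0<..<T} t"
    proof (cases "t \<in> {0<..<T}")
      case True
      have "(\<integral>\<^sup>+ x. indicator (cyl \<Omega> T) (x, y, t) * ennreal (weight \<beta> \<theta> y) * f (x, y, t) \<partial>lborel) =
         (\<integral>\<^sup>+ x\<in>\<Omega>. ennreal (weight \<beta> \<theta> y) * f (x, y, t) \<partial>lborel) * indicator {0<..} y" for y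
        using True by (cases "0 < y") (auto simp: cyl_def indicator_def intro!: nn_integral_cong)
      thus ?thesis using True by simp
    qed (auto simp: cyl_def indicator_def)
  qed
  finally show ?thesis .
qed

lemma wnorm2_eq:
  fixes v :: "'n::finite spacetime \<Rightarrow> 'b::euclidean_space"
  assumes "open \<Omega>" and [measurable]: "v \<in> borel_measurable borel"
  shows "wnorm2 \<Omega> T \<beta> \<theta> v = (\<integral>\<^sup>+ p. ennreal ((norm (v p))\<^sup>2) \<partial>wmeas \<Omega> T \<beta> \<theta>)"
  unfolding wnorm2_def using assms by (subst nn_integral_wmeas) (auto simp: ennreal_mult weight_nonneg)

text \<open>On a compact subset of the open cylinder the weight is bounded below by a positive constant, so the
Cauchy-Schwarz inequality controls the \<open>L\<^sup>1\<close> norm by the weighted \<open>L\<^sup>2\<close> norm, whatever the weight.\<close>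

lemma local_L1_bound:
  fixes K :: "'n::finite spacetime set"
  assumes "open \<Omega>" and K: "compact K" "K \<subseteq> cyl \<Omega> T"
  shows "\<exists>C. C < \<infinity> \<and> (\<forall>F :: 'n spacetime \<Rightarrow> 'b::euclidean_space. F \<in> borel_measurable borel \<longrightarrow>
     (\<integral>\<^sup>+ p\<in>K. ennreal (norm (F p)) \<partial>lborel)\<^sup>2 \<le> C * (\<integral>\<^sup>+ p. ennreal ((norm (F p))\<^sup>2) \<partial>wmeas \<Omega> T \<beta> \<theta>))"
proof -
  have ypos: "0 < fst (snd p)" if "p \<in> K" for p using K(2) that by (auto simp: cyl_def)
  have cw: "continuous_on K (\<lambda>p. weight \<beta> \<theta> (fst (snd p)))"
    unfolding weight_def using ypos by (intro continuous_intros) (auto simp: less_imp_neq[symmetric])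
  have wpos: "0 < weight \<beta> \<theta> (fst (snd p))" if "p \<in> K" for p
    using ypos[OF that] by (simp add: weight_def)
  with cw have "\<exists>w>0. \<forall>p\<in>K. w \<le> weight \<beta> \<theta> (fst (snd p))"
  proof (cases "K = {}")
    case False
    assume "continuous_on K (\<lambda>p. weight \<beta> \<theta> (fst (snd p)))"
    from continuous_attains_inf[OF K(1) False this] wpos show ?thesis by blast
  qed (auto intro: zero_less_one)
  then obtain w where w: "0 < w" "\<And>p. p \<in> K \<Longrightarrow> w \<le> weight \<beta> \<theta> (fst (snd p))" by blast
  have [measurable]: "K \<in> sets borel" "cyl \<Omega> T \<in> sets borel"
    using K(1) measurable_cyl[OF assms(1)] by (auto intro: borel_closed compact_imp_closed)
  have mw[measurable]: "(\<lambda>p. weight \<beta> \<theta> (fst (snd p))) \<in> borel_measurable (borel :: 'n spacetime measure)"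
    by (intro measurable_compose[OF _ measurable_weight] borel_measurable_continuous_onI continuous_intros)
  define C where "C = emeasure lborel K * ennreal (1 / w)"
  have "C < \<infinity>" unfolding C_def
    using emeasure_compact_finite[OF K(1)] by (simp add: ennreal_mult_less_top)
  moreover have "(\<integral>\<^sup>+ p\<in>K. ennreal (norm (F p)) \<partial>lborel)\<^sup>2 \<le> C * (\<integral>\<^sup>+ p. ennreal ((norm (F p))\<^sup>2) \<partial>wmeas \<Omega> T \<beta> \<theta>)"
    if [measurable]: "F \<in> borel_measurable borel" for F :: "'n spacetime \<Rightarrow> 'b"
  proof -
    have "(\<integral>\<^sup>+ p\<in>K. ennreal (norm (F p)) \<partial>lborel)\<^sup>2 =
       (\<integral>\<^sup>+ p. indicator K p * (ennreal (norm (F p)) * indicator K p) \<partial>lborel)\<^sup>2"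
      by (intro arg_cong[where f = "\<lambda>x. x\<^sup>2"] nn_integral_cong) (auto simp: indicator_def)
    also have "\<dots> \<le> (\<integral>\<^sup>+ p. (indicator K p)\<^sup>2 \<partial>lborel) * (\<integral>\<^sup>+ p. (ennreal (norm (F p)) * indicator K p)\<^sup>2 \<partial>lborel)"
      by (rule Cauchy_Schwarz_nn_integral) auto
    also have "(\<integral>\<^sup>+ p. (indicator K p :: ennreal)\<^sup>2 \<partial>lborel) = (\<integral>\<^sup>+ p. indicator K p \<partial>lborel)"
      by (intro nn_integral_cong) (auto simp: indicator_def)
    also have "\<dots> = emeasure lborel K" by simp
    also have "(\<integral>\<^sup>+ p. (ennreal (norm (F p)) * indicator K p)\<^sup>2 \<partial>lborel) \<le>
       (\<integral>\<^sup>+ p. ennreal (1 / w) * (indicator (cyl \<Omega> T) p * ennreal (weight \<beta> \<theta> (fst (snd p))) * ennreal ((norm (F p))\<^sup>2)) \<partial>lborel)"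
    proof (rule nn_integral_mono)
      fix p :: "'n spacetime"
      show "(ennreal (norm (F p)) * indicator K p)\<^sup>2 \<le>
         ennreal (1 / w) * (indicator (cyl \<Omega> T) p * ennreal (weight \<beta> \<theta> (fst (snd p))) * ennreal ((norm (F p))\<^sup>2))"
      proof (cases "p \<in> K")
        case True
        have "1 \<le> 1 / w * weight \<beta> \<theta> (fst (snd p))" using w(2)[OF True] w(1) by (simp add: field_simps)
        hence "1 * (norm (F p))\<^sup>2 \<le> 1 / w * weight \<beta> \<theta> (fst (snd p)) * (norm (F p))\<^sup>2"
          by (intro mult_right_mono) auto
        hence "ennreal ((norm (F p))\<^sup>2) \<le> ennreal (1 / w) * (ennreal (weight \<beta> \<theta> (fst (snd p))) * ennreal ((norm (F p))\<^sup>2))"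
          using w(1) by (simp add: ennreal_mult[symmetric] weight_nonneg ennreal_leI mult.assoc)
        thus ?thesis using True K(2) by (auto simp: ennreal_power)
      qed simp
    qed
    also have "\<dots> = ennreal (1 / w) * (\<integral>\<^sup>+ p. ennreal ((norm (F p))\<^sup>2) \<partial>wmeas \<Omega> T \<beta> \<theta>)"
      unfolding wmeas_def by (subst nn_integral_density) (auto simp: nn_integral_cmult)
    finally show ?thesis unfolding C_def by (simp add: mult.assoc mult_left_mono)
  qed
  ultimately show ?thesis by blast
qed

lemma set_integrable_of_L2_control:
  fixes F :: "'p::euclidean_space \<Rightarrow> 'b::euclidean_space"
  assumes K: "compact K"
    and ctrl: "\<exists>C. C < \<infinity> \<and> (\<forall>F :: 'p \<Rightarrow> 'b. F \<in> borel_measurable borel \<longrightarrow>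
      (\<integral>\<^sup>+ p\<in>K. ennreal (norm (F p)) \<partial>lborel)\<^sup>2 \<le> C * (\<integral>\<^sup>+ p. ennreal ((norm (F p))\<^sup>2) \<partial>M))"
    and [measurable]: "F \<in> borel_measurable borel"
    and fin: "(\<integral>\<^sup>+ p. ennreal ((norm (F p))\<^sup>2) \<partial>M) < \<infinity>"
  shows "set_integrable lborel K F"
proof -
  obtain C where C: "C < \<infinity>"
    "(\<integral>\<^sup>+ p\<in>K. ennreal (norm (F p)) \<partial>lborel)\<^sup>2 \<le> C * (\<integral>\<^sup>+ p. ennreal ((norm (F p))\<^sup>2) \<partial>M)"
    using ctrl assms(3) by blast
  have [measurable]: "K \<in> sets borel" using K(1) by (auto intro: borel_closed compact_imp_closed)
  have "(\<integral>\<^sup>+ p\<in>K. ennreal (norm (F p)) \<partial>lborel)\<^sup>2 < \<infinity>"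
    using C fin by (simp add: ennreal_mult_less_top le_less_trans)
  hence "(\<integral>\<^sup>+ p\<in>K. ennreal (norm (F p)) \<partial>lborel) < \<infinity>"
    by (simp add: power_less_top_ennreal)
  thus "set_integrable lborel K F"
    unfolding set_integrable_def integrable_iff_bounded
    by (intro conjI borel_measurable_scaleR) (auto simp: ennreal_mult' ennreal_indicator mult.commute)
qed

lemma loc_integrable_of_weighted_L2:
  fixes F :: "'n::finite spacetime \<Rightarrow> 'b::euclidean_space"
  assumes "open \<Omega>" and "F \<in> borel_measurable borel"
    and "(\<integral>\<^sup>+ p. ennreal ((norm (F p))\<^sup>2) \<partial>wmeas \<Omega> T \<beta> \<theta>) < \<infinity>"
  shows "loc_integrable (cyl \<Omega> T) F"
  unfolding loc_integrable_def
  using set_integrable_of_L2_control[OF _ local_L1_bound[OF assms(1)] assms(2,3)] by blast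

lemma tendsto_0_of_square:
  fixes a :: "nat \<Rightarrow> ennreal"
  assumes "\<And>n. (a n)\<^sup>2 \<le> b n" "b \<longlonglongrightarrow> 0"
  shows "a \<longlonglongrightarrow> 0"
proof (rule order_tendstoI)
  fix e :: ennreal assume e: "0 < e"
  define d where "d = min e 1"
  have d: "0 < d" "d \<le> 1" "d \<le> e" using e by (auto simp: d_def)
  have "0 < d\<^sup>2" using d by (simp add: zero_less_iff_neq_zero)
  hence "\<forall>\<^sub>F n in sequentially. b n < d\<^sup>2" by (rule order_tendstoD[OF assms(2)])
  thus "\<forall>\<^sub>F n in sequentially. a n < e"
  proof eventually_elim
    case (elim n)
    hence "(a n)\<^sup>2 < d\<^sup>2" using assms(1)[of n] by simp
    hence "a n < d" by (meson not_le power_mono zero_le)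
    thus ?case using d by simp
  qed
qed simp

lemma integrable_bilinear_compact_support:
  fixes prod :: "'a::euclidean_space \<Rightarrow> 'b::real_normed_vector \<Rightarrow> 'c::euclidean_space"
    and F :: "'p::euclidean_space \<Rightarrow> 'a" and g :: "'p \<Rightarrow> 'b"
  assumes prod: "bounded_bilinear prod" and i: "set_integrable lborel K F"
    and meas: "(\<lambda>p. prod (F p) (g p)) \<in> borel_measurable borel"
    and bnd: "AE p in lborel. norm (g p) \<le> B" and supp: "\<And>p. p \<notin> K \<Longrightarrow> g p = 0"
  shows "integrable lborel (\<lambda>p. prod (F p) (g p))"
proof -
  obtain C where C: "0 < C" "\<And>a b. norm (prod a b) \<le> norm a * norm b * C" using bounded_bilinear.pos_bounded[OF prod] by blast
  note i = i[unfolded set_integrable_def]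
  show ?thesis
  proof (rule Bochner_Integration.integrable_bound)
    show "integrable lborel (\<lambda>p. norm (indicator K p *\<^sub>R F p) * (\<bar>B\<bar> * C))"
      by (intro integrable_mult_left integrable_norm i)
    show "AE p in lborel. norm (prod (F p) (g p)) \<le> norm (norm (indicator K p *\<^sub>R F p) * (\<bar>B\<bar> * C))"
      using bnd
    proof eventually_elim
      case (elim p)
      show ?case
      proof (cases "p \<in> K")
        case True
        have "norm (prod (F p) (g p)) \<le> norm (F p) * norm (g p) * C" by (rule C)
        also have "\<dots> \<le> norm (F p) * \<bar>B\<bar> * C" using elim C by (intro mult_right_mono mult_left_mono) auto
        finally show ?thesis using True C(1) by (simp add: abs_mult mult.assoc)
      qed (simp add: supp bounded_bilinear.zero_right[OF prod])
    qed
  qed (use meas in simp)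
qed

lemma finite_weighted_L2_limit:
  fixes F :: "nat \<Rightarrow> 'a \<Rightarrow> 'b::euclidean_space"
  assumes [measurable]: "\<And>n. F n \<in> borel_measurable M" "f \<in> borel_measurable M"
    and lim: "(\<lambda>n. \<integral>\<^sup>+ p. ennreal ((norm (F n p - f p))\<^sup>2) \<partial>M) \<longlonglongrightarrow> 0"
    and fin: "\<And>n. (\<integral>\<^sup>+ p. ennreal ((norm (F n p))\<^sup>2) \<partial>M) < \<infinity>"
  shows "(\<integral>\<^sup>+ p. ennreal ((norm (f p))\<^sup>2) \<partial>M) < \<infinity>"
proof -
  have "\<forall>\<^sub>F n in sequentially. (\<integral>\<^sup>+ p. ennreal ((norm (F n p - f p))\<^sup>2) \<partial>M) < 1"
    using lim by (rule order_tendstoD) simp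
  then obtain n where n: "(\<integral>\<^sup>+ p. ennreal ((norm (F n p - f p))\<^sup>2) \<partial>M) < 1"
    by (auto simp: eventually_sequentially)
  have "(\<integral>\<^sup>+ p. ennreal ((norm (f p))\<^sup>2) \<partial>M) \<le>
      (\<integral>\<^sup>+ p. 2 * ennreal ((norm (F n p))\<^sup>2) + 2 * ennreal ((norm (F n p - f p))\<^sup>2) \<partial>M)"
  proof (rule nn_integral_mono)
    fix p
    have "norm (f p) \<le> norm (F n p) + norm (F n p - f p)"
      by (metis norm_triangle_sub norm_minus_commute)
    hence "(norm (f p))\<^sup>2 \<le> (norm (F n p) + norm (F n p - f p))\<^sup>2" by (intro power_mono) auto
    also have "\<dots> \<le> 2 * (norm (F n p))\<^sup>2 + 2 * (norm (F n p - f p))\<^sup>2"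
      using sum_squares_bound[of "norm (F n p)" "norm (F n p - f p)"] by (simp add: power2_sum)
    finally have "ennreal ((norm (f p))\<^sup>2) \<le> ennreal (2 * (norm (F n p))\<^sup>2 + 2 * (norm (F n p - f p))\<^sup>2)"
      by (rule ennreal_leI)
    thus "ennreal ((norm (f p))\<^sup>2) \<le> 2 * ennreal ((norm (F n p))\<^sup>2) + 2 * ennreal ((norm (F n p - f p))\<^sup>2)"
      by (simp add: ennreal_plus ennreal_mult')
  qed
  also have "\<dots> = 2 * (\<integral>\<^sup>+ p. ennreal ((norm (F n p))\<^sup>2) \<partial>M) + 2 * (\<integral>\<^sup>+ p. ennreal ((norm (F n p - f p))\<^sup>2) \<partial>M)"
    by (simp add: nn_integral_add nn_integral_cmult)
  also have "\<dots> < \<infinity>" using fin[of n] n by (auto simp: ennreal_mult_less_top intro: less_trans)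
  finally show ?thesis .
qed

text \<open>The passage to the limit in all weak formulations. It is stated for a bilinear product because the
factor \<open>g\<close> multiplies scalars (\<open>\<eta>\<close>), scales or is scaled by vectors (\<open>\<nabla>\<eta>\<close>), or enters by inner products
(\<open>A \<nabla>\<eta>\<close>), and for an abstract control of local \<open>L\<^sup>1\<close> norms because it is needed on the cylinder with
weights and on \<open>\<Omega>\<close> without.\<close>

lemma L2_tendsto_integral_bilinear:
  fixes prod :: "'a::euclidean_space \<Rightarrow> 'b::real_normed_vector \<Rightarrow> 'c::euclidean_space"
    and F :: "nat \<Rightarrow> 'p::euclidean_space \<Rightarrow> 'a" and f :: "'p \<Rightarrow> 'a"
  assumes prod: "bounded_bilinear prod" and K: "compact K"
    and ctrl: "\<exists>C. C < \<infinity> \<and> (\<forall>F :: 'p \<Rightarrow> 'a. F \<in> borel_measurable borel \<longrightarrow>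
      (\<integral>\<^sup>+ p\<in>K. ennreal (norm (F p)) \<partial>lborel)\<^sup>2 \<le> C * (\<integral>\<^sup>+ p. ennreal ((norm (F p))\<^sup>2) \<partial>M))"
    and mF[measurable]: "\<And>n. F n \<in> borel_measurable borel" and mf[measurable]: "f \<in> borel_measurable borel"
    and iF: "\<And>n. set_integrable lborel K (F n)" and "if": "set_integrable lborel K f"
    and mp: "\<And>u :: 'p \<Rightarrow> 'a. u \<in> borel_measurable borel \<Longrightarrow> (\<lambda>p. prod (u p) (g p)) \<in> borel_measurable borel"
    and bnd: "AE p in lborel. norm (g p) \<le> B" and supp: "\<And>p. p \<notin> K \<Longrightarrow> g p = 0"
    and lim: "(\<lambda>n. \<integral>\<^sup>+ p. ennreal ((norm (F n p - f p))\<^sup>2) \<partial>M) \<longlonglongrightarrow> 0"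
  shows "(\<lambda>n. \<integral>p. prod (F n p) (g p) \<partial>lborel) \<longlonglongrightarrow> (\<integral>p. prod (f p) (g p) \<partial>lborel)"
proof -
  obtain C where C: "0 < C" "\<And>a b. norm (prod a b) \<le> norm a * norm b * C"
    using bounded_bilinear.pos_bounded[OF prod] by blast
  obtain D where D: "D < \<infinity>" "\<And>F :: 'p \<Rightarrow> 'a. F \<in> borel_measurable borel \<Longrightarrow>
     (\<integral>\<^sup>+ p\<in>K. ennreal (norm (F p)) \<partial>lborel)\<^sup>2 \<le> D * (\<integral>\<^sup>+ p. ennreal ((norm (F p))\<^sup>2) \<partial>M)"
    using ctrl by blast
  have [measurable]: "K \<in> sets borel" using K(1) by (auto intro: borel_closed compact_imp_closed)
  have int: "integrable lborel (\<lambda>p. prod (f p) (g p))" "integrable lborel (\<lambda>p. prod (F n p) (g p))" for n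
    using bnd supp
    by (auto intro!: integrable_bilinear_compact_support[OF prod "if"]
          integrable_bilinear_compact_support[OF prod iF] mp)
  define a where "a n = (\<integral>\<^sup>+ p\<in>K. ennreal (norm (F n p - f p)) \<partial>lborel)" for n
  have "a \<longlonglongrightarrow> 0"
  proof (rule tendsto_0_of_square)
    show "(a n)\<^sup>2 \<le> D * (\<integral>\<^sup>+ p. ennreal ((norm (F n p - f p))\<^sup>2) \<partial>M)" for n
      unfolding a_def by (rule D(2)) simp
    show "(\<lambda>n. D * (\<integral>\<^sup>+ p. ennreal ((norm (F n p - f p))\<^sup>2) \<partial>M)) \<longlonglongrightarrow> 0"
      using ennreal_tendsto_cmult[OF _ lim, of D] D(1) by simp
  qed
  hence lim0: "(\<lambda>n. ennreal (\<bar>B\<bar> * C) * a n) \<longlonglongrightarrow> 0"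
    using ennreal_tendsto_cmult[of "ennreal (\<bar>B\<bar> * C)" a 0] by simp
  have "ennreal (norm ((\<integral>p. prod (F n p) (g p) \<partial>lborel) - (\<integral>p. prod (f p) (g p) \<partial>lborel))) \<le> ennreal (\<bar>B\<bar> * C) * a n" for n
  proof -
    have "(\<integral>p. prod (F n p) (g p) \<partial>lborel) - (\<integral>p. prod (f p) (g p) \<partial>lborel)
       = (\<integral>p. prod (F n p - f p) (g p) \<partial>lborel)"
      using int by (simp add: bounded_bilinear.diff_left[OF prod])
    also have "ennreal (norm \<dots>) \<le> (\<integral>\<^sup>+ p. norm (prod (F n p - f p) (g p)) \<partial>lborel)"
      using int by (intro integral_norm_bound_ennreal) (simp add: bounded_bilinear.diff_left[OF prod])
    also have "\<dots> \<le> (\<integral>\<^sup>+ p. ennreal (\<bar>B\<bar> * C) * (ennreal (norm (F n p - f p)) * indicator K p) \<partial>lborel)"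
      using bnd
    proof (intro nn_integral_mono_AE, eventually_elim)
      case (elim p)
      show ?case
      proof (cases "p \<in> K")
        case True
        have "norm (prod (F n p - f p) (g p)) \<le> norm (F n p - f p) * norm (g p) * C" by (rule C)
        also have "\<dots> \<le> norm (F n p - f p) * \<bar>B\<bar> * C" using elim C by (intro mult_right_mono mult_left_mono) auto
        also have "\<dots> = \<bar>B\<bar> * C * norm (F n p - f p)" by simp
        finally show ?thesis using True C(1) by (simp add: ennreal_mult[symmetric] ennreal_leI)
      qed (simp add: supp bounded_bilinear.zero_right[OF prod])
    qed
    also have "\<dots> = ennreal (\<bar>B\<bar> * C) * a n" unfolding a_def by (rule nn_integral_cmult) simp
    finally show ?thesis .
  qed
  hence "(\<lambda>n. ennreal (norm ((\<integral>p. prod (F n p) (g p) \<partial>lborel) - (\<integral>p. prod (f p) (g p) \<partial>lborel)))) \<longlonglongrightarrow> ennreal 0"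
    unfolding ennreal_0 by (intro tendsto_sandwich[OF _ _ tendsto_const lim0]) auto
  from tendsto_enn2real[OF this order_refl]
  have "(\<lambda>n. norm ((\<integral>p. prod (F n p) (g p) \<partial>lborel) - (\<integral>p. prod (f p) (g p) \<partial>lborel))) \<longlonglongrightarrow> 0" by simp
  thus ?thesis by (simp add: LIM_zero_iff tendsto_norm_zero_iff)
qed

section \<open>Test functions and integration by parts\<close>

lemma lborel_integral_translate:
  fixes f :: "'a::euclidean_space \<Rightarrow> real"
  assumes "f \<in> borel_measurable borel"
  shows "integrable lborel (\<lambda>p. f (p + c)) \<longleftrightarrow> integrable lborel f"
    and "(\<integral>p. f (p + c) \<partial>lborel) = (\<integral>p. f p \<partial>lborel)"
proof -
  have 1: "integrable (distr lborel borel ((+) c)) f \<longleftrightarrow> integrable lborel (\<lambda>p. f (c + p))"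
    by (rule integrable_distr_eq) (use assms in auto)
  have 2: "integral\<^sup>L (distr lborel borel ((+) c)) f = (\<integral>p. f (c + p) \<partial>lborel)"
    by (rule integral_distr) (use assms in auto)
  show "integrable lborel (\<lambda>p. f (p + c)) \<longleftrightarrow> integrable lborel f"
    and "(\<integral>p. f (p + c) \<partial>lborel) = (\<integral>p. f p \<partial>lborel)"
    using 1 2 by (simp_all add: lborel_distr_plus add.commute)
qed

text \<open>Integrating \<open>w (p + b) - w p = \<integral>\<^sub>0\<^sup>1 D (p + \<tau> b) d\<tau>\<close> over \<open>p\<close> gives 0 on the left and \<open>\<integral> D\<close> on the right, both
by translation invariance of the Lebesgue measure.\<close>

lemma integral_directional_derivative_eq_0:
  fixes w D :: "'a::euclidean_space \<Rightarrow> real"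
  assumes iw: "integrable lborel w" and iD: "integrable lborel D"
    and cont: "\<And>p. continuous_on UNIV (\<lambda>\<tau>. D (p + \<tau> *\<^sub>R b))"
    and deriv: "\<And>p \<tau>. ((\<lambda>\<tau>. w (p + \<tau> *\<^sub>R b)) has_real_derivative D (p + \<tau> *\<^sub>R b)) (at \<tau>)"
  shows "(\<integral>p. D p \<partial>lborel) = 0"
proof -
  have [measurable]: "w \<in> borel_measurable borel" "D \<in> borel_measurable borel"
    using borel_measurable_integrable[OF iw] borel_measurable_integrable[OF iD] by simp_all
  let ?G = "\<lambda>(\<tau>::real) p. D (p + \<tau> *\<^sub>R b) * indicator {0..1} \<tau>"
  have G: "integrable (lborel \<Otimes>\<^sub>M lborel) (\<lambda>(\<tau>, p). ?G \<tau> p)"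
  proof (rule lborel_pair.Fubini_integrable)
    have "(\<lambda>x::real \<times> 'a. D (snd x + fst x *\<^sub>R b)) \<in> borel_measurable (borel \<Otimes>\<^sub>M borel)"
      by measurable
    thus "(\<lambda>(\<tau>, p). ?G \<tau> p) \<in> borel_measurable (lborel \<Otimes>\<^sub>M lborel)"
      unfolding case_prod_beta by measurable
    have "(\<integral>p. norm (?G \<tau> p) \<partial>lborel) = (\<integral>p. \<bar>D p\<bar> \<partial>lborel) * indicator {0..1} \<tau>" for \<tau>
      using lborel_integral_translate(2)[of "\<lambda>p. \<bar>D p\<bar>" "\<tau> *\<^sub>R b"] by (simp add: abs_mult)
    thus "integrable lborel (\<lambda>\<tau>. \<integral>p. norm (case (\<tau>, p) of (\<tau>, p) \<Rightarrow> ?G \<tau> p) \<partial>lborel)"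
      by simp
    show "AE \<tau> in lborel. integrable lborel (\<lambda>p. case (\<tau>, p) of (\<tau>, p) \<Rightarrow> ?G \<tau> p)"
      using lborel_integral_translate(1)[of D] iD by simp
  qed
  have "(\<integral>\<tau>. (\<integral>p. ?G \<tau> p \<partial>lborel) \<partial>lborel) = (\<integral>\<tau>. (\<integral>p. D p \<partial>lborel) * indicator {0..1} \<tau> \<partial>(lborel :: real measure))"
    using lborel_integral_translate(2)[of D] by simp
  also have "\<dots> = (\<integral>p. D p \<partial>lborel)" by simp
  finally have "(\<integral>p. D p \<partial>lborel) = (\<integral>\<tau>. (\<integral>p. ?G \<tau> p \<partial>lborel) \<partial>lborel)" by simp
  also have "\<dots> = (\<integral>p. (\<integral>\<tau>. ?G \<tau> p \<partial>lborel) \<partial>lborel)"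
    using lborel_pair.Fubini_integral[OF G] by simp
  also have "\<dots> = (\<integral>p. w (p + b) - w p \<partial>lborel)"
  proof (intro Bochner_Integration.integral_cong refl)
    fix p
    have "(\<integral>\<tau>. ?G \<tau> p \<partial>lborel) = w (p + 1 *\<^sub>R b) - w (p + 0 *\<^sub>R b)"
    proof (rule integral_FTC_Icc_real[where F = "\<lambda>\<tau>. w (p + \<tau> *\<^sub>R b)"])
      show "isCont (\<lambda>\<tau>. D (p + \<tau> *\<^sub>R b)) \<tau>" for \<tau>
        using cont[of p] continuous_on_eq_continuous_at[of UNIV] by blast
    qed (use deriv in simp_all)
    thus "(\<integral>\<tau>. ?G \<tau> p \<partial>lborel) = w (p + b) - w p" by simp
  qed
  also have "\<dots> = 0"
    using iw lborel_integral_translate[of w b] by simp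
  finally show ?thesis .
qed

lemma test_fun_differentiable: "test_fun S \<eta> \<Longrightarrow> \<eta> differentiable (at x)"
proof -
  assume "test_fun S \<eta>"
  hence "Ck (Suc 0) \<eta>" unfolding test_fun_def by blast
  thus ?thesis by simp
qed

lemma test_fun_continuous: "test_fun S \<eta> \<Longrightarrow> continuous_on UNIV \<eta>"
proof -
  assume "test_fun S \<eta>"
  hence "Ck 0 \<eta>" unfolding test_fun_def by blast
  thus ?thesis by simp
qed

lemma test_fun_zero_outside: "test_fun S \<eta> \<Longrightarrow> x \<notin> S \<Longrightarrow> \<eta> x = 0"
  unfolding test_fun_def using closure_subset[of "{x. \<eta> x \<noteq> 0}"] by auto

lemma dderiv_zero_outside_support:
  assumes "x \<notin> closure {x. \<eta> x \<noteq> 0}"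
  shows "dderiv b \<eta> x = 0"
proof -
  have "(\<eta> has_derivative (\<lambda>_. 0)) (at x)"
  proof (rule has_derivative_transform_within_open)
    show "((\<lambda>_. 0) has_derivative (\<lambda>_. 0)) (at x)" by simp
    show "open (- closure {x. \<eta> x \<noteq> 0})" by (intro open_Compl closed_closure)
    show "0 = \<eta> y" if "y \<in> - closure {x. \<eta> x \<noteq> 0}" for y
      using that closure_subset[of "{x. \<eta> x \<noteq> 0}"] by auto
  qed (use assms in auto)
  from frechet_derivative_at[OF this, symmetric] show ?thesis by (simp add: dderiv_def)
qed

lemma test_fun_dderiv:
  assumes "test_fun S \<eta>" "b \<in> Basis"
  shows "test_fun S (dderiv b \<eta>)"
proof -
  have "Ck (Suc m) \<eta>" for m using assms unfolding test_fun_def by blast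
  hence "Ck m (dderiv b \<eta>)" for m using assms(2) by simp
  moreover have sub: "closure {x. dderiv b \<eta> x \<noteq> 0} \<subseteq> closure {x. \<eta> x \<noteq> 0}"
    using dderiv_zero_outside_support[of _ \<eta> b] by (intro closure_minimal) auto
  moreover have "compact (closure {x. dderiv b \<eta> x \<noteq> 0})"
    using sub assms(1) unfolding test_fun_def
    by (meson closed_closure compact_Int_closed inf.absorb_iff2 bounded_subset compact_eq_bounded_closed)
  ultimately show ?thesis using assms(1) unfolding test_fun_def by blast
qed

lemma test_fun_line_deriv:
  assumes "test_fun S \<eta>"
  shows "((\<lambda>\<tau>. \<eta> (p + \<tau> *\<^sub>R b)) has_real_derivative dderiv b \<eta> (p + \<tau> *\<^sub>R b)) (at \<tau>)"
proof -
  let ?D = "frechet_derivative \<eta> (at (p + \<tau> *\<^sub>R b))"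
  have D: "(\<eta> has_derivative ?D) (at (p + \<tau> *\<^sub>R b))"
    using test_fun_differentiable[OF assms] frechet_derivative_works by blast
  have "((\<lambda>\<tau>. p + \<tau> *\<^sub>R b) has_derivative (\<lambda>h. h *\<^sub>R b)) (at \<tau>)"
    by (auto intro!: derivative_eq_intros)
  from has_derivative_compose[OF this D]
  have "((\<lambda>\<tau>. \<eta> (p + \<tau> *\<^sub>R b)) has_derivative (\<lambda>h. ?D (h *\<^sub>R b))) (at \<tau>)" .
  moreover have "?D (h *\<^sub>R b) = dderiv b \<eta> (p + \<tau> *\<^sub>R b) * h" for h
    using linear_cmul[OF has_derivative_linear[OF D]] by (simp add: dderiv_def)
  ultimately show ?thesis by (simp add: has_field_derivative_def)
qed

lemma Ck_slice:
  fixes f :: "'a::euclidean_space \<times> 'b::euclidean_space \<Rightarrow> real"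
  assumes "Ck m f"
  shows "Ck m (\<lambda>x. f (x, q))"
  using assms
proof (induction m arbitrary: f)
  case 0
  hence "continuous_on UNIV f" by simp
  hence "continuous_on UNIV (\<lambda>x. f (x, q))"
    by (rule continuous_on_compose2) (auto intro: continuous_intros)
  thus ?case by simp
next
  case (Suc m)
  have d: "((\<lambda>x. f (x, q)) has_derivative (\<lambda>h. frechet_derivative f (at (x, q)) (h, 0))) (at x)" for x
  proof -
    have "(f has_derivative frechet_derivative f (at (x, q))) (at (x, q))"
      using Suc.prems frechet_derivative_works by auto
    moreover have "((\<lambda>x. (x, q)) has_derivative (\<lambda>h. (h, 0))) (at x)"
      by (auto intro!: derivative_eq_intros)
    ultimately show ?thesis using has_derivative_compose by blast
  qed
  have "dderiv b (\<lambda>x. f (x, q)) = (\<lambda>x. dderiv (b, 0) f (x, q))" for b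
    using frechet_derivative_at[OF d, symmetric] by (simp add: dderiv_def fun_eq_iff)
  moreover have "(b, 0) \<in> Basis" if "b \<in> Basis" for b :: 'a using that by (auto simp: Basis_prod_def)
  ultimately show ?case using Suc.IH Suc.prems d unfolding Ck.simps differentiable_def by metis
qed

lemma dderiv_slice:
  assumes "f differentiable (at (x, q))"
  shows "dderiv b (\<lambda>x. f (x, q)) x = dderiv (b, 0) f (x, q)"
proof -
  have "(f has_derivative frechet_derivative f (at (x, q))) (at (x, q))"
    using assms frechet_derivative_works by blast
  moreover have "((\<lambda>x. (x, q)) has_derivative (\<lambda>h. (h, 0))) (at x)"
    by (auto intro!: derivative_eq_intros)
  ultimately have "((\<lambda>x. f (x, q)) has_derivative (\<lambda>h. frechet_derivative f (at (x, q)) (h, 0))) (at x)"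
    using has_derivative_compose by blast
  from frechet_derivative_at[OF this, symmetric] show ?thesis by (simp add: dderiv_def)
qed

text \<open>Test functions on the cylinder restrict to test functions on \<open>\<Omega>\<close>; this reduces identities in \<open>x\<close> to the
weak formulations on \<open>\<Omega>\<close>.\<close>

lemma test_fun_slice:
  assumes "test_fun (cyl \<Omega> T) \<eta>"
  shows "test_fun \<Omega> (\<lambda>x. \<eta> (x, q))"
    and "grad (\<lambda>x. \<eta> (x, q)) x = grad_x \<eta> (x, q)"
proof -
  let ?K = "closure {p. \<eta> p \<noteq> 0}"
  have K: "compact ?K" "?K \<subseteq> cyl \<Omega> T" using assms unfolding test_fun_def by auto
  have "closed ((\<lambda>x. (x, q)) -` ?K)" by (intro closed_vimage continuous_intros) auto
  hence sub: "closure {x. \<eta> (x, q) \<noteq> 0} \<subseteq> (\<lambda>x. (x, q)) -` ?K"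
    using closure_subset[of "{p. \<eta> p \<noteq> 0}"] by (intro closure_minimal) auto
  have "(\<lambda>x. (x, q)) -` ?K \<subseteq> fst ` ?K" by force
  moreover have "bounded (fst ` ?K)"
    using K(1) by (intro compact_imp_bounded compact_continuous_image continuous_intros)
  ultimately have "compact (closure {x. \<eta> (x, q) \<noteq> 0})"
    using sub bounded_subset by (metis (no_types, lifting) closed_closure compact_eq_bounded_closed order_trans)
  moreover have "closure {x. \<eta> (x, q) \<noteq> 0} \<subseteq> \<Omega>"
    using sub K(2) by (auto simp: cyl_def)
  ultimately show "test_fun \<Omega> (\<lambda>x. \<eta> (x, q))"
    using assms Ck_slice unfolding test_fun_def by blast
  show "grad (\<lambda>x. \<eta> (x, q)) x = grad_x \<eta> (x, q)"
    unfolding grad_def grad_x_def using dderiv_slice[OF test_fun_differentiable[OF assms]]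
    by (simp add: zero_prod_def)
qed

lemma set_integral_zero_outside:
  fixes f :: "'a \<Rightarrow> 'b::{banach, second_countable_topology}"
  assumes "\<And>p. p \<notin> S \<Longrightarrow> f p = 0"
  shows "(LINT p:S|M. f p) = (\<integral>p. f p \<partial>M)"
  unfolding set_lebesgue_integral_def using assms
  by (intro Bochner_Integration.integral_cong) (auto simp: indicator_def)

lemma test_fun_bounded:
  assumes "test_fun S \<eta>"
  shows "\<exists>B. \<forall>p. \<bar>\<eta> p\<bar> \<le> B"
proof -
  let ?K = "closure {p. \<eta> p \<noteq> 0}"
  have "compact (\<eta> ` ?K)"
    using assms test_fun_continuous[OF assms] unfolding test_fun_def
    by (intro compact_continuous_image) (auto intro: continuous_on_subset)
  from compact_imp_bounded[OF this] obtain B where B: "\<And>p. p \<in> ?K \<Longrightarrow> \<bar>\<eta> p\<bar> \<le> B"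
    unfolding bounded_iff by auto
  have "\<bar>\<eta> p\<bar> \<le> max B 0" for p
  proof (cases "\<eta> p = 0")
    case False
    hence "p \<in> ?K" using closure_subset[of "{p. \<eta> p \<noteq> 0}"] by auto
    from B[OF this] show ?thesis by (rule max.coboundedI1)
  qed simp
  thus ?thesis by blast
qed

lemma borel_measurable_test_fun: "test_fun S \<eta> \<Longrightarrow> \<eta> \<in> borel_measurable borel"
  by (intro borel_measurable_continuous_onI test_fun_continuous)

lemma loc_integrable_compact: "loc_integrable S F \<Longrightarrow> compact K \<Longrightarrow> K \<subseteq> S \<Longrightarrow> set_integrable lborel K F"
  unfolding loc_integrable_def by blast

lemma test_fun_support: "test_fun S \<eta> \<Longrightarrow> compact (closure {p. \<eta> p \<noteq> 0})" 
  "test_fun S \<eta> \<Longrightarrow> closure {p. \<eta> p \<noteq> 0} \<subseteq> S"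
  unfolding test_fun_def by auto

lemma not_in_closure_support: "p \<notin> closure {p. \<eta> p \<noteq> 0} \<Longrightarrow> \<eta> p = 0"
  using closure_subset[of "{p. \<eta> p \<noteq> 0}"] by auto

lemma integrable_mult_test_fun:
  fixes F :: "'p::euclidean_space \<Rightarrow> real"
  assumes F: "F \<in> borel_measurable borel" "loc_integrable S F" and \<eta>: "test_fun S \<eta>"
  shows "integrable lborel (\<lambda>p. F p * \<eta> p)"
proof -
  obtain B where B: "\<And>p. \<bar>\<eta> p\<bar> \<le> B" using test_fun_bounded[OF \<eta>] by blast
  show ?thesis
    using F(1) borel_measurable_test_fun[OF \<eta>] B not_in_closure_support
    by (intro integrable_bilinear_compact_support[OF bounded_bilinear_mult
        loc_integrable_compact[OF F(2) test_fun_support[OF \<eta>]], where B = B]) auto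
qed

lemma d_y_basis: "((0, 1, 0) :: 'n::finite spacetime) \<in> Basis"
  by (auto simp: Basis_prod_def)

lemma test_fun_d_y: "test_fun S \<eta> \<Longrightarrow> test_fun S (d_y \<eta>)"
  unfolding d_y_def by (rule test_fun_dderiv[OF _ d_y_basis])

lemma test_fun_d_y_pow: "test_fun S \<eta> \<Longrightarrow> test_fun S ((d_y ^^ m) \<eta>)"
  by (induction m) (auto intro: test_fun_d_y)

text \<open>The product \<open>F \<eta>\<close> is differentiable in direction \<open>y\<close> everywhere: \<open>F\<close> is for \<open>y > 0\<close>, and elsewhere \<open>\<eta>\<close>
vanishes in a neighbourhood.\<close>

lemma integral_d_y_by_parts:
  fixes F F' :: "'n::finite spacetime \<Rightarrow> real"
  assumes meas: "F \<in> borel_measurable borel" "F' \<in> borel_measurable borel"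
    and loc: "loc_integrable (cyl \<Omega> T) F" "loc_integrable (cyl \<Omega> T) F'"
    and deriv: "\<And>x y t. 0 < y \<Longrightarrow> ((\<lambda>y. F (x, y, t)) has_real_derivative F' (x, y, t)) (at y)"
    and cont: "\<And>x y t. 0 < y \<Longrightarrow> isCont (\<lambda>y. F' (x, y, t)) y"
    and \<eta>: "test_fun (cyl \<Omega> T) \<eta>"
  shows "(\<integral>p. F p * d_y \<eta> p \<partial>lborel) = - (\<integral>p. F' p * \<eta> p \<partial>lborel)"
proof -
  let ?b = "(0, 1, 0) :: 'n spacetime" and ?K = "closure {p. \<eta> p \<noteq> 0}"
  have dy: "d_y \<eta> p = dderiv ?b \<eta> p" for p by (simp add: d_y_def)
  have i: "integrable lborel (\<lambda>p. F p * \<eta> p)" "integrable lborel (\<lambda>p. F' p * \<eta> p)"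
     "integrable lborel (\<lambda>p. F p * d_y \<eta> p)"
    using integrable_mult_test_fun[OF meas(1) loc(1)] integrable_mult_test_fun[OF meas(2) loc(2) \<eta>]
      integrable_mult_test_fun[OF meas(1) loc(1) test_fun_d_y[OF \<eta>]] \<eta> by blast+
  have near: "\<forall>\<^sub>F \<tau>' in nhds \<tau>. p + \<tau>' *\<^sub>R ?b \<notin> ?K" if "p + \<tau> *\<^sub>R ?b \<notin> ?K" for p \<tau>
  proof -
    have lim: "((\<lambda>\<tau>'. p + \<tau>' *\<^sub>R ?b) \<longlongrightarrow> p + \<tau> *\<^sub>R ?b) (nhds \<tau>)"
      by (intro tendsto_add tendsto_scaleR tendsto_const filterlim_ident)
    have "\<forall>\<^sub>F q in nhds (p + \<tau> *\<^sub>R ?b). q \<in> - ?K"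
      using that by (intro eventually_nhds_in_open) (auto simp: open_Compl)
    from eventually_compose_filterlim[OF this lim] show ?thesis by simp
  qed
  have dF: "((\<lambda>\<tau>. F (p + \<tau> *\<^sub>R ?b)) has_real_derivative F' (p + \<tau> *\<^sub>R ?b)) (at \<tau>)"
    and cF: "isCont (\<lambda>\<tau>. F' (p + \<tau> *\<^sub>R ?b)) \<tau>" if "0 < fst (snd (p + \<tau> *\<^sub>R ?b))" for p \<tau>
  proof -
    obtain x y t where p: "p = (x, y, t)" by (cases p) auto
    have y: "0 < y + \<tau>" using that p by simp
    have "((\<lambda>\<tau>. y + \<tau>) has_real_derivative 1) (at \<tau>)" by (auto intro!: derivative_eq_intros)
    from DERIV_chain2[OF deriv[OF y, where x = x and t = t] this]
    show "((\<lambda>\<tau>. F (p + \<tau> *\<^sub>R ?b)) has_real_derivative F' (p + \<tau> *\<^sub>R ?b)) (at \<tau>)" by (simp add: p)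
    have "isCont (\<lambda>\<tau>. y + \<tau>) \<tau>" by simp
    from isCont_o2[OF this cont[OF y, where x = x and t = t]] show "isCont (\<lambda>\<tau>. F' (p + \<tau> *\<^sub>R ?b)) \<tau>" by (simp add: p)
  qed
  have pos: "0 < fst (snd p)" if "p \<in> ?K" for p using test_fun_support(2)[OF \<eta>] that by (auto simp: cyl_def)
  have e: "((\<lambda>\<tau>. \<eta> (p + \<tau> *\<^sub>R ?b)) has_real_derivative d_y \<eta> (p + \<tau> *\<^sub>R ?b)) (at \<tau>)" for p \<tau>
    unfolding d_y_def by (rule test_fun_line_deriv[OF \<eta>])
  have ce: "isCont (\<lambda>\<tau>. d_y \<eta> (p + \<tau> *\<^sub>R ?b)) \<tau>" for p \<tau>
    by (rule DERIV_isCont[OF test_fun_line_deriv[OF test_fun_d_y[OF \<eta>]]])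
  have z: "\<eta> q = 0" "d_y \<eta> q = 0" if "q \<notin> ?K" for q
    using not_in_closure_support[OF that] dderiv_zero_outside_support[OF that] by (simp_all add: dy)
  have "(\<integral>p. F' p * \<eta> p + F p * d_y \<eta> p \<partial>lborel) = 0"
  proof (rule integral_directional_derivative_eq_0[where b = ?b])
    fix p
    show "continuous_on UNIV (\<lambda>\<tau>. F' (p + \<tau> *\<^sub>R ?b) * \<eta> (p + \<tau> *\<^sub>R ?b) + F (p + \<tau> *\<^sub>R ?b) * d_y \<eta> (p + \<tau> *\<^sub>R ?b))"
      unfolding continuous_on_eq_continuous_at[OF open_UNIV]
    proof (intro ballI)
      fix \<tau>
      show "isCont (\<lambda>\<tau>. F' (p + \<tau> *\<^sub>R ?b) * \<eta> (p + \<tau> *\<^sub>R ?b) + F (p + \<tau> *\<^sub>R ?b) * d_y \<eta> (p + \<tau> *\<^sub>R ?b)) \<tau>"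
      proof (cases "p + \<tau> *\<^sub>R ?b \<in> ?K")
        case True
        show ?thesis
          by (intro isCont_add isCont_mult cF[OF pos[OF True]] DERIV_isCont[OF dF[OF pos[OF True]]]
              DERIV_isCont[OF e] ce)
      next
        case False
        from near[OF False] have "\<forall>\<^sub>F \<tau> in nhds \<tau>. F' (p + \<tau> *\<^sub>R ?b) * \<eta> (p + \<tau> *\<^sub>R ?b) + F (p + \<tau> *\<^sub>R ?b) * d_y \<eta> (p + \<tau> *\<^sub>R ?b) = 0"
          by eventually_elim (simp only: z mult_zero_right add_0_right not_False_eq_True)
        from isCont_cong[OF this] show ?thesis by (simp only: continuous_const)
      qed
    qed
    fix \<tau>
    show "((\<lambda>\<tau>. F (p + \<tau> *\<^sub>R ?b) * \<eta> (p + \<tau> *\<^sub>R ?b)) has_real_derivative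
       F' (p + \<tau> *\<^sub>R ?b) * \<eta> (p + \<tau> *\<^sub>R ?b) + F (p + \<tau> *\<^sub>R ?b) * d_y \<eta> (p + \<tau> *\<^sub>R ?b)) (at \<tau>)"
    proof (cases "p + \<tau> *\<^sub>R ?b \<in> ?K")
      case True
      from DERIV_mult[OF dF[OF pos[OF True]] e] show ?thesis by (simp add: mult.commute)
    next
      case False
      from near[OF False] have "\<forall>\<^sub>F \<tau> in nhds \<tau>. F (p + \<tau> *\<^sub>R ?b) * \<eta> (p + \<tau> *\<^sub>R ?b) = 0"
        by eventually_elim (simp only: z mult_zero_right not_False_eq_True)
      from DERIV_cong_ev[OF refl this refl] show ?thesis
        unfolding z[OF False] mult_zero_right add_0_right by (simp only: DERIV_const)
    qed
  qed (use i in simp_all)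
  thus ?thesis using i by simp
qed

lemma integral_d_y_pow_by_parts:
  fixes F :: "nat \<Rightarrow> 'n::finite spacetime \<Rightarrow> real"
  assumes meas: "\<And>j. F j \<in> borel_measurable borel"
    and loc: "\<And>j. loc_integrable (cyl \<Omega> T) (F j)"
    and deriv: "\<And>j x y t. 0 < y \<Longrightarrow> ((\<lambda>y. F j (x, y, t)) has_real_derivative F (Suc j) (x, y, t)) (at y)"
    and \<eta>: "test_fun (cyl \<Omega> T) \<eta>"
  shows "(\<integral>p. F j p * (d_y ^^ m) \<eta> p \<partial>lborel) = (-1) ^ m * (\<integral>p. F (j + m) p * \<eta> p \<partial>lborel)"
proof (induction m arbitrary: j)
  case (Suc m)
  have "(\<integral>p. F j p * (d_y ^^ Suc m) \<eta> p \<partial>lborel) = - (\<integral>p. F (Suc j) p * (d_y ^^ m) \<eta> p \<partial>lborel)"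
    using integral_d_y_by_parts[OF meas meas loc loc deriv DERIV_isCont[OF deriv] test_fun_d_y_pow[OF \<eta>]] by simp
  thus ?case using Suc by simp
qed simp

lemma integral_zero_of_slices:
  fixes f :: "'a::euclidean_space \<times> 'b::euclidean_space \<Rightarrow> 'c::euclidean_space"
  assumes "integrable lborel f" "\<And>q. (\<integral>x. f (x, q) \<partial>lborel) = 0"
  shows "(\<integral>p. f p \<partial>lborel) = 0"
proof -
  have "integrable (lborel \<Otimes>\<^sub>M lborel) (\<lambda>(x, q). f (x, q))" using assms(1) by (simp add: lborel_prod)
  from lborel_pair.integral_snd[OF this] assms(2) show ?thesis by (simp add: lborel_prod)
qed

lemma nn_integral_density_indicator:
  assumes "S \<in> sets borel" "f \<in> borel_measurable borel"
  shows "(\<integral>\<^sup>+ x. f x \<partial>density lborel (indicator S)) = (\<integral>\<^sup>+ x\<in>S. f x \<partial>lborel)"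
  using assms by (subst nn_integral_density) (auto simp: mult.commute)

lemma L1_control_lborel:
  fixes K :: "'p::euclidean_space set"
  assumes S[measurable]: "S \<in> sets borel" and K: "compact K" "K \<subseteq> S"
  shows "\<exists>C. C < \<infinity> \<and> (\<forall>F :: 'p \<Rightarrow> 'a::euclidean_space. F \<in> borel_measurable borel \<longrightarrow>
      (\<integral>\<^sup>+ p\<in>K. ennreal (norm (F p)) \<partial>lborel)\<^sup>2
        \<le> C * (\<integral>\<^sup>+ p. ennreal ((norm (F p))\<^sup>2) \<partial>density lborel (indicator S)))"
proof (intro exI[of _ "emeasure lborel K"] conjI allI impI)
  show "emeasure lborel K < \<infinity>" using emeasure_compact_finite[OF K(1)] by simp
  fix F :: "'p \<Rightarrow> 'a" assume [measurable]: "F \<in> borel_measurable borel"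
  have [measurable]: "K \<in> sets borel" using K(1) by (auto intro: borel_closed compact_imp_closed)
  have "(\<integral>\<^sup>+ p\<in>K. ennreal (norm (F p)) \<partial>lborel)\<^sup>2 =
     (\<integral>\<^sup>+ p. indicator K p * (ennreal (norm (F p)) * indicator K p) \<partial>lborel)\<^sup>2"
    by (intro arg_cong[where f = "\<lambda>x. x\<^sup>2"] nn_integral_cong) (auto simp: indicator_def)
  also have "\<dots> \<le> (\<integral>\<^sup>+ p. (indicator K p)\<^sup>2 \<partial>lborel) * (\<integral>\<^sup>+ p. (ennreal (norm (F p)) * indicator K p)\<^sup>2 \<partial>lborel)"
    by (rule Cauchy_Schwarz_nn_integral) auto
  also have "(\<integral>\<^sup>+ p. (indicator K p :: ennreal)\<^sup>2 \<partial>lborel) = (\<integral>\<^sup>+ p. indicator K p \<partial>lborel)"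
    by (intro nn_integral_cong) (auto simp: indicator_def)
  also have "\<dots> = emeasure lborel K" by simp
  also have "(\<integral>\<^sup>+ p. (ennreal (norm (F p)) * indicator K p)\<^sup>2 \<partial>lborel) \<le> (\<integral>\<^sup>+ p\<in>S. ennreal ((norm (F p))\<^sup>2) \<partial>lborel)"
    using K(2) by (intro nn_integral_mono) (auto simp: indicator_def ennreal_power)
  also have "\<dots> = (\<integral>\<^sup>+ p. ennreal ((norm (F p))\<^sup>2) \<partial>density lborel (indicator S))"
    by (rule nn_integral_density_indicator[symmetric]) auto
  finally show "(\<integral>\<^sup>+ p\<in>K. ennreal (norm (F p)) \<partial>lborel)\<^sup>2
        \<le> emeasure lborel K * (\<integral>\<^sup>+ p. ennreal ((norm (F p))\<^sup>2) \<partial>density lborel (indicator S))"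
    by (simp add: mult_left_mono)
qed

text \<open>Extension by zero turns measurability and integrals on a set into those on the whole space.\<close>

definition zero_ext :: "'a set \<Rightarrow> ('a \<Rightarrow> 'b::real_vector) \<Rightarrow> 'a \<Rightarrow> 'b" where
  "zero_ext S f x = indicator S x *\<^sub>R f x"

lemma zero_ext_simps [simp]: "x \<in> S \<Longrightarrow> zero_ext S f x = f x" "x \<notin> S \<Longrightarrow> zero_ext S f x = 0"
  by (auto simp: zero_ext_def)

lemma L2_zero_ext:
  assumes "L2 S f" "S \<in> sets borel"
  shows "zero_ext S f \<in> borel_measurable borel"
    and "integrable lborel (\<lambda>x. (norm (zero_ext S f x))\<^sup>2)"
    and "(\<integral>\<^sup>+ x. ennreal ((norm (zero_ext S f x))\<^sup>2) \<partial>M) = (\<integral>\<^sup>+ x\<in>S. ennreal ((norm (f x))\<^sup>2) \<partial>M)"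
proof -
  have eq: "zero_ext S f = (\<lambda>x. indicator S x *\<^sub>R f x)" by (auto simp: zero_ext_def)
  show "zero_ext S f \<in> borel_measurable borel"
    using assms(1) by (simp add: eq L2_def set_borel_measurable_def)
  have "(\<lambda>x. (norm (zero_ext S f x))\<^sup>2) = (\<lambda>x. indicator S x *\<^sub>R (norm (f x))\<^sup>2)"
    by (auto simp: zero_ext_def fun_eq_iff indicator_def)
  thus "integrable lborel (\<lambda>x. (norm (zero_ext S f x))\<^sup>2)"
    using assms(1) by (simp add: L2_def set_integrable_def)
  show "(\<integral>\<^sup>+ x. ennreal ((norm (zero_ext S f x))\<^sup>2) \<partial>M) = (\<integral>\<^sup>+ x\<in>S. ennreal ((norm (f x))\<^sup>2) \<partial>M)"
    by (intro nn_integral_cong) (auto simp: zero_ext_def indicator_def)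
qed

lemma L2_zero_ext_finite:
  assumes "L2 S f" "S \<in> sets borel"
  shows "(\<integral>\<^sup>+ x. ennreal ((norm (zero_ext S f x))\<^sup>2) \<partial>lborel) < \<infinity>"
  using L2_zero_ext(2)[OF assms] by (simp add: nn_integral_eq_integral)

lemma L2_set_integrable_compact:
  assumes "L2 S f" "S \<in> sets borel" "compact K" "K \<subseteq> S"
  shows "set_integrable lborel K (zero_ext S f)"
proof (rule set_integrable_of_L2_control[OF assms(3) L1_control_lborel[OF assms(2-4)] L2_zero_ext(1)[OF assms(1,2)]])
  have "(\<integral>\<^sup>+ x. ennreal ((norm (zero_ext S f x))\<^sup>2) \<partial>density lborel (indicator S))
     = (\<integral>\<^sup>+ x\<in>S. ennreal ((norm (zero_ext S f x))\<^sup>2) \<partial>lborel)"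
    using L2_zero_ext(1)[OF assms(1,2)] by (intro nn_integral_density_indicator assms) auto
  also have "\<dots> \<le> (\<integral>\<^sup>+ x. ennreal ((norm (zero_ext S f x))\<^sup>2) \<partial>lborel)"
    by (intro nn_integral_mono) (auto simp: indicator_def)
  also have "\<dots> < \<infinity>" by (rule L2_zero_ext_finite[OF assms(1,2)])
  finally show "(\<integral>\<^sup>+ x. ennreal ((norm (zero_ext S f x))\<^sup>2) \<partial>density lborel (indicator S)) < \<infinity>" .
qed

lemma integrable_continuous_compact_support:
  fixes f :: "'a::euclidean_space \<Rightarrow> 'b::euclidean_space"
  assumes "continuous_on UNIV f" "compact K" "\<And>x. x \<notin> K \<Longrightarrow> f x = 0"
  shows "integrable lborel f"
proof -
  have "integrable lborel (\<lambda>x. indicator K x *\<^sub>R f x)"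
    using assms by (intro borel_integrable_compact) (auto intro: continuous_on_subset)
  moreover have "(\<lambda>x. indicator K x *\<^sub>R f x) = f" using assms(3) by (auto simp: indicator_def)
  ultimately show ?thesis by simp
qed

lemma axis_Basis: "axis i (1::real) \<in> Basis"
  by (simp add: axis_in_Basis_iff)

lemma continuous_grad: "test_fun S v \<Longrightarrow> continuous_on UNIV (grad v)"
  unfolding grad_def
  by (intro continuous_on_vec_lambda test_fun_continuous[OF test_fun_dderiv] axis_Basis)

lemma test_fun_obtain_support:
  assumes "test_fun S \<eta>"
  obtains K where "compact K" "K \<subseteq> S" "\<And>x. x \<notin> K \<Longrightarrow> \<eta> x = 0" "\<And>x b. x \<notin> K \<Longrightarrow> dderiv b \<eta> x = 0"
  using test_fun_support[OF assms] not_in_closure_support[where \<eta> = \<eta>] dderiv_zero_outside_support[where \<eta> = \<eta>]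
  by blast

lemma grad_zero: "(\<And>b. dderiv b v x = 0) \<Longrightarrow> grad v x = 0"
  by (simp add: grad_def vec_eq_iff)

lemma L2_continuous_compact_support:
  fixes f :: "'a::euclidean_space \<Rightarrow> 'b::euclidean_space"
  assumes "continuous_on UNIV f" "compact K" "\<And>x. x \<notin> K \<Longrightarrow> f x = 0" "S \<in> sets borel"
  shows "L2 S f"
proof -
  have [measurable]: "f \<in> borel_measurable borel" by (intro borel_measurable_continuous_onI assms)
  have "integrable lborel (\<lambda>x. (norm (f x))\<^sup>2)"
    by (rule integrable_continuous_compact_support[OF continuous_on_power[OF continuous_on_norm[OF assms(1)]] assms(2)])
      (simp add: assms(3))
  from integrable_mult_indicator[OF _ this] assms(4) show ?thesis
    unfolding L2_def set_borel_measurable_def set_integrable_def by auto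
qed

lemma H01_grad_test_fun:
  assumes "test_fun \<Omega> v" "\<Omega> \<in> sets borel"
  shows "H01_grad \<Omega> v (grad v)"
proof -
  obtain K where K: "compact K" "\<And>x. x \<notin> K \<Longrightarrow> v x = 0" "\<And>x b. x \<notin> K \<Longrightarrow> dderiv b v x = 0"
    using test_fun_obtain_support[OF assms(1)] by metis
  have "L2 \<Omega> v" "L2 \<Omega> (grad v)"
    using L2_continuous_compact_support[OF test_fun_continuous[OF assms(1)] K(1,2) assms(2)]
      L2_continuous_compact_support[OF continuous_grad[OF assms(1)] K(1) grad_zero[OF K(3)] assms(2)] by auto
  thus ?thesis unfolding H01_grad_def L2_tendsto_def using assms(1)
    by (intro conjI exI[of _ "\<lambda>_. v"]) auto
qed

lemma integral_grad_by_parts: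
  assumes u: "test_fun S u" and v: "test_fun S' v"
  shows "(\<integral>x. u x *\<^sub>R grad v x \<partial>lborel) = - (\<integral>x. v x *\<^sub>R grad u x \<partial>lborel)"
proof -
  obtain K where K: "compact K" "\<And>x. x \<notin> K \<Longrightarrow> v x = 0" "\<And>x b. x \<notin> K \<Longrightarrow> dderiv b v x = 0"
    using test_fun_obtain_support[OF v] by metis
  have i: "integrable lborel (\<lambda>x. u x *\<^sub>R grad v x)" "integrable lborel (\<lambda>x. v x *\<^sub>R grad u x)"
    by (simp_all add: integrable_continuous_compact_support[OF _ K(1)] continuous_on_scaleR K grad_zero
        test_fun_continuous[OF u] test_fun_continuous[OF v] continuous_grad[OF u] continuous_grad[OF v])
  have "(\<integral>x. u x *\<^sub>R grad v x + v x *\<^sub>R grad u x \<partial>lborel) $ i = 0" for i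
  proof -
    have "(\<integral>x. u x *\<^sub>R grad v x + v x *\<^sub>R grad u x \<partial>lborel) $ i
       = (\<integral>x. (u x *\<^sub>R grad v x + v x *\<^sub>R grad u x) $ i \<partial>lborel)"
      by (rule integral_bounded_linear[OF bounded_linear_vec_nth, symmetric]) (use i in simp)
    also have "\<dots> = (\<integral>x. dderiv (axis i 1) u x * v x + u x * dderiv (axis i 1) v x \<partial>lborel)"
      by (intro Bochner_Integration.integral_cong) (simp_all add: grad_def algebra_simps)
    also have "\<dots> = 0"
    proof (rule integral_directional_derivative_eq_0[where w = "\<lambda>x. u x * v x" and b = "axis i 1"])
      have d: "continuous_on UNIV (dderiv (axis i 1) u)" "continuous_on UNIV (dderiv (axis i 1) v)"
        using test_fun_continuous[OF test_fun_dderiv] u v axis_Basis by blast+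
      note c = d test_fun_continuous[OF u] test_fun_continuous[OF v]
      show "integrable lborel (\<lambda>x. u x * v x)"
        "integrable lborel (\<lambda>x. dderiv (axis i 1) u x * v x + u x * dderiv (axis i 1) v x)"
        by (simp_all add: integrable_continuous_compact_support[OF _ K(1)]
            continuous_on_add continuous_on_mult c K)
      fix p \<tau>
      have c2: "continuous_on UNIV (\<lambda>x. dderiv (axis i 1) u x * v x + u x * dderiv (axis i 1) v x)"
        by (intro continuous_on_add continuous_on_mult c)
      show "continuous_on UNIV (\<lambda>\<tau>. dderiv (axis i 1) u (p + \<tau> *\<^sub>R axis i 1) * v (p + \<tau> *\<^sub>R axis i 1)
         + u (p + \<tau> *\<^sub>R axis i 1) * dderiv (axis i 1) v (p + \<tau> *\<^sub>R axis i 1))"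
        by (rule continuous_on_compose2[OF c2, where f = "\<lambda>\<tau>. p + \<tau> *\<^sub>R axis i 1"])
          (intro continuous_on_add continuous_on_scaleR continuous_on_id continuous_on_const, simp)
      from DERIV_mult[OF test_fun_line_deriv[OF u] test_fun_line_deriv[OF v]]
      show "((\<lambda>\<tau>. u (p + \<tau> *\<^sub>R axis i 1) * v (p + \<tau> *\<^sub>R axis i 1)) has_real_derivative
         dderiv (axis i 1) u (p + \<tau> *\<^sub>R axis i 1) * v (p + \<tau> *\<^sub>R axis i 1)
         + u (p + \<tau> *\<^sub>R axis i 1) * dderiv (axis i 1) v (p + \<tau> *\<^sub>R axis i 1)) (at \<tau>)"
        by (simp add: mult.commute)
    qed
    finally show ?thesis .
  qed
  hence "(\<integral>x. u x *\<^sub>R grad v x + v x *\<^sub>R grad u x \<partial>lborel) = 0" by (simp add: vec_eq_iff)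
  thus ?thesis using i by (simp add: eq_neg_iff_add_eq_0)
qed

text \<open>The identity holds for the approximating test functions and passes to the limit.\<close>

lemma H01_integral_by_parts:
  assumes \<Omega>: "open \<Omega>" and H: "H01_grad \<Omega> u G" and v: "test_fun \<Omega> v"
  shows "integrable lborel (\<lambda>x. zero_ext \<Omega> u x *\<^sub>R grad v x)"
    and "integrable lborel (\<lambda>x. v x *\<^sub>R zero_ext \<Omega> G x)"
    and "(\<integral>x. zero_ext \<Omega> u x *\<^sub>R grad v x \<partial>lborel) = - (\<integral>x. v x *\<^sub>R zero_ext \<Omega> G x \<partial>lborel)"
proof -
  have S: "\<Omega> \<in> sets borel" using \<Omega> by simp
  let ?M = "density lborel (indicator \<Omega>) :: (real^'a) measure"
  obtain K where K: "compact K" "K \<subseteq> \<Omega>" and v0: "\<And>x. x \<notin> K \<Longrightarrow> v x = 0"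
      "\<And>x. x \<notin> K \<Longrightarrow> grad v x = 0"
    using test_fun_obtain_support[OF v] grad_zero by metis
  obtain \<eta> where L: "L2 \<Omega> u" "L2 \<Omega> G" and \<eta>: "\<And>j. test_fun \<Omega> (\<eta> j)"
    and lim: "L2_tendsto \<Omega> \<eta> u" "L2_tendsto \<Omega> (\<lambda>j. grad (\<eta> j)) G"
    using H unfolding H01_grad_def by blast
  note m[measurable] = L2_zero_ext(1)[OF L(1) S] L2_zero_ext(1)[OF L(2) S]
    borel_measurable_test_fun[OF v] borel_measurable_continuous_onI[OF continuous_grad[OF v]]
  have [measurable]: "\<eta> j \<in> borel_measurable borel" "grad (\<eta> j) \<in> borel_measurable borel" for j
    using \<eta> by (auto intro: borel_measurable_test_fun borel_measurable_continuous_onI continuous_grad)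
  note iu = L2_set_integrable_compact[OF L(1) S K] and iG = L2_set_integrable_compact[OF L(2) S K]
  have i\<eta>: "set_integrable lborel K (\<eta> j)" "set_integrable lborel K (grad (\<eta> j))" for j
    unfolding set_integrable_def
    by (rule borel_integrable_compact[OF K(1)], rule continuous_on_subset[OF test_fun_continuous[OF \<eta>]], simp)
      (rule borel_integrable_compact[OF K(1)], rule continuous_on_subset[OF continuous_grad[OF \<eta>]], simp)
  have "bounded (grad v ` K)" using continuous_grad[OF v] K(1)
    by (intro compact_imp_bounded compact_continuous_image) (auto intro: continuous_on_subset)
  then obtain B1 where "\<And>x. x \<in> K \<Longrightarrow> norm (grad v x) \<le> B1" unfolding bounded_iff by auto
  hence B1: "norm (grad v x) \<le> \<bar>B1\<bar>" for x
    using v0(2)[of x] by (cases "x \<in> K") (auto intro: order_trans[OF _ abs_ge_self])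
  obtain B2 where B2: "\<And>x. norm (v x) \<le> B2" using test_fun_bounded[OF v] by auto
  note bl1 = bounded_bilinear_scaleR and bl2 = bounded_bilinear.flip[OF bounded_bilinear_scaleR]
  show i1: "integrable lborel (\<lambda>x. zero_ext \<Omega> u x *\<^sub>R grad v x)"
    by (rule integrable_bilinear_compact_support[OF bl1 iu, where B = "\<bar>B1\<bar>"])
      (use B1 v0 in auto)
  show i2: "integrable lborel (\<lambda>x. v x *\<^sub>R zero_ext \<Omega> G x)"
    by (rule integrable_bilinear_compact_support[OF bl2 iG, where B = B2])
      (use B2 v0 in auto)
  have lim1: "(\<lambda>j. \<integral>x. \<eta> j x *\<^sub>R grad v x \<partial>lborel) \<longlonglongrightarrow> (\<integral>x. zero_ext \<Omega> u x *\<^sub>R grad v x \<partial>lborel)"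
  proof (rule L2_tendsto_integral_bilinear[OF bl1 K(1) L1_control_lborel[OF S K] _ _ i\<eta>(1) iu, where B = "\<bar>B1\<bar>"])
    have "(\<integral>\<^sup>+ x. ennreal ((norm (\<eta> j x - zero_ext \<Omega> u x))\<^sup>2) \<partial>?M) = (\<integral>\<^sup>+ x\<in>\<Omega>. ennreal ((norm (\<eta> j x - u x))\<^sup>2) \<partial>lborel)" for j
      using S by (subst nn_integral_density_indicator) (auto intro!: nn_integral_cong simp: indicator_def)
    thus "(\<lambda>j. \<integral>\<^sup>+ x. ennreal ((norm (\<eta> j x - zero_ext \<Omega> u x))\<^sup>2) \<partial>?M) \<longlonglongrightarrow> 0"
      using lim(1) unfolding L2_tendsto_def by simp
  qed (use B1 v0 in auto)
  have lim2: "(\<lambda>j. \<integral>x. v x *\<^sub>R grad (\<eta> j) x \<partial>lborel) \<longlonglongrightarrow> (\<integral>x. v x *\<^sub>R zero_ext \<Omega> G x \<partial>lborel)"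
  proof (rule L2_tendsto_integral_bilinear[OF bl2 K(1) L1_control_lborel[OF S K] _ _ i\<eta>(2) iG, where B = B2])
    have "(\<integral>\<^sup>+ x. ennreal ((norm (grad (\<eta> j) x - zero_ext \<Omega> G x))\<^sup>2) \<partial>?M) = (\<integral>\<^sup>+ x\<in>\<Omega>. ennreal ((norm (grad (\<eta> j) x - G x))\<^sup>2) \<partial>lborel)" for j
      using S by (subst nn_integral_density_indicator) (auto intro!: nn_integral_cong simp: indicator_def)
    thus "(\<lambda>j. \<integral>\<^sup>+ x. ennreal ((norm (grad (\<eta> j) x - zero_ext \<Omega> G x))\<^sup>2) \<partial>?M) \<longlonglongrightarrow> 0"
      using lim(2) unfolding L2_tendsto_def by simp
  qed (use B2 v0 in auto)
  have "(\<lambda>j. \<integral>x. \<eta> j x *\<^sub>R grad v x \<partial>lborel) \<longlonglongrightarrow> - (\<integral>x. v x *\<^sub>R zero_ext \<Omega> G x \<partial>lborel)"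
    unfolding integral_grad_by_parts[OF \<eta> v] by (intro tendsto_minus lim2)
  from LIMSEQ_unique[OF lim1 this]
  show "(\<integral>x. zero_ext \<Omega> u x *\<^sub>R grad v x \<partial>lborel) = - (\<integral>x. v x *\<^sub>R zero_ext \<Omega> G x \<partial>lborel)" .
qed

section \<open>The energy form and orthogonality\<close>

lemma integrable_of_L2_bound:
  fixes f :: "'p::euclidean_space \<Rightarrow> 'a::euclidean_space" and g :: "'p \<Rightarrow> 'b::euclidean_space"
    and Q :: "'p \<Rightarrow> 'c::euclidean_space"
  assumes f: "L2 S f" and g: "L2 S g" and S: "S \<in> sets borel" and Q: "Q \<in> borel_measurable borel"
    and bnd: "AE x in lborel. norm (Q x) \<le> C * (norm (zero_ext S f x) * norm (zero_ext S g x))"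
  shows "integrable lborel Q"
proof (rule Bochner_Integration.integrable_bound)
  show "integrable lborel (\<lambda>x. \<bar>C\<bar> * ((norm (zero_ext S f x))\<^sup>2 + (norm (zero_ext S g x))\<^sup>2))"
    using L2_zero_ext(2)[OF f S] L2_zero_ext(2)[OF g S] by simp
  show "AE x in lborel. norm (Q x) \<le> norm (\<bar>C\<bar> * ((norm (zero_ext S f x))\<^sup>2 + (norm (zero_ext S g x))\<^sup>2))"
    using bnd
  proof eventually_elim
    case (elim x)
    let ?a = "norm (zero_ext S f x)" and ?b = "norm (zero_ext S g x)"
    have "2 * ?a * ?b \<le> ?a\<^sup>2 + ?b\<^sup>2" by (rule sum_squares_bound)
    moreover have "0 \<le> ?a * ?b" by simp
    ultimately have ab: "?a * ?b \<le> ?a\<^sup>2 + ?b\<^sup>2" by linarith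
    have "C * (?a * ?b) \<le> \<bar>C\<bar> * (?a * ?b)" by (intro mult_right_mono) auto
    also have "\<dots> \<le> \<bar>C\<bar> * (?a\<^sup>2 + ?b\<^sup>2)" using ab by (intro mult_left_mono) auto
    finally show ?case using elim by simp
  qed
qed (use Q in simp)

lemma bounded_bilinear_matrix_vector:
  "bounded_bilinear (\<lambda>(M :: real^'n^'n) x. M *v x)"
  unfolding bilinear_conv_bounded_bilinear[symmetric] bilinear_def
  by (auto intro!: linearI simp: matrix_vector_mult_add_rdistrib matrix_vector_right_distrib
      scaleR_matrix_vector_assoc matrix_vector_mult_scaleR)

lemma borel_measurable_matrix_vector [measurable]:
  fixes M :: "'a \<Rightarrow> real^'n^'n"
  assumes "M \<in> borel_measurable N" "g \<in> borel_measurable N"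
  shows "(\<lambda>x. M x *v g x) \<in> borel_measurable N"
proof (rule borel_measurable_continuous_Pair[OF assms])
  show "continuous_on UNIV (\<lambda>x :: (real^'n^'n) \<times> (real^'n). fst x *v snd x)"
    by (intro bounded_bilinear.continuous_on[OF bounded_bilinear_matrix_vector] continuous_intros)
qed

text \<open>The integrand of the bilinear form of the operator, extended by zero.\<close>

definition energy_density ::
  "(real^'n) set \<Rightarrow> (real^'n \<Rightarrow> real^'n^'n) \<Rightarrow> (real^'n \<Rightarrow> real) \<Rightarrow> (real^'n \<Rightarrow> real) \<Rightarrow> (real^'n \<Rightarrow> real^'n)
    \<Rightarrow> (real^'n \<Rightarrow> real) \<Rightarrow> (real^'n \<Rightarrow> real^'n) \<Rightarrow> real^'n \<Rightarrow> real" where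
  "energy_density \<Omega> A c u G v H x = (zero_ext \<Omega> A x *v zero_ext \<Omega> G x) \<bullet> zero_ext \<Omega> H x
     + zero_ext \<Omega> c x * zero_ext \<Omega> u x * zero_ext \<Omega> v x"

lemma energy_integral:
  "(LINT x:\<Omega>|lborel. (A x *v G x) \<bullet> H x + c x * u x * v x) = (\<integral>x. energy_density \<Omega> A c u G v H x \<partial>lborel)"
  unfolding set_lebesgue_integral_def energy_density_def
  by (intro Bochner_Integration.integral_cong) (auto simp: zero_ext_def indicator_def)

lemma integral_zero_ext_mult:
  "(LINT x:\<Omega>|lborel. u x * v x) = (\<integral>x. zero_ext \<Omega> u x * zero_ext \<Omega> v x \<partial>lborel)" for u v :: "_ \<Rightarrow> real"
  unfolding set_lebesgue_integral_def
  by (intro Bochner_Integration.integral_cong) (auto simp: zero_ext_def indicator_def)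

lemma admissible_coeffs_zero_ext:
  assumes \<Omega>: "open \<Omega>" "bounded \<Omega>" and adm: "admissible_coeffs \<Omega> A c"
  shows "zero_ext \<Omega> A \<in> borel_measurable borel" "zero_ext \<Omega> c \<in> borel_measurable borel"
    and "\<exists>B. \<forall>x. norm (zero_ext \<Omega> A x) \<le> B" and "\<exists>B. AE x in lborel. norm (zero_ext \<Omega> c x) \<le> B"
    and "AE x in lborel. 0 \<le> zero_ext \<Omega> c x"
    and "continuous_on \<Omega> A"
proof -
  obtain L where L: "L-lipschitz_on \<Omega> A" using adm unfolding admissible_coeffs_def by blast
  show cont: "continuous_on \<Omega> A" using L by (rule lipschitz_on_continuous_on)
  have "zero_ext \<Omega> A = (\<lambda>x. indicator \<Omega> x *\<^sub>R A x)" by (auto simp: zero_ext_def)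
  thus "zero_ext \<Omega> A \<in> borel_measurable borel"
    using borel_measurable_continuous_on_indicator[OF _ cont] \<Omega>(1) by simp
  have "zero_ext \<Omega> c = (\<lambda>x. indicator \<Omega> x *\<^sub>R c x)" by (auto simp: zero_ext_def)
  thus "zero_ext \<Omega> c \<in> borel_measurable borel"
    using adm by (simp add: admissible_coeffs_def set_borel_measurable_def)
  have "bounded (A ` \<Omega>)"
    using lipschitz_on_uniformly_continuous[OF L] \<Omega>(2) by (rule bounded_uniformly_continuous_image)
  then obtain B where B: "\<And>x. x \<in> \<Omega> \<Longrightarrow> norm (A x) \<le> B" unfolding bounded_iff by auto
  hence "norm (zero_ext \<Omega> A x) \<le> \<bar>B\<bar>" for x
    by (cases "x \<in> \<Omega>") (auto intro: order_trans[OF _ abs_ge_self])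
  thus "\<exists>B. \<forall>x. norm (zero_ext \<Omega> A x) \<le> B" by blast
  obtain M where M: "AE x in lborel. x \<in> \<Omega> \<longrightarrow> 0 \<le> c x \<and> c x \<le> M"
    using adm unfolding admissible_coeffs_def by blast
  have "AE x in lborel. 0 \<le> zero_ext \<Omega> c x \<and> norm (zero_ext \<Omega> c x) \<le> \<bar>M\<bar>"
    using M
  proof eventually_elim
    case (elim x)
    thus ?case by (cases "x \<in> \<Omega>") auto
  qed
  thus "\<exists>B. AE x in lborel. norm (zero_ext \<Omega> c x) \<le> B" "AE x in lborel. 0 \<le> zero_ext \<Omega> c x"
    by (auto elim: eventually_mono intro: exI[of _ "\<bar>M\<bar>"])
qed

lemma integrable_energy_density:
  assumes \<Omega>: "open \<Omega>" "bounded \<Omega>" and adm: "admissible_coeffs \<Omega> A c"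
    and L: "L2 \<Omega> u" "L2 \<Omega> G" "L2 \<Omega> v" "L2 \<Omega> H"
  shows "integrable lborel (energy_density \<Omega> A c u G v H)"
proof -
  have S: "\<Omega> \<in> sets borel" using \<Omega> by simp
  note a = admissible_coeffs_zero_ext[OF \<Omega> adm]
  note [measurable] = a(1,2) L[THEN L2_zero_ext(1), OF S]
  obtain MA where MA: "\<And>x. norm (zero_ext \<Omega> A x) \<le> MA" using a(3) by blast
  obtain Mc where Mc: "AE x in lborel. norm (zero_ext \<Omega> c x) \<le> Mc" using a(4) by blast
  obtain C where C: "0 < C" "\<And>(M :: real^'a^'a) x. norm (M *v x) \<le> norm M * norm x * C"
    using bounded_bilinear.pos_bounded[OF bounded_bilinear_matrix_vector] by blast
  have "integrable lborel (\<lambda>x. (zero_ext \<Omega> A x *v zero_ext \<Omega> G x) \<bullet> zero_ext \<Omega> H x)"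
  proof (rule integrable_of_L2_bound[OF L(2,4) S, where C = "MA * C"])
    show "AE x in lborel. norm ((zero_ext \<Omega> A x *v zero_ext \<Omega> G x) \<bullet> zero_ext \<Omega> H x)
       \<le> MA * C * (norm (zero_ext \<Omega> G x) * norm (zero_ext \<Omega> H x))"
    proof (rule AE_I2)
      fix x
      have "norm ((zero_ext \<Omega> A x *v zero_ext \<Omega> G x) \<bullet> zero_ext \<Omega> H x)
        \<le> norm (zero_ext \<Omega> A x *v zero_ext \<Omega> G x) * norm (zero_ext \<Omega> H x)"
        using Cauchy_Schwarz_ineq2 by simp
      also have "\<dots> \<le> (norm (zero_ext \<Omega> A x) * norm (zero_ext \<Omega> G x) * C) * norm (zero_ext \<Omega> H x)"
        by (intro mult_right_mono C) auto
      also have "\<dots> \<le> (MA * norm (zero_ext \<Omega> G x) * C) * norm (zero_ext \<Omega> H x)"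
        using C by (intro mult_right_mono MA) auto
      finally show "norm ((zero_ext \<Omega> A x *v zero_ext \<Omega> G x) \<bullet> zero_ext \<Omega> H x)
       \<le> MA * C * (norm (zero_ext \<Omega> G x) * norm (zero_ext \<Omega> H x))" by (simp add: mult_ac)
    qed
  qed measurable
  moreover have "integrable lborel (\<lambda>x. zero_ext \<Omega> c x * zero_ext \<Omega> u x * zero_ext \<Omega> v x)"
  proof (rule integrable_of_L2_bound[OF L(1,3) S, where C = Mc])
    show "AE x in lborel. norm (zero_ext \<Omega> c x * zero_ext \<Omega> u x * zero_ext \<Omega> v x)
       \<le> Mc * (norm (zero_ext \<Omega> u x) * norm (zero_ext \<Omega> v x))"
      using Mc by eventually_elim (simp add: abs_mult mult.assoc mult_right_mono)
  qed measurable
  ultimately show ?thesis unfolding energy_density_def by simp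
qed

lemma energy_density_coercive:
  assumes \<Omega>: "open \<Omega>" "bounded \<Omega>" and adm: "admissible_coeffs \<Omega> A c"
  shows "\<exists>a>0. \<forall>u G. AE x in lborel. a * (norm (zero_ext \<Omega> G x))\<^sup>2 \<le> energy_density \<Omega> A c u G u G x"
proof -
  obtain a where a: "0 < a" "\<And>x \<xi>. x \<in> \<Omega> \<Longrightarrow> a * (norm \<xi>)\<^sup>2 \<le> \<xi> \<bullet> (A x *v \<xi>)"
    using adm unfolding admissible_coeffs_def by blast
  have "AE x in lborel. a * (norm (zero_ext \<Omega> G x))\<^sup>2 \<le> energy_density \<Omega> A c u G u G x" for u G
    using admissible_coeffs_zero_ext(5)[OF \<Omega> adm]
  proof eventually_elim
    case (elim x)
    show ?case
    proof (cases "x \<in> \<Omega>")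
      case True
      have "0 \<le> c x * (u x * u x)" using elim True by simp
      thus ?thesis using a(2)[OF True, of "G x"] True
        by (simp add: energy_density_def inner_commute mult.assoc)
    qed (simp add: energy_density_def)
  qed
  thus ?thesis using a(1) by blast
qed

lemma L2_sum_scaleR:
  fixes f :: "nat \<Rightarrow> 'a::euclidean_space \<Rightarrow> 'b::euclidean_space"
  assumes "\<And>k. L2 S (f k)" "S \<in> sets borel" "finite I"
  shows "L2 S (\<lambda>x. \<Sum>k\<in>I. a k *\<^sub>R f k x)"
  using assms(3)
proof induction
  case empty
  show ?case by (simp add: L2_def set_borel_measurable_def set_integrable_def)
next
  case (insert j I)
  let ?g = "\<lambda>x. \<Sum>k\<in>I. a k *\<^sub>R f k x"
  note j = L2_zero_ext[OF assms(1)[of j] assms(2)] and g = L2_zero_ext[OF insert.IH assms(2)]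
  have eq: "zero_ext S (\<lambda>x. \<Sum>k\<in>insert j I. a k *\<^sub>R f k x) = (\<lambda>x. a j *\<^sub>R zero_ext S (f j) x + zero_ext S ?g x)"
    using insert.hyps by (auto simp: zero_ext_def fun_eq_iff scaleR_add_right indicator_def)
  have m: "zero_ext S (\<lambda>x. \<Sum>k\<in>insert j I. a k *\<^sub>R f k x) \<in> borel_measurable borel"
    unfolding eq using j(1) g(1) by simp
  have "integrable lborel (\<lambda>x. (norm (zero_ext S (\<lambda>x. \<Sum>k\<in>insert j I. a k *\<^sub>R f k x) x))\<^sup>2)"
  proof (rule Bochner_Integration.integrable_bound)
    show "integrable lborel (\<lambda>x. 2 * ((a j)\<^sup>2 * (norm (zero_ext S (f j) x))\<^sup>2) + 2 * (norm (zero_ext S ?g x))\<^sup>2)"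
      using j(2) g(2) by simp
    have "(norm (a j *\<^sub>R zero_ext S (f j) x + zero_ext S ?g x))\<^sup>2
       \<le> 2 * ((a j)\<^sup>2 * (norm (zero_ext S (f j) x))\<^sup>2) + 2 * (norm (zero_ext S ?g x))\<^sup>2" for x
    proof -
      let ?u = "a j *\<^sub>R zero_ext S (f j) x" and ?v = "zero_ext S ?g x"
      have "(norm (?u + ?v))\<^sup>2 \<le> (norm ?u + norm ?v)\<^sup>2" by (intro power_mono norm_triangle_ineq) auto
      also have "\<dots> \<le> 2 * (norm ?u)\<^sup>2 + 2 * (norm ?v)\<^sup>2"
        using sum_squares_bound[of "norm ?u" "norm ?v"] by (simp add: power2_sum)
      finally show ?thesis by (simp add: power_mult_distrib)
    qed
    thus "AE x in lborel. norm ((norm (zero_ext S (\<lambda>x. \<Sum>k\<in>insert j I. a k *\<^sub>R f k x) x))\<^sup>2)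
      \<le> norm (2 * ((a j)\<^sup>2 * (norm (zero_ext S (f j) x))\<^sup>2) + 2 * (norm (zero_ext S ?g x))\<^sup>2)"
      unfolding eq by (intro AE_I2) simp
  qed (use m in simp)
  moreover have "(\<lambda>x. (norm (zero_ext S h x))\<^sup>2) = (\<lambda>x. indicator S x *\<^sub>R (norm (h x))\<^sup>2)" for h :: "'a \<Rightarrow> 'b"
    by (auto simp: zero_ext_def fun_eq_iff indicator_def)
  moreover have "zero_ext S h = (\<lambda>x. indicator S x *\<^sub>R h x)" for h :: "'a \<Rightarrow> 'b" by (auto simp: zero_ext_def)
  ultimately show ?case using m unfolding L2_def set_borel_measurable_def set_integrable_def by simp
qed

lemma energy_density_sum:
  fixes G :: "nat \<Rightarrow> real^'n \<Rightarrow> real^'n"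
  shows "energy_density \<Omega> A c (\<lambda>x. \<Sum>k\<in>I. a k *\<^sub>R u k x) (\<lambda>x. \<Sum>k\<in>I. a k *\<^sub>R G k x)
      (\<lambda>x. \<Sum>k\<in>I. a k *\<^sub>R u k x) (\<lambda>x. \<Sum>k\<in>I. a k *\<^sub>R G k x) x
    = (\<Sum>j\<in>I. \<Sum>k\<in>I. a j * a k * energy_density \<Omega> A c (u j) (G j) (u k) (G k) x)"
proof (cases "x \<in> \<Omega>")
  case True
  note bb = bounded_bilinear_matrix_vector
  have "(A x *v (\<Sum>k\<in>I. a k *\<^sub>R G k x)) \<bullet> (\<Sum>k\<in>I. a k *\<^sub>R G k x)
     = (\<Sum>j\<in>I. \<Sum>k\<in>I. a j * a k * ((A x *v G j x) \<bullet> G k x))"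
    by (simp add: bounded_bilinear.sum_right[OF bb] bounded_bilinear.scaleR_right[OF bb]
        inner_sum_left inner_sum_right sum_distrib_left mult_ac)
      (subst sum.swap, simp add: mult_ac)
  moreover have "c x * (\<Sum>k\<in>I. a k *\<^sub>R u k x) * (\<Sum>k\<in>I. a k *\<^sub>R u k x)
     = (\<Sum>j\<in>I. \<Sum>k\<in>I. a j * a k * (c x * u j x * u k x))"
    by (simp add: sum_distrib_left sum_distrib_right mult_ac)
  ultimately show ?thesis using True by (simp add: energy_density_def sum.distrib[symmetric] algebra_simps)
qed (simp add: energy_density_def)

lemma basis_sum_norm:
  assumes "orthonormal_basis_L2 \<Omega> \<phi>" "\<Omega> \<in> sets borel" "finite I"
  shows "(\<integral>\<^sup>+ x. ennreal ((norm (\<Sum>k\<in>I. a k *\<^sub>R zero_ext \<Omega> (\<phi> k) x))\<^sup>2) \<partial>lborel) = ennreal (\<Sum>k\<in>I. (a k)\<^sup>2)"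
proof -
  have L: "L2 \<Omega> (\<phi> k)" and o: "(LINT x:\<Omega>|lborel. \<phi> j x * \<phi> k x) = (if j = k then 1 else 0)" for j k
    using assms(1) unfolding orthonormal_basis_L2_def by auto
  have i: "integrable lborel (\<lambda>x. zero_ext \<Omega> (\<phi> j) x * zero_ext \<Omega> (\<phi> k) x)" for j k
    using L2_zero_ext(1)[OF L assms(2)]
    by (intro integrable_of_L2_bound[OF L L assms(2), where C = 1]) (auto simp: abs_mult)
  have eq: "(norm (\<Sum>k\<in>I. a k *\<^sub>R zero_ext \<Omega> (\<phi> k) x))\<^sup>2
     = (\<Sum>j\<in>I. \<Sum>k\<in>I. a j * a k * (zero_ext \<Omega> (\<phi> j) x * zero_ext \<Omega> (\<phi> k) x))" for x
    by (simp add: power2_eq_square sum_product mult_ac)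
  have "(\<integral>\<^sup>+ x. ennreal ((norm (\<Sum>k\<in>I. a k *\<^sub>R zero_ext \<Omega> (\<phi> k) x))\<^sup>2) \<partial>lborel)
     = ennreal (\<integral>x. (norm (\<Sum>k\<in>I. a k *\<^sub>R zero_ext \<Omega> (\<phi> k) x))\<^sup>2 \<partial>lborel)"
  proof (rule nn_integral_eq_integral)
    show "integrable lborel (\<lambda>x. (norm (\<Sum>k\<in>I. a k *\<^sub>R zero_ext \<Omega> (\<phi> k) x))\<^sup>2)"
      unfolding eq using i by auto
  qed simp
  also have "(\<integral>x. (norm (\<Sum>k\<in>I. a k *\<^sub>R zero_ext \<Omega> (\<phi> k) x))\<^sup>2 \<partial>lborel)
     = (\<Sum>j\<in>I. \<Sum>k\<in>I. a j * a k * (if j = k then 1 else 0))"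
    unfolding eq using i o by (simp add: integral_zero_ext_mult)
  also have "\<dots> = (\<Sum>k\<in>I. (a k)\<^sup>2)"
    using assms(3) by (simp add: if_distrib sum.delta power2_eq_square cong: if_cong)
  finally show ?thesis .
qed

text \<open>By the eigenvalue equation the pairs \<open>(\<phi> k, G k)\<close> are orthogonal for the energy form, with squares
\<open>lam k\<close>. Ellipticity and \<open>c \<ge> 0\<close> bound \<open>a \<integral> \<bar>G\<bar>\<^sup>2\<close> by the energy.\<close>

lemma gradient_sum_norm:
  assumes \<Omega>: "open \<Omega>" "bounded \<Omega>" and adm: "admissible_coeffs \<Omega> A c"
    and \<phi>: "orthonormal_basis_L2 \<Omega> \<phi>"
    and H: "\<And>k. H01_grad \<Omega> (\<phi> k) (G k)"
    and eig: "\<And>k v H. H01_grad \<Omega> v H \<Longrightarrow>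
      (LINT x:\<Omega>|lborel. (A x *v G k x) \<bullet> H x + c x * \<phi> k x * v x) = lam k * (LINT x:\<Omega>|lborel. \<phi> k x * v x)"
  shows "\<exists>a>0. \<forall>I e. finite I \<longrightarrow> (\<integral>\<^sup>+ x. ennreal ((norm (\<Sum>k\<in>I. e k *\<^sub>R zero_ext \<Omega> (G k) x))\<^sup>2) \<partial>lborel)
    \<le> ennreal (\<Sum>k\<in>I. lam k / a * (e k)\<^sup>2)"
proof -
  have S: "\<Omega> \<in> sets borel" using \<Omega> by simp
  have L: "L2 \<Omega> (\<phi> k)" "L2 \<Omega> (G k)" for k using H[of k] unfolding H01_grad_def by auto
  obtain a where a: "0 < a" "\<And>u G. AE x in lborel. a * (norm (zero_ext \<Omega> G x))\<^sup>2 \<le> energy_density \<Omega> A c u G u G x"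
    using energy_density_coercive[OF \<Omega> adm] by blast
  have i: "integrable lborel (energy_density \<Omega> A c (\<phi> j) (G j) (\<phi> k) (G k))" for j k
    by (rule integrable_energy_density[OF \<Omega> adm L L])
  have e: "(\<integral>x. energy_density \<Omega> A c (\<phi> j) (G j) (\<phi> k) (G k) x \<partial>lborel) = lam j * (if j = k then 1 else 0)" for j k
    using eig[OF H, of j k] \<phi> unfolding energy_integral orthonormal_basis_L2_def by simp
  have "(\<integral>\<^sup>+ x. ennreal ((norm (\<Sum>k\<in>I. e k *\<^sub>R zero_ext \<Omega> (G k) x))\<^sup>2) \<partial>lborel)
    \<le> ennreal (\<Sum>k\<in>I. lam k / a * (e k)\<^sup>2)" if I: "finite I" for I e
  proof -
    let ?u = "\<lambda>x. \<Sum>k\<in>I. e k *\<^sub>R \<phi> k x" and ?G = "\<lambda>x. \<Sum>k\<in>I. e k *\<^sub>R G k x"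
    let ?Q = "energy_density \<Omega> A c ?u ?G ?u ?G"
    have zG: "zero_ext \<Omega> ?G x = (\<Sum>k\<in>I. e k *\<^sub>R zero_ext \<Omega> (G k) x)" for x
      by (cases "x \<in> \<Omega>") auto
    have iQ: "integrable lborel ?Q"
      by (intro integrable_energy_density[OF \<Omega> adm] L2_sum_scaleR L S I)
    have bnd: "AE x in lborel. (norm (zero_ext \<Omega> ?G x))\<^sup>2 \<le> ?Q x / a"
      using a(2)[of ?G ?u] by eventually_elim (use a(1) in \<open>simp add: field_simps\<close>)
    have pos: "AE x in lborel. 0 \<le> ?Q x / a"
      using bnd by eventually_elim (meson order_trans zero_le_power2)
    have "(\<integral>\<^sup>+ x. ennreal ((norm (zero_ext \<Omega> ?G x))\<^sup>2) \<partial>lborel) \<le> (\<integral>\<^sup>+ x. ennreal (?Q x / a) \<partial>lborel)"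
      using bnd by (intro nn_integral_mono_AE) (auto elim!: eventually_mono intro: ennreal_leI)
    also have "\<dots> = ennreal (\<integral>x. ?Q x / a \<partial>lborel)"
      using iQ pos by (intro nn_integral_eq_integral) auto
    also have "(\<integral>x. ?Q x / a \<partial>lborel) = (\<Sum>j\<in>I. \<Sum>k\<in>I. e j * e k * (lam j * (if j = k then 1 else 0))) / a"
      unfolding energy_density_sum using i e by simp
    also have "\<dots> = (\<Sum>k\<in>I. lam k / a * (e k)\<^sup>2)"
      using I by (simp add: if_distrib sum.delta power2_eq_square sum_divide_distrib mult_ac cong: if_cong)
    finally show ?thesis unfolding zG .
  qed
  thus ?thesis using a(1) by blast
qed

section \<open>The time-dependent coefficients\<close>

text \<open>The coefficient of \<open>f(\<cdot>, r)\<close>, computed from the zero extension of \<open>f\<close>: unlike \<open>coef\<close> it is measurable in \<open>r\<close>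
on all of \<open>\<real>\<close>, as \<open>f\<close> may be arbitrary outside \<open>(0, T)\<close>.\<close>

definition time_coef :: "(real^'n) set \<Rightarrow> (nat \<Rightarrow> real^'n \<Rightarrow> real) \<Rightarrow> real \<Rightarrow> ((real^'n) \<times> real \<Rightarrow> real) \<Rightarrow> nat \<Rightarrow> real \<Rightarrow> real" where
  "time_coef \<Omega> \<phi> T f k r = (\<integral>x. zero_ext (\<Omega> \<times> {0<..<T}) f (x, r) * zero_ext \<Omega> (\<phi> k) x \<partial>lborel)"

lemma time_coef_eq: "r \<in> {0<..<T} \<Longrightarrow> coef \<Omega> \<phi> (\<lambda>x. f (x, r)) k = time_coef \<Omega> \<phi> T f k r"
  unfolding coef_def time_coef_def set_lebesgue_integral_def
  by (intro Bochner_Integration.integral_cong) (auto simp: zero_ext_def indicator_def)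

lemma time_coef_zero: "r \<notin> {0<..<T} \<Longrightarrow> time_coef \<Omega> \<phi> T f k r = 0"
  by (simp add: time_coef_def)

lemma borel_measurable_time_coef:
  fixes \<Omega> :: "(real^'n) set"
  assumes "open \<Omega>" "L2 (\<Omega> \<times> {0<..<T}) f" "L2 \<Omega> (\<phi> k)"
  shows "time_coef \<Omega> \<phi> T f k \<in> borel_measurable borel"
proof -
  have S: "\<Omega> \<in> sets borel" "\<Omega> \<times> {0<..<T} \<in> sets borel"
    using assms(1) by (simp, intro borel_open open_Times) auto
  have [measurable]: "zero_ext \<Omega> (\<phi> k) \<in> borel_measurable borel"
    using L2_zero_ext(1)[OF assms(3) S(1)] .
  have "zero_ext (\<Omega> \<times> {0<..<T}) f \<in> borel_measurable borel"
    using L2_zero_ext(1)[OF assms(2) S(2)] .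
  hence [measurable]: "zero_ext (\<Omega> \<times> {0<..<T}) f \<in> borel_measurable (borel \<Otimes>\<^sub>M borel)" by (simp add: borel_prod)
  show ?thesis unfolding time_coef_def by measurable
qed

lemma mode_eq:
  assumes "t \<in> {0<..<T}"
  shows "mode \<Omega> lam \<phi> s f g h k t =
     coef \<Omega> \<phi> g k * cos (lam k powr (s/2) * t)
     + coef \<Omega> \<phi> h k / lam k powr (s/2) * sin (lam k powr (s/2) * t)
     + 1 / lam k powr (s/2) *
       (\<integral>r. indicator {0..t} r * (time_coef \<Omega> \<phi> T f k r * sin (lam k powr (s/2) * (t - r))) \<partial>lborel)"
proof -
  have "(LINT r:{0..t}|lborel. coef \<Omega> \<phi> (\<lambda>x. f (x, r)) k * sin (lam k powr (s/2) * (t - r)))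
    = (\<integral>r. indicator {0..t} r * (time_coef \<Omega> \<phi> T f k r * sin (lam k powr (s/2) * (t - r))) \<partial>lborel)"
    unfolding set_lebesgue_integral_def
  proof (rule integral_discrete_difference[where X = "{0}"])
    fix r :: real assume "r \<notin> {0}"
    thus "indicator {0..t} r *\<^sub>R (coef \<Omega> \<phi> (\<lambda>x. f (x, r)) k * sin (lam k powr (s/2) * (t - r)))
      = indicator {0..t} r * (time_coef \<Omega> \<phi> T f k r * sin (lam k powr (s/2) * (t - r)))"
      using assms time_coef_eq[of r T \<Omega> \<phi> f k] by (cases "r \<in> {0..t}") auto
  qed auto
  thus ?thesis by (simp add: mode_def)
qed

lemma borel_measurable_mode:
  assumes "open \<Omega>" "L2 (\<Omega> \<times> {0<..<T}) f" "L2 \<Omega> (\<phi> k)"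
  shows "(\<lambda>t. indicator {0<..<T} t * mode \<Omega> lam \<phi> s f g h k t) \<in> borel_measurable borel"
proof -
  note [measurable] = borel_measurable_time_coef[where \<phi> = \<phi> and k = k, OF assms]
  let ?I = "\<lambda>t. \<integral>r. indicator {0..t} r * (time_coef \<Omega> \<phi> T f k r * sin (lam k powr (s/2) * (t - r))) \<partial>lborel"
  have "?I = (\<lambda>t. \<integral>r. (if 0 \<le> r \<and> r \<le> t then time_coef \<Omega> \<phi> T f k r * sin (lam k powr (s/2) * (t - r)) else 0) \<partial>lborel)"
    by (intro ext Bochner_Integration.integral_cong) (auto simp: indicator_def)
  also have "\<dots> \<in> borel_measurable borel" by measurable
  finally have [measurable]: "?I \<in> borel_measurable borel" .
  have "(\<lambda>t. indicator {0<..<T} t * mode \<Omega> lam \<phi> s f g h k t) =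
    (\<lambda>t. indicator {0<..<T} t * (coef \<Omega> \<phi> g k * cos (lam k powr (s/2) * t)
     + coef \<Omega> \<phi> h k / lam k powr (s/2) * sin (lam k powr (s/2) * t) + 1 / lam k powr (s/2) * ?I t))"
  proof
    fix t
    show "indicator {0<..<T} t * mode \<Omega> lam \<phi> s f g h k t = indicator {0<..<T} t * (coef \<Omega> \<phi> g k * cos (lam k powr (s/2) * t)
     + coef \<Omega> \<phi> h k / lam k powr (s/2) * sin (lam k powr (s/2) * t) + 1 / lam k powr (s/2) * ?I t)"
    proof (cases "t \<in> {0<..<T}")
      case True
      thus ?thesis by (simp only: mode_eq[OF True])
    qed simp
  qed
  also have "\<dots> \<in> borel_measurable borel" by measurable
  finally show ?thesis .
qed

text \<open>The Cauchy-Schwarz inequality on \<open>(0, T)\<close>. If the integrand is not integrable, the integral is 0.\<close>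

lemma duhamel_bound:
  fixes c w :: "real \<Rightarrow> real"
  assumes [measurable]: "c \<in> borel_measurable borel" "w \<in> borel_measurable borel"
    and c0: "\<And>r. r \<notin> {0<..<T} \<Longrightarrow> c r = 0" and w: "\<And>r. \<bar>w r\<bar> \<le> 1" and "0 < T"
  shows "ennreal ((\<integral>r. indicator {0..t} r * (c r * w r) \<partial>lborel)\<^sup>2)
    \<le> ennreal T * (\<integral>\<^sup>+ r. ennreal ((c r)\<^sup>2) \<partial>lborel)"
proof (cases "integrable lborel (\<lambda>r. indicator {0..t} r * (c r * w r))")
  case True
  have "ennreal (norm (\<integral>r. indicator {0..t} r * (c r * w r) \<partial>lborel))
     \<le> (\<integral>\<^sup>+ r. norm (indicator {0..t} r * (c r * w r)) \<partial>lborel)"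
    by (rule integral_norm_bound_ennreal[OF True])
  also have "\<dots> \<le> (\<integral>\<^sup>+ r. indicator {0<..<T} r * ennreal \<bar>c r\<bar> \<partial>lborel)"
  proof (rule nn_integral_mono)
    fix r
    have "\<bar>c r\<bar> * \<bar>w r\<bar> \<le> \<bar>c r\<bar> * 1" using w by (intro mult_left_mono) auto
    thus "ennreal (norm (indicator {0..t} r * (c r * w r))) \<le> indicator {0<..<T} r * ennreal \<bar>c r\<bar>"
      using c0[of r] by (cases "r \<in> {0<..<T}") (auto simp: indicator_def abs_mult ennreal_leI)
  qed
  finally have "(ennreal (norm (\<integral>r. indicator {0..t} r * (c r * w r) \<partial>lborel)))\<^sup>2
     \<le> (\<integral>\<^sup>+ r. indicator {0<..<T} r * ennreal \<bar>c r\<bar> \<partial>lborel)\<^sup>2"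
    by (intro power_mono) auto
  also have "\<dots> \<le> (\<integral>\<^sup>+ r. (indicator {0<..<T} r)\<^sup>2 \<partial>lborel) * (\<integral>\<^sup>+ r. (ennreal \<bar>c r\<bar>)\<^sup>2 \<partial>lborel)"
    by (rule Cauchy_Schwarz_nn_integral) auto
  also have "(\<integral>\<^sup>+ r. (indicator {0<..<T} r :: ennreal)\<^sup>2 \<partial>lborel) = (\<integral>\<^sup>+ r. indicator {0<..<T} r \<partial>lborel)"
    by (intro nn_integral_cong) (auto simp: indicator_def)
  also have "\<dots> = ennreal T" using \<open>0 < T\<close> by simp
  finally show ?thesis by (simp add: ennreal_power)
next
  case False
  thus ?thesis by (simp add: not_integrable_integral_eq)
qed

text \<open>Squaring the factor \<open>1 / lam\<^sub>k\<^sup>s\<^sup>/\<^sup>2\<close> in front of \<open>h\<^sub>k\<close> and of the integral of \<open>f\<^sub>k\<close> lowers the exponent of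
\<open>lam k\<close> by \<open>s\<close> there; hence \<open>g\<close> is measured in a stronger norm than \<open>h\<close> and \<open>f\<close>.\<close>

lemma mode_L2_bound:
  assumes "open \<Omega>" "L2 (\<Omega> \<times> {0<..<T}) f" "L2 \<Omega> (\<phi> k)" and T: "0 < T" and lam: "0 < lam k"
  shows "ennreal (lam k powr (r + s)) * (\<integral>\<^sup>+ t\<in>{0<..<T}. ennreal ((mode \<Omega> lam \<phi> s f g h k t)\<^sup>2) \<partial>lborel)
    \<le> ennreal (3 * T * (1 + T)) * (ennreal (lam k powr (r + s) * (coef \<Omega> \<phi> g k)\<^sup>2)
      + ennreal (lam k powr r * (coef \<Omega> \<phi> h k)\<^sup>2)
      + (\<integral>\<^sup>+ t. ennreal (lam k powr r * (time_coef \<Omega> \<phi> T f k t)\<^sup>2) \<partial>lborel))"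
proof -
  note m[measurable] = borel_measurable_time_coef[where \<phi> = \<phi> and k = k, OF assms(1-3)]
  let ?\<mu> = "lam k powr (s/2)" and ?l = "lam k powr (r + s)"
  let ?g = "coef \<Omega> \<phi> g k" and ?h = "coef \<Omega> \<phi> h k"
  let ?I = "\<lambda>t. \<integral>r. indicator {0..t} r * (time_coef \<Omega> \<phi> T f k r * sin (?\<mu> * (t - r))) \<partial>lborel"
  define N where "N = (\<integral>\<^sup>+ t. ennreal ((time_coef \<Omega> \<phi> T f k t)\<^sup>2) \<partial>lborel)"
  have \<mu>: "0 < ?\<mu>" "?\<mu>\<^sup>2 = lam k powr s" using lam by (auto simp: power2_eq_square powr_add[symmetric])
  have l: "?l = lam k powr r * ?\<mu>\<^sup>2" unfolding \<mu>(2) by (simp add: powr_add)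
  have pt: "ennreal ?l * ennreal ((mode \<Omega> lam \<phi> s f g h k t)\<^sup>2)
     \<le> 3 * (ennreal (?l * ?g\<^sup>2) + ennreal (lam k powr r * ?h\<^sup>2) + ennreal (lam k powr r) * (ennreal T * N))"
    if t: "t \<in> {0<..<T}" for t
  proof -
    have three: "(a + b + c)\<^sup>2 \<le> 3 * (a\<^sup>2 + b\<^sup>2 + c\<^sup>2)" for a b c :: real
      using sum_squares_bound[of a b] sum_squares_bound[of a c] sum_squares_bound[of b c]
      by (simp add: power2_sum algebra_simps)
    have sq: "(a * x)\<^sup>2 \<le> a\<^sup>2" if "\<bar>x\<bar> \<le> 1" for a x :: real
      using mult_left_mono[of "x\<^sup>2" 1 "a\<^sup>2"] that by (simp add: power_mult_distrib abs_square_le_1)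
    have "(mode \<Omega> lam \<phi> s f g h k t)\<^sup>2 \<le> 3 * ((?g * cos (?\<mu> * t))\<^sup>2 + (?h / ?\<mu> * sin (?\<mu> * t))\<^sup>2 + (1 / ?\<mu> * ?I t)\<^sup>2)"
      unfolding mode_eq[OF t] by (rule three)
    also have "\<dots> \<le> 3 * (?g\<^sup>2 + (?h / ?\<mu>)\<^sup>2 + (1 / ?\<mu> * ?I t)\<^sup>2)"
      by (intro mult_left_mono add_mono sq) auto
    finally have "?l * (mode \<Omega> lam \<phi> s f g h k t)\<^sup>2 \<le> ?l * (3 * (?g\<^sup>2 + (?h / ?\<mu>)\<^sup>2 + (1 / ?\<mu> * ?I t)\<^sup>2))"
      by (intro mult_left_mono) auto
    also have "\<dots> = 3 * (?l * ?g\<^sup>2 + lam k powr r * ?h\<^sup>2 + lam k powr r * (?I t)\<^sup>2)"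
    proof -
      have "?l * (?h / ?\<mu>)\<^sup>2 = lam k powr r * ?h\<^sup>2" "?l * (1 / ?\<mu> * ?I t)\<^sup>2 = lam k powr r * (?I t)\<^sup>2"
        unfolding l power_divide power_mult_distrib using \<mu>(1) by auto
      thus ?thesis by (simp only: distrib_left mult.left_commute[of _ 3])
    qed
    finally have "ennreal (?l * (mode \<Omega> lam \<phi> s f g h k t)\<^sup>2)
       \<le> ennreal (3 * (?l * ?g\<^sup>2 + lam k powr r * ?h\<^sup>2 + lam k powr r * (?I t)\<^sup>2))" by (rule ennreal_leI)
    also have "\<dots> = 3 * (ennreal (?l * ?g\<^sup>2) + ennreal (lam k powr r * ?h\<^sup>2) + ennreal (lam k powr r) * ennreal ((?I t)\<^sup>2))"
      by (simp add: ennreal_mult' ennreal_plus)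
    also have "\<dots> \<le> 3 * (ennreal (?l * ?g\<^sup>2) + ennreal (lam k powr r * ?h\<^sup>2) + ennreal (lam k powr r) * (ennreal T * N))"
      unfolding N_def using T time_coef_zero[of _ T \<Omega> \<phi> f k]
      by (intro mult_left_mono add_left_mono duhamel_bound) auto
    finally show ?thesis by (simp add: ennreal_mult')
  qed
  have um: "(\<lambda>t. ennreal ((mode \<Omega> lam \<phi> s f g h k t)\<^sup>2) * indicator {0<..<T} t) \<in> borel_measurable borel"
  proof -
    have "(\<lambda>t. ennreal ((mode \<Omega> lam \<phi> s f g h k t)\<^sup>2) * indicator {0<..<T} t)
       = (\<lambda>t. ennreal ((indicator {0<..<T} t * mode \<Omega> lam \<phi> s f g h k t)\<^sup>2))"
      by (auto simp: fun_eq_iff indicator_def)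
    thus ?thesis using borel_measurable_mode[where \<phi> = \<phi> and k = k and s = s and g = g and h = h and lam = lam, OF assms(1-3)] by simp
  qed
  let ?B = "ennreal (?l * ?g\<^sup>2) + ennreal (lam k powr r * ?h\<^sup>2) + ennreal (lam k powr r) * (ennreal T * N)"
  have const: "ennreal (3 * T * (1 + T)) = 3 * ennreal (1 + T) * ennreal T"
    using T ennreal_mult[of "3 * T" "1 + T"] ennreal_mult[of 3 T] by (simp add: mult_ac del: ennreal_plus)
  have "ennreal ?l * (\<integral>\<^sup>+ t\<in>{0<..<T}. ennreal ((mode \<Omega> lam \<phi> s f g h k t)\<^sup>2) \<partial>lborel)
    = (\<integral>\<^sup>+ t. ennreal ?l * (ennreal ((mode \<Omega> lam \<phi> s f g h k t)\<^sup>2) * indicator {0<..<T} t) \<partial>lborel)"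
    using um by (intro nn_integral_cmult[symmetric]) simp
  also have "\<dots> \<le> (\<integral>\<^sup>+ t. 3 * ?B * indicator {0<..<T} t \<partial>lborel)"
    using pt by (intro nn_integral_mono) (auto simp: indicator_def mult.assoc)
  also have "\<dots> = 3 * ?B * ennreal T" using T by (simp add: nn_integral_cmult_indicator)
  also have "\<dots> \<le> 3 * (ennreal (1 + T) * (ennreal (?l * ?g\<^sup>2) + ennreal (lam k powr r * ?h\<^sup>2) + ennreal (lam k powr r) * N)) * ennreal T"
  proof (intro mult_right_mono mult_left_mono)
    have one: "X \<le> ennreal (1 + T) * X" for X
    proof -
      have "ennreal 1 * X \<le> ennreal (1 + T) * X" using T by (intro mult_right_mono ennreal_leI) auto
      thus ?thesis by (simp only: ennreal_1 mult_1)
    qed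
    have "ennreal (lam k powr r) * (ennreal T * N) = ennreal T * (ennreal (lam k powr r) * N)" by (simp add: mult_ac)
    also have "\<dots> \<le> ennreal (1 + T) * (ennreal (lam k powr r) * N)" by (intro mult_right_mono ennreal_leI) auto
    finally show "?B \<le> ennreal (1 + T) * (ennreal (?l * ?g\<^sup>2) + ennreal (lam k powr r * ?h\<^sup>2) + ennreal (lam k powr r) * N)"
      unfolding distrib_left by (intro add_mono one)
  qed auto
  also have "\<dots> = ennreal (3 * T * (1 + T)) * (ennreal (?l * ?g\<^sup>2) + ennreal (lam k powr r * ?h\<^sup>2) + ennreal (lam k powr r) * N)"
    unfolding const by (simp only: mult_ac)
  also have "ennreal (lam k powr r) * N = (\<integral>\<^sup>+ t. ennreal (lam k powr r * (time_coef \<Omega> \<phi> T f k t)\<^sup>2) \<partial>lborel)"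
    unfolding N_def by (subst nn_integral_cmult[symmetric]) (auto simp: ennreal_mult')
  finally show ?thesis .
qed

lemma mode_L2_sum:
  assumes "open \<Omega>" "L2 (\<Omega> \<times> {0<..<T}) f" "\<And>k. L2 \<Omega> (\<phi> k)" and T: "0 < T" and lam: "\<And>k. 0 < lam k"
  shows "(\<Sum>k. ennreal (lam k powr (r + s)) * (\<integral>\<^sup>+ t\<in>{0<..<T}. ennreal ((mode \<Omega> lam \<phi> s f g h k t)\<^sup>2) \<partial>lborel))
    \<le> ennreal (3 * T * (1 + T)) * (Hnorm2 \<Omega> lam \<phi> (r + s) g + Hnorm2 \<Omega> lam \<phi> r h + L2Hnorm2 \<Omega> lam \<phi> T r f)"
proof -
  note [measurable] = borel_measurable_time_coef[where \<phi> = \<phi>, OF assms(1-3)]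
  have f: "L2Hnorm2 \<Omega> lam \<phi> T r f = (\<Sum>k. \<integral>\<^sup>+ t. ennreal (lam k powr r * (time_coef \<Omega> \<phi> T f k t)\<^sup>2) \<partial>lborel)"
  proof -
    have "L2Hnorm2 \<Omega> lam \<phi> T r f = (\<integral>\<^sup>+ t. (\<Sum>k. ennreal (lam k powr r * (time_coef \<Omega> \<phi> T f k t)\<^sup>2)) \<partial>lborel)"
      unfolding L2Hnorm2_def Hnorm2_def
    proof (rule nn_integral_cong)
      fix t
      show "(\<Sum>k. ennreal (lam k powr r * (coef \<Omega> \<phi> (\<lambda>x. f (x, t)) k)\<^sup>2)) * indicator {0<..<T} t
         = (\<Sum>k. ennreal (lam k powr r * (time_coef \<Omega> \<phi> T f k t)\<^sup>2))"
        by (cases "t \<in> {0<..<T}") (simp_all add: time_coef_eq[of t T \<Omega> \<phi> f] time_coef_zero)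
    qed
    also have "\<dots> = (\<Sum>k. \<integral>\<^sup>+ t. ennreal (lam k powr r * (time_coef \<Omega> \<phi> T f k t)\<^sup>2) \<partial>lborel)"
      by (intro nn_integral_suminf) simp
    finally show ?thesis .
  qed
  have "(\<Sum>k. ennreal (lam k powr (r + s)) * (\<integral>\<^sup>+ t\<in>{0<..<T}. ennreal ((mode \<Omega> lam \<phi> s f g h k t)\<^sup>2) \<partial>lborel))
    \<le> (\<Sum>k. ennreal (3 * T * (1 + T)) * (ennreal (lam k powr (r + s) * (coef \<Omega> \<phi> g k)\<^sup>2)
      + ennreal (lam k powr r * (coef \<Omega> \<phi> h k)\<^sup>2)
      + (\<integral>\<^sup>+ t. ennreal (lam k powr r * (time_coef \<Omega> \<phi> T f k t)\<^sup>2) \<partial>lborel)))"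
    by (intro suminf_le allI mode_L2_bound assms) auto
  also have "\<dots> = ennreal (3 * T * (1 + T)) * (Hnorm2 \<Omega> lam \<phi> (r + s) g + Hnorm2 \<Omega> lam \<phi> r h + L2Hnorm2 \<Omega> lam \<phi> T r f)"
    unfolding f Hnorm2_def by (simp add: suminf_add[symmetric])
  finally show ?thesis .
qed

section \<open>Convergence of the separated series\<close>

text \<open>Finite sums of products of functions of \<open>t\<close>, \<open>y\<close> and \<open>x\<close>: partial sums of the solution, of its
gradient in \<open>x\<close> and of its image under the operator arise from different choices of \<open>\<Phi>\<close>, and derivatives in \<open>y\<close>
from different choices of \<open>e\<close>.\<close>

definition tensor_sum ::
  "(nat \<Rightarrow> real \<Rightarrow> real) \<Rightarrow> (nat \<Rightarrow> real \<Rightarrow> real) \<Rightarrow> (nat \<Rightarrow> real^'n \<Rightarrow> 'b::real_vector) \<Rightarrow> nat set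
    \<Rightarrow> 'n::finite spacetime \<Rightarrow> 'b" where
  "tensor_sum u e \<Phi> I = (\<lambda>(x, y, t). \<Sum>k\<in>I. (u k t * e k y) *\<^sub>R \<Phi> k x)"

lemma borel_measurable_tensor_sum:
  fixes \<Phi> :: "nat \<Rightarrow> real^'n::finite \<Rightarrow> 'b::euclidean_space"
  assumes "\<And>k. u k \<in> borel_measurable borel" "\<And>k. e k \<in> borel_measurable borel" "\<And>k. \<Phi> k \<in> borel_measurable borel"
  shows "tensor_sum u e \<Phi> I \<in> borel_measurable borel"
proof -
  have m: "(\<lambda>p :: 'n spacetime. fst (snd p)) \<in> borel_measurable borel"
      "(\<lambda>p :: 'n spacetime. snd (snd p)) \<in> borel_measurable borel"
      "(\<lambda>p :: 'n spacetime. fst p) \<in> borel_measurable borel"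
    by (intro borel_measurable_continuous_onI continuous_intros)+
  have "(\<lambda>p :: 'n spacetime. u k (snd (snd p))) \<in> borel_measurable borel"
     "(\<lambda>p :: 'n spacetime. e k (fst (snd p))) \<in> borel_measurable borel"
     "(\<lambda>p :: 'n spacetime. \<Phi> k (fst p)) \<in> borel_measurable borel" for k
    by (rule measurable_compose[OF m(2) assms(1)], rule measurable_compose[OF m(1) assms(2)],
        rule measurable_compose[OF m(3) assms(3)])
  thus ?thesis unfolding tensor_sum_def case_prod_beta
    by (intro borel_measurable_sum borel_measurable_scaleR borel_measurable_times) auto
qed

text \<open>Bessel's inequality for the system \<open>\<Phi>\<close> with the weights \<open>\<mu>\<close> in place of the squared norms.\<close>

definition bessel_bound :: "(nat \<Rightarrow> real) \<Rightarrow> (nat \<Rightarrow> 'a::euclidean_space \<Rightarrow> 'b::euclidean_space) \<Rightarrow> bool" where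
  "bessel_bound \<mu> \<Phi> \<longleftrightarrow> (\<forall>I c. finite I \<longrightarrow>
     (\<integral>\<^sup>+ x. ennreal ((norm (\<Sum>k\<in>I. c k *\<^sub>R \<Phi> k x))\<^sup>2) \<partial>lborel) \<le> ennreal (\<Sum>k\<in>I. \<mu> k * (c k)\<^sup>2))"

text \<open>For fixed \<open>y\<close> and \<open>t\<close> Bessel's inequality in \<open>x\<close> decouples the terms; afterwards the integrals in \<open>y\<close> and \<open>t\<close>
factor.\<close>

lemma tensor_sum_weighted_bound:
  fixes \<Phi> :: "nat \<Rightarrow> real^'n::finite \<Rightarrow> 'b::euclidean_space"
  assumes \<Omega>: "open \<Omega>" and u: "\<And>k. u k \<in> borel_measurable borel" and e: "\<And>k. e k \<in> borel_measurable borel"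
    and \<Phi>: "\<And>k. \<Phi> k \<in> borel_measurable borel"
    and bessel: "bessel_bound \<mu> \<Phi>"
    and \<mu>: "\<And>k. 0 \<le> \<mu> k" and I: "finite I"
  shows "(\<integral>\<^sup>+ p. ennreal ((norm (tensor_sum u e \<Phi> I p))\<^sup>2) \<partial>wmeas \<Omega> T \<beta> \<theta>)
    \<le> (\<Sum>k\<in>I. ennreal (\<mu> k) * (\<integral>\<^sup>+ y\<in>{0<..}. ennreal (weight \<beta> \<theta> y * (e k y)\<^sup>2) \<partial>lborel)
        * (\<integral>\<^sup>+ t\<in>{0<..<T}. ennreal ((u k t)\<^sup>2) \<partial>lborel))"
proof -
  note [measurable] = u e \<Phi> borel_measurable_tensor_sum[OF u e \<Phi>]
  have x: "(\<integral>\<^sup>+ x\<in>\<Omega>. ennreal (weight \<beta> \<theta> y) * ennreal ((norm (tensor_sum u e \<Phi> I (x, y, t)))\<^sup>2) \<partial>lborel)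
     \<le> (\<Sum>k\<in>I. ennreal (\<mu> k) * ennreal ((u k t)\<^sup>2) * ennreal (weight \<beta> \<theta> y * (e k y)\<^sup>2))" for y t
  proof -
    have "(\<integral>\<^sup>+ x\<in>\<Omega>. ennreal (weight \<beta> \<theta> y) * ennreal ((norm (tensor_sum u e \<Phi> I (x, y, t)))\<^sup>2) \<partial>lborel)
      \<le> (\<integral>\<^sup>+ x. ennreal (weight \<beta> \<theta> y) * ennreal ((norm (\<Sum>k\<in>I. (u k t * e k y) *\<^sub>R \<Phi> k x))\<^sup>2) \<partial>lborel)"
      by (intro nn_integral_mono) (auto simp: tensor_sum_def indicator_def)
    also have "\<dots> = ennreal (weight \<beta> \<theta> y) * (\<integral>\<^sup>+ x. ennreal ((norm (\<Sum>k\<in>I. (u k t * e k y) *\<^sub>R \<Phi> k x))\<^sup>2) \<partial>lborel)"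
      by (intro nn_integral_cmult) measurable
    also have "\<dots> \<le> ennreal (weight \<beta> \<theta> y) * ennreal (\<Sum>k\<in>I. \<mu> k * (u k t * e k y)\<^sup>2)"
      using bessel I unfolding bessel_bound_def by (intro mult_left_mono) auto
    also have "\<dots> = ennreal (weight \<beta> \<theta> y * (\<Sum>k\<in>I. \<mu> k * (u k t * e k y)\<^sup>2))"
      using \<mu> by (intro ennreal_mult[symmetric] weight_nonneg sum_nonneg mult_nonneg_nonneg) auto
    also have "weight \<beta> \<theta> y * (\<Sum>k\<in>I. \<mu> k * (u k t * e k y)\<^sup>2)
        = (\<Sum>k\<in>I. \<mu> k * (u k t)\<^sup>2 * (weight \<beta> \<theta> y * (e k y)\<^sup>2))"
      by (simp add: sum_distrib_left power_mult_distrib mult_ac)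
    also have "ennreal \<dots> = (\<Sum>k\<in>I. ennreal (\<mu> k * (u k t)\<^sup>2 * (weight \<beta> \<theta> y * (e k y)\<^sup>2)))"
      using \<mu> weight_nonneg by (intro sum_ennreal[symmetric] mult_nonneg_nonneg) auto
    also have "\<dots> = (\<Sum>k\<in>I. ennreal (\<mu> k) * ennreal ((u k t)\<^sup>2) * ennreal (weight \<beta> \<theta> y * (e k y)\<^sup>2))"
      using \<mu> weight_nonneg by (intro sum.cong refl) (simp add: ennreal_mult)
    finally show ?thesis .
  qed
  have y: "(\<integral>\<^sup>+ y\<in>{0<..}. (\<integral>\<^sup>+ x\<in>\<Omega>. ennreal (weight \<beta> \<theta> y) * ennreal ((norm (tensor_sum u e \<Phi> I (x, y, t)))\<^sup>2) \<partial>lborel) \<partial>lborel)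
     \<le> (\<Sum>k\<in>I. ennreal (\<mu> k) * ennreal ((u k t)\<^sup>2) * (\<integral>\<^sup>+ y\<in>{0<..}. ennreal (weight \<beta> \<theta> y * (e k y)\<^sup>2) \<partial>lborel))" for t
  proof -
    have "(\<integral>\<^sup>+ y\<in>{0<..}. (\<integral>\<^sup>+ x\<in>\<Omega>. ennreal (weight \<beta> \<theta> y) * ennreal ((norm (tensor_sum u e \<Phi> I (x, y, t)))\<^sup>2) \<partial>lborel) \<partial>lborel)
      \<le> (\<integral>\<^sup>+ y\<in>{0<..}. (\<Sum>k\<in>I. ennreal (\<mu> k) * ennreal ((u k t)\<^sup>2) * ennreal (weight \<beta> \<theta> y * (e k y)\<^sup>2)) \<partial>lborel)"
      by (intro nn_integral_mono mult_right_mono x) auto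
    also have "\<dots> = (\<integral>\<^sup>+ y. (\<Sum>k\<in>I. ennreal (\<mu> k) * ennreal ((u k t)\<^sup>2) * (ennreal (weight \<beta> \<theta> y * (e k y)\<^sup>2) * indicator {0<..} y)) \<partial>lborel)"
      by (intro nn_integral_cong) (simp only: sum_distrib_right, intro sum.cong refl, simp only: mult_ac)
    also have "\<dots> = (\<Sum>k\<in>I. ennreal (\<mu> k) * ennreal ((u k t)\<^sup>2) * (\<integral>\<^sup>+ y\<in>{0<..}. ennreal (weight \<beta> \<theta> y * (e k y)\<^sup>2) \<partial>lborel))"
      by (subst nn_integral_sum) (auto simp: nn_integral_cmult)
    finally show ?thesis .
  qed
  have "(\<integral>\<^sup>+ p. ennreal ((norm (tensor_sum u e \<Phi> I p))\<^sup>2) \<partial>wmeas \<Omega> T \<beta> \<theta>)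
    \<le> (\<integral>\<^sup>+ t\<in>{0<..<T}. (\<Sum>k\<in>I. ennreal (\<mu> k) * ennreal ((u k t)\<^sup>2) * (\<integral>\<^sup>+ y\<in>{0<..}. ennreal (weight \<beta> \<theta> y * (e k y)\<^sup>2) \<partial>lborel)) \<partial>lborel)"
    by (subst nn_integral_wmeas[OF \<Omega>]) (auto intro!: nn_integral_mono mult_right_mono y)
  also have "\<dots> = (\<integral>\<^sup>+ t. (\<Sum>k\<in>I. ennreal (\<mu> k) * (\<integral>\<^sup>+ y\<in>{0<..}. ennreal (weight \<beta> \<theta> y * (e k y)\<^sup>2) \<partial>lborel)
      * (ennreal ((u k t)\<^sup>2) * indicator {0<..<T} t)) \<partial>lborel)"
    by (intro nn_integral_cong) (simp only: sum_distrib_right, intro sum.cong refl, simp only: mult_ac)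
  also have "\<dots> = (\<Sum>k\<in>I. ennreal (\<mu> k) * (\<integral>\<^sup>+ y\<in>{0<..}. ennreal (weight \<beta> \<theta> y * (e k y)\<^sup>2) \<partial>lborel)
        * (\<integral>\<^sup>+ t\<in>{0<..<T}. ennreal ((u k t)\<^sup>2) \<partial>lborel))"
    by (subst nn_integral_sum) (auto simp: nn_integral_cmult)
  finally show ?thesis .
qed

lemma tensor_series_converges:
  fixes \<Phi> :: "nat \<Rightarrow> real^'n::finite \<Rightarrow> 'b::euclidean_space"
  assumes \<Omega>: "open \<Omega>" and u: "\<And>k. u k \<in> borel_measurable borel" and e: "\<And>k. e k \<in> borel_measurable borel"
    and \<Phi>: "\<And>k. \<Phi> k \<in> borel_measurable borel"
    and bessel: "bessel_bound \<mu> \<Phi>"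
    and \<mu>: "\<And>k. 0 \<le> \<mu> k"
    and b: "\<And>k. ennreal (\<mu> k) * (\<integral>\<^sup>+ y\<in>{0<..}. ennreal (weight \<beta> \<theta> y * (e k y)\<^sup>2) \<partial>lborel)
        * (\<integral>\<^sup>+ t\<in>{0<..<T}. ennreal ((u k t)\<^sup>2) \<partial>lborel) \<le> b k"
    and fin: "(\<Sum>k. b k) < \<infinity>"
  shows "\<exists>V\<in>borel_measurable borel.
      (\<integral>\<^sup>+ p. ennreal ((norm (V p))\<^sup>2) \<partial>wmeas \<Omega> T \<beta> \<theta>) \<le> (\<Sum>k. b k) \<and>
      (\<lambda>N. \<integral>\<^sup>+ p. ennreal ((norm (tensor_sum u e \<Phi> {..<N} p - V p))\<^sup>2) \<partial>wmeas \<Omega> T \<beta> \<theta>) \<longlonglongrightarrow> 0"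
    and "(\<integral>\<^sup>+ p. ennreal ((norm (tensor_sum u e \<Phi> {..<N} p))\<^sup>2) \<partial>wmeas \<Omega> T \<beta> \<theta>) < \<infinity>"
proof -
  have bnd: "(\<integral>\<^sup>+ p. ennreal ((norm (tensor_sum u e \<Phi> I p))\<^sup>2) \<partial>wmeas \<Omega> T \<beta> \<theta>) \<le> (\<Sum>k\<in>I. b k)"
    if "finite I" for I
    by (rule order_trans[OF tensor_sum_weighted_bound[OF \<Omega> u e \<Phi> bessel \<mu> that]]) (auto intro!: sum_mono b)
  have incr: "tensor_sum u e \<Phi> {..<m} p - tensor_sum u e \<Phi> {..<n} p = tensor_sum u e \<Phi> {n..<m} p" if "n \<le> m" for n m p
  proof -
    have "{..<m} - {..<n} = {n..<m}" by auto
    thus ?thesis using that unfolding tensor_sum_def case_prod_beta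
      by (subst sum_diff[symmetric]) auto
  qed
  have "\<exists>V\<in>borel_measurable (wmeas \<Omega> T \<beta> \<theta>).
      (\<integral>\<^sup>+ p. ennreal ((norm (V p))\<^sup>2) \<partial>wmeas \<Omega> T \<beta> \<theta>) \<le> (\<Sum>k. b k) \<and>
      (\<lambda>N. \<integral>\<^sup>+ p. ennreal ((norm (tensor_sum u e \<Phi> {..<N} p - V p))\<^sup>2) \<partial>wmeas \<Omega> T \<beta> \<theta>) \<longlonglongrightarrow> 0"
  proof (rule L2_series_complete[OF _ _ _ fin])
    show "tensor_sum u e \<Phi> {..<n} \<in> borel_measurable (wmeas \<Omega> T \<beta> \<theta>)" for n
      using borel_measurable_tensor_sum[OF u e \<Phi>] by simp
    show "tensor_sum u e \<Phi> {..<0} p = 0" for p by (simp add: tensor_sum_def case_prod_beta)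
  qed (use incr bnd in simp)
  thus "\<exists>V\<in>borel_measurable borel.
      (\<integral>\<^sup>+ p. ennreal ((norm (V p))\<^sup>2) \<partial>wmeas \<Omega> T \<beta> \<theta>) \<le> (\<Sum>k. b k) \<and>
      (\<lambda>N. \<integral>\<^sup>+ p. ennreal ((norm (tensor_sum u e \<Phi> {..<N} p - V p))\<^sup>2) \<partial>wmeas \<Omega> T \<beta> \<theta>) \<longlonglongrightarrow> 0"
    by simp
  have "(\<integral>\<^sup>+ p. ennreal ((norm (tensor_sum u e \<Phi> {..<N} p))\<^sup>2) \<partial>wmeas \<Omega> T \<beta> \<theta>) \<le> (\<Sum>k<N. b k)"
    by (rule bnd) simp
  also have "\<dots> \<le> (\<Sum>k. b k)" by (intro sum_le_suminf) auto
  finally show "(\<integral>\<^sup>+ p. ennreal ((norm (tensor_sum u e \<Phi> {..<N} p))\<^sup>2) \<partial>wmeas \<Omega> T \<beta> \<theta>) < \<infinity>"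
    using fin by (rule le_less_trans)
qed

text \<open>The hypothesis gives convergence to \<open>U\<close> only on almost every slice. On a slice, letting \<open>M \<rightarrow> \<infinity>\<close> in
\<open>\<parallel>S\<^sub>N - U\<parallel>\<^sup>2 \<le> 2 \<parallel>S\<^sub>N - S\<^sub>M\<parallel>\<^sup>2 + 2 \<parallel>S\<^sub>M - U\<parallel>\<^sup>2\<close> bounds the distance by twice the tail of \<open>\<Sum>\<^sub>k (u\<^sub>k \<psi>\<^sub>k)\<^sup>2\<close>, and the
integrals of these tails tend to 0.\<close>

lemma solution_series_converges:
  fixes \<Omega> :: "(real^'n::finite) set"
  assumes \<Omega>: "open \<Omega>" and \<phi>: "orthonormal_basis_L2 \<Omega> \<phi>"
    and U: "zero_ext (cyl \<Omega> T) U \<in> borel_measurable borel"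
    and u: "\<And>k. u k \<in> borel_measurable borel" and e: "\<And>k. e k \<in> borel_measurable borel"
    and ue: "\<And>k t. t \<in> {0<..<T} \<Longrightarrow> u k t = mode \<Omega> lam \<phi> s f g h k t" "\<And>k y. 0 < y \<Longrightarrow> e k y = \<psi> k y"
    and ser: "series_solution \<Omega> lam \<phi> \<psi> s T f g h U"
    and fin: "(\<Sum>k. (\<integral>\<^sup>+ y\<in>{0<..}. ennreal (weight \<beta> \<theta> y * (e k y)\<^sup>2) \<partial>lborel)
        * (\<integral>\<^sup>+ t\<in>{0<..<T}. ennreal ((u k t)\<^sup>2) \<partial>lborel)) < \<infinity>"
  shows "(\<lambda>N. \<integral>\<^sup>+ p. ennreal ((norm (tensor_sum u e (\<lambda>k. zero_ext \<Omega> (\<phi> k)) {..<N} p - zero_ext (cyl \<Omega> T) U p))\<^sup>2)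
     \<partial>wmeas \<Omega> T \<beta> \<theta>) \<longlonglongrightarrow> 0"
proof -
  have S: "\<Omega> \<in> sets borel" using \<Omega> by simp
  have L: "L2 \<Omega> (\<phi> k)" for k using \<phi> unfolding orthonormal_basis_L2_def by auto
  let ?S = "\<lambda>N. tensor_sum u e (\<lambda>k. zero_ext \<Omega> (\<phi> k)) {..<N}" and ?U = "zero_ext (cyl \<Omega> T) U"
  note m\<phi>[measurable] = L2_zero_ext(1)[OF L S]
  note [measurable] = u e U borel_measurable_tensor_sum[OF u e m\<phi>]
  define b where "b k = (\<integral>\<^sup>+ y\<in>{0<..}. ennreal (weight \<beta> \<theta> y * (e k y)\<^sup>2) \<partial>lborel)
        * (\<integral>\<^sup>+ t\<in>{0<..<T}. ennreal ((u k t)\<^sup>2) \<partial>lborel)" for k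
  have slice: "(\<integral>\<^sup>+ x\<in>\<Omega>. ennreal ((norm (?S N (x, y, t) - ?U (x, y, t)))\<^sup>2) \<partial>lborel)
      \<le> 2 * (\<Sum>k. ennreal ((u (k + N) t * e (k + N) y)\<^sup>2))"
    if t: "t \<in> {0<..<T}" and y: "0 < y"
      and lim: "L2_tendsto \<Omega> (\<lambda>N x. \<Sum>k<N. mode \<Omega> lam \<phi> s f g h k t * \<phi> k x * \<psi> k y) (\<lambda>x. U (x, y, t))" for N y t
  proof -
    let ?d = "\<lambda>M. \<integral>\<^sup>+ x\<in>\<Omega>. ennreal ((norm (?S M (x, y, t) - ?U (x, y, t)))\<^sup>2) \<partial>lborel"
    let ?tail = "\<Sum>k. ennreal ((u (k + N) t * e (k + N) y)\<^sup>2)"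
    have mU[measurable]: "(\<lambda>x. ?U (x, y, t)) \<in> borel_measurable borel"
      by (rule measurable_compose[OF _ U]) (intro borel_measurable_continuous_onI continuous_intros)
    have mS[measurable]: "(\<lambda>x. ?S M (x, y, t)) \<in> borel_measurable borel" for M
      unfolding tensor_sum_def by simp
    have [measurable]: "\<Omega> \<in> sets borel" by (rule S)
    have d0: "?d \<longlonglongrightarrow> 0"
    proof -
      have "?d M = (\<integral>\<^sup>+ x\<in>\<Omega>. ennreal ((norm ((\<Sum>k<M. mode \<Omega> lam \<phi> s f g h k t * \<phi> k x * \<psi> k y) - U (x, y, t)))\<^sup>2) \<partial>lborel)" for M
      proof (intro nn_integral_cong)
        fix x
        show "ennreal ((norm (?S M (x, y, t) - ?U (x, y, t)))\<^sup>2) * indicator \<Omega> x =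
          ennreal ((norm ((\<Sum>k<M. mode \<Omega> lam \<phi> s f g h k t * \<phi> k x * \<psi> k y) - U (x, y, t)))\<^sup>2) * indicator \<Omega> x"
        proof (cases "x \<in> \<Omega>")
          case True
          have "?S M (x, y, t) = (\<Sum>k<M. mode \<Omega> lam \<phi> s f g h k t * \<phi> k x * \<psi> k y)"
            unfolding tensor_sum_def case_prod_conv using True
            by (intro sum.cong refl) (simp add: ue(1)[OF t] ue(2)[OF y])
          moreover have "(x, y, t) \<in> cyl \<Omega> T" using True t y by (simp add: cyl_def)
          ultimately show ?thesis by simp
        qed simp
      qed
      thus ?thesis using lim unfolding L2_tendsto_def by simp
    qed
    have le: "?d N \<le> 2 * ?tail + 2 * ?d M" if "N \<le> M" for M
    proof -
      have sub: "?S N (x, y, t) - ?S M (x, y, t) = - (\<Sum>k\<in>{N..<M}. (u k t * e k y) *\<^sub>R zero_ext \<Omega> (\<phi> k) x)" for x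
      proof -
        have "{..<M} - {..<N} = {N..<M}" by auto
        hence "?S M (x, y, t) - ?S N (x, y, t) = (\<Sum>k\<in>{N..<M}. (u k t * e k y) *\<^sub>R zero_ext \<Omega> (\<phi> k) x)"
          using that unfolding tensor_sum_def case_prod_conv by (subst sum_diff[symmetric]) auto
        moreover have "?S N (x, y, t) - ?S M (x, y, t) = - (?S M (x, y, t) - ?S N (x, y, t))" by simp
        ultimately show ?thesis by (simp only:)
      qed
      have "?d N \<le> (\<integral>\<^sup>+ x. 2 * ennreal ((norm (\<Sum>k\<in>{N..<M}. (u k t * e k y) *\<^sub>R zero_ext \<Omega> (\<phi> k) x))\<^sup>2)
         + 2 * (ennreal ((norm (?S M (x, y, t) - ?U (x, y, t)))\<^sup>2) * indicator \<Omega> x) \<partial>lborel)"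
      proof (rule nn_integral_mono)
        fix x
        let ?a = "\<Sum>k\<in>{N..<M}. (u k t * e k y) *\<^sub>R zero_ext \<Omega> (\<phi> k) x" and ?b = "?S M (x, y, t) - ?U (x, y, t)"
        have "norm (?S N (x, y, t) - ?U (x, y, t)) = norm (- ?a + ?b)" unfolding sub[symmetric] by simp
        also have "\<dots> \<le> norm ?a + norm ?b" using norm_triangle_ineq[of "- ?a" ?b] by simp
        finally have "(norm (?S N (x, y, t) - ?U (x, y, t)))\<^sup>2 \<le> (norm ?a + norm ?b)\<^sup>2" by (intro power_mono) auto
        also have "\<dots> \<le> 2 * (norm ?a)\<^sup>2 + 2 * (norm ?b)\<^sup>2"
          using sum_squares_bound[of "norm ?a" "norm ?b"] by (simp add: power2_sum)
        finally have "ennreal ((norm (?S N (x, y, t) - ?U (x, y, t)))\<^sup>2) \<le> 2 * ennreal ((norm ?a)\<^sup>2) + 2 * ennreal ((norm ?b)\<^sup>2)"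
          using ennreal_leI by (fastforce simp: ennreal_plus ennreal_mult')
        thus "ennreal ((norm (?S N (x, y, t) - ?U (x, y, t)))\<^sup>2) * indicator \<Omega> x
          \<le> 2 * ennreal ((norm ?a)\<^sup>2) + 2 * (ennreal ((norm ?b)\<^sup>2) * indicator \<Omega> x)"
          by (cases "x \<in> \<Omega>") auto
      qed
      also have "\<dots> = 2 * (\<integral>\<^sup>+ x. ennreal ((norm (\<Sum>k\<in>{N..<M}. (u k t * e k y) *\<^sub>R zero_ext \<Omega> (\<phi> k) x))\<^sup>2) \<partial>lborel) + 2 * ?d M"
        by (subst nn_integral_add) (auto simp: nn_integral_cmult)
      also have "\<dots> \<le> 2 * ?tail + 2 * ?d M"
      proof (intro add_right_mono mult_left_mono)
        have "(\<integral>\<^sup>+ x. ennreal ((norm (\<Sum>k\<in>{N..<M}. (u k t * e k y) *\<^sub>R zero_ext \<Omega> (\<phi> k) x))\<^sup>2) \<partial>lborel)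
           = ennreal (\<Sum>k\<in>{N..<M}. (u k t * e k y)\<^sup>2)"
          by (rule basis_sum_norm[OF \<phi> S]) simp
        also have "\<dots> = (\<Sum>k\<in>{N..<M}. ennreal ((u k t * e k y)\<^sup>2))"
          by (rule sum_ennreal[symmetric]) simp
        also have "\<dots> \<le> ?tail" by (rule sum_le_suminf_tail)
        finally show "(\<integral>\<^sup>+ x. ennreal ((norm (\<Sum>k\<in>{N..<M}. (u k t * e k y) *\<^sub>R zero_ext \<Omega> (\<phi> k) x))\<^sup>2) \<partial>lborel) \<le> ?tail" .
      qed simp
      finally show ?thesis .
    qed
    have "(\<lambda>M. 2 * ?tail + 2 * ?d M) \<longlonglongrightarrow> 2 * ?tail + 2 * 0"
      by (intro tendsto_add tendsto_const ennreal_tendsto_cmult d0) simp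
    hence "(\<lambda>M. 2 * ?tail + 2 * ?d M) \<longlonglongrightarrow> 2 * ?tail" by simp
    moreover have "\<forall>\<^sub>F M in sequentially. ?d N \<le> 2 * ?tail + 2 * ?d M"
      using eventually_ge_at_top[of N] by eventually_elim (rule le)
    ultimately show ?thesis by (rule tendsto_lowerbound) simp
  qed
  have bound: "(\<integral>\<^sup>+ p. ennreal ((norm (?S N p - ?U p))\<^sup>2) \<partial>wmeas \<Omega> T \<beta> \<theta>) \<le> 2 * (\<Sum>k. b (k + N))" for N
  proof -
    have [measurable]: "\<Omega> \<in> sets borel" by (rule S)
    have "(\<integral>\<^sup>+ p. ennreal ((norm (?S N p - ?U p))\<^sup>2) \<partial>wmeas \<Omega> T \<beta> \<theta>) =
      (\<integral>\<^sup>+ t\<in>{0<..<T}. (\<integral>\<^sup>+ y\<in>{0<..}. (\<integral>\<^sup>+ x\<in>\<Omega>. ennreal (weight \<beta> \<theta> y) * ennreal ((norm (?S N (x, y, t) - ?U (x, y, t)))\<^sup>2) \<partial>lborel) \<partial>lborel) \<partial>lborel)"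
      by (rule nn_integral_wmeas[OF \<Omega>], measurable)
    also have "\<dots> \<le> (\<integral>\<^sup>+ t\<in>{0<..<T}. (\<integral>\<^sup>+ y\<in>{0<..}. (ennreal (weight \<beta> \<theta> y) * (2 * (\<Sum>k. ennreal ((u (k + N) t * e (k + N) y)\<^sup>2)))) \<partial>lborel) \<partial>lborel)"
      using ser[unfolded series_solution_def]
    proof (intro nn_integral_mono_AE, eventually_elim)
      case (elim t)
      show ?case
      proof (cases "t \<in> {0<..<T}")
        case True
        with elim have "AE y in lborel. y > 0 \<longrightarrow>
          L2_tendsto \<Omega> (\<lambda>N x. \<Sum>k<N. mode \<Omega> lam \<phi> s f g h k t * \<phi> k x * \<psi> k y) (\<lambda>x. U (x, y, t))" by simp
        hence "(\<integral>\<^sup>+ y\<in>{0<..}. (\<integral>\<^sup>+ x\<in>\<Omega>. ennreal (weight \<beta> \<theta> y) * ennreal ((norm (?S N (x, y, t) - ?U (x, y, t)))\<^sup>2) \<partial>lborel) \<partial>lborel)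
          \<le> (\<integral>\<^sup>+ y\<in>{0<..}. (ennreal (weight \<beta> \<theta> y) * (2 * (\<Sum>k. ennreal ((u (k + N) t * e (k + N) y)\<^sup>2)))) \<partial>lborel)"
        proof (intro nn_integral_mono_AE, eventually_elim)
          case (elim y)
          show ?case
          proof (cases "0 < y")
            case y: True
            have [measurable]: "(\<lambda>x. ?U (x, y, t)) \<in> borel_measurable borel"
              by (rule measurable_compose[OF _ U]) (intro borel_measurable_continuous_onI continuous_intros)
            have [measurable]: "(\<lambda>x. ?S N (x, y, t)) \<in> borel_measurable borel"
              unfolding tensor_sum_def by simp
            have "(\<integral>\<^sup>+ x\<in>\<Omega>. ennreal (weight \<beta> \<theta> y) * ennreal ((norm (?S N (x, y, t) - ?U (x, y, t)))\<^sup>2) \<partial>lborel)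
               = ennreal (weight \<beta> \<theta> y) * (\<integral>\<^sup>+ x\<in>\<Omega>. ennreal ((norm (?S N (x, y, t) - ?U (x, y, t)))\<^sup>2) \<partial>lborel)"
              by (subst nn_integral_cmult[symmetric]) (auto simp: mult.assoc)
            also have "\<dots> \<le> ennreal (weight \<beta> \<theta> y) * (2 * (\<Sum>k. ennreal ((u (k + N) t * e (k + N) y)\<^sup>2)))"
              using elim y True by (intro mult_left_mono slice) auto
            finally show ?thesis by (intro mult_right_mono) auto
          qed simp
        qed
        thus ?thesis by (intro mult_right_mono) auto
      qed simp
    qed
    also have "\<dots> = (\<integral>\<^sup>+ t. (\<Sum>k. 2 * (\<integral>\<^sup>+ y\<in>{0<..}. ennreal (weight \<beta> \<theta> y * (e (k + N) y)\<^sup>2) \<partial>lborel) * (ennreal ((u (k + N) t)\<^sup>2) * indicator {0<..<T} t)) \<partial>lborel)"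
    proof (rule nn_integral_cong)
      fix t
      have "(\<integral>\<^sup>+ y\<in>{0<..}. (ennreal (weight \<beta> \<theta> y) * (2 * (\<Sum>k. ennreal ((u (k + N) t * e (k + N) y)\<^sup>2)))) \<partial>lborel)
        = (\<integral>\<^sup>+ y. (\<Sum>k. 2 * ennreal ((u (k + N) t)\<^sup>2) * (ennreal (weight \<beta> \<theta> y * (e (k + N) y)\<^sup>2) * indicator {0<..} y)) \<partial>lborel)"
        by (intro nn_integral_cong)
          (simp add: ennreal_suminf_cmult[symmetric] power_mult_distrib ennreal_mult weight_nonneg mult_ac
            del: ennreal_suminf_cmult)
      also have "\<dots> = (\<Sum>k. 2 * ennreal ((u (k + N) t)\<^sup>2) * (\<integral>\<^sup>+ y\<in>{0<..}. ennreal (weight \<beta> \<theta> y * (e (k + N) y)\<^sup>2) \<partial>lborel))"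
        by (subst nn_integral_suminf) (auto simp: nn_integral_cmult)
      finally have inner: "(\<integral>\<^sup>+ y\<in>{0<..}. (ennreal (weight \<beta> \<theta> y) * (2 * (\<Sum>k. ennreal ((u (k + N) t * e (k + N) y)\<^sup>2)))) \<partial>lborel)
        = (\<Sum>k. 2 * ennreal ((u (k + N) t)\<^sup>2) * (\<integral>\<^sup>+ y\<in>{0<..}. ennreal (weight \<beta> \<theta> y * (e (k + N) y)\<^sup>2) \<partial>lborel))" .
      show "(\<integral>\<^sup>+ y\<in>{0<..}. (ennreal (weight \<beta> \<theta> y) * (2 * (\<Sum>k. ennreal ((u (k + N) t * e (k + N) y)\<^sup>2)))) \<partial>lborel) * indicator {0<..<T} t
        = (\<Sum>k. 2 * (\<integral>\<^sup>+ y\<in>{0<..}. ennreal (weight \<beta> \<theta> y * (e (k + N) y)\<^sup>2) \<partial>lborel) * (ennreal ((u (k + N) t)\<^sup>2) * indicator {0<..<T} t))"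
      proof (cases "t \<in> {0<..<T}")
        case True
        show ?thesis unfolding inner by (simp only: indicator_simps(1)[OF True] mult_1_right mult_1_left mult_ac)
      next
        case False
        show ?thesis unfolding inner by (simp only: indicator_simps(2)[OF False] mult_zero_right mult_zero_left suminf_zero)
      qed
    qed
    also have "\<dots> = (\<Sum>k. 2 * b (k + N))"
      unfolding b_def by (subst nn_integral_suminf) (auto simp: nn_integral_cmult mult.assoc)
    also have "\<dots> = 2 * (\<Sum>k. b (k + N))" by (rule ennreal_suminf_cmult)
    finally show ?thesis .
  qed
  have "(\<lambda>N. 2 * (\<Sum>k. b (k + N))) \<longlonglongrightarrow> 2 * 0"
    using fin by (intro ennreal_tendsto_cmult suminf_ennreal_tail_tendsto_0) (auto simp: b_def)
  hence lim0: "(\<lambda>N. 2 * (\<Sum>k. b (k + N))) \<longlonglongrightarrow> 0" by simp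
  show ?thesis by (rule tendsto_sandwich[OF _ _ tendsto_const lim0]) (use bound in auto)
qed

section \<open>Weak derivatives of the limits\<close>

lemma integral_test_fun_limit:
  fixes F :: "nat \<Rightarrow> 'n::finite spacetime \<Rightarrow> real"
  assumes \<Omega>: "open \<Omega>" and \<eta>: "test_fun (cyl \<Omega> T) \<eta>"
    and mF: "\<And>n. F n \<in> borel_measurable borel" and mf: "f \<in> borel_measurable borel"
    and lim: "(\<lambda>n. \<integral>\<^sup>+ p. ennreal ((norm (F n p - f p))\<^sup>2) \<partial>wmeas \<Omega> T \<beta> \<theta>) \<longlonglongrightarrow> 0"
    and loc: "\<And>n. loc_integrable (cyl \<Omega> T) (F n)" "loc_integrable (cyl \<Omega> T) f"
  shows "(\<lambda>n. \<integral>p. F n p * \<eta> p \<partial>lborel) \<longlonglongrightarrow> (\<integral>p. f p * \<eta> p \<partial>lborel)"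
proof -
  obtain K where K: "compact K" "K \<subseteq> cyl \<Omega> T" and z: "\<And>p. p \<notin> K \<Longrightarrow> \<eta> p = 0"
    using test_fun_obtain_support[OF \<eta>] by metis
  obtain B where B: "\<And>p. \<bar>\<eta> p\<bar> \<le> B" using test_fun_bounded[OF \<eta>] by blast
  show ?thesis
  proof (rule L2_tendsto_integral_bilinear[OF bounded_bilinear_mult K(1) local_L1_bound[OF \<Omega> K] mF mf
        loc_integrable_compact[OF loc(1) K] loc_integrable_compact[OF loc(2) K] _ _ z lim, where B = B])
    show "(\<lambda>p. w p * \<eta> p) \<in> borel_measurable borel" if "w \<in> borel_measurable borel" for w
      using that borel_measurable_test_fun[OF \<eta>] by simp
  qed (use B in simp)
qed

lemma grad_x_basis: "((axis i 1, 0, 0) :: 'n::finite spacetime) \<in> Basis"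
  by (auto simp: Basis_prod_def zero_prod_def axis_Basis image_iff)

lemma continuous_grad_x: "test_fun S \<eta> \<Longrightarrow> continuous_on UNIV (grad_x \<eta>)"
  unfolding grad_x_def by (intro continuous_on_vec_lambda test_fun_continuous[OF test_fun_dderiv] grad_x_basis)

lemma grad_x_support:
  assumes \<eta>: "test_fun S \<eta>"
  obtains K B where "compact K" "K \<subseteq> S" "\<And>p. p \<notin> K \<Longrightarrow> \<eta> p = 0" "\<And>p. p \<notin> K \<Longrightarrow> grad_x \<eta> p = 0"
    "\<And>p. norm (grad_x \<eta> p) \<le> B" "\<And>p. \<bar>\<eta> p\<bar> \<le> B"
proof -
  obtain K where K: "compact K" "K \<subseteq> S" and z: "\<And>p. p \<notin> K \<Longrightarrow> \<eta> p = 0" and dz: "\<And>p b. p \<notin> K \<Longrightarrow> dderiv b \<eta> p = 0"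
    using test_fun_obtain_support[OF \<eta>] by metis
  have gz: "grad_x \<eta> p = 0" if "p \<notin> K" for p using dz[OF that] by (simp add: grad_x_def vec_eq_iff)
  have "bounded (grad_x \<eta> ` K)"
    by (intro compact_imp_bounded compact_continuous_image K(1) continuous_on_subset[OF continuous_grad_x[OF \<eta>]]) simp
  then obtain B1 where B1': "\<forall>w\<in>grad_x \<eta> ` K. norm w \<le> B1" unfolding bounded_iff by blast
  have B1: "norm (grad_x \<eta> p) \<le> \<bar>B1\<bar>" for p
  proof (cases "p \<in> K")
    case True
    hence "norm (grad_x \<eta> p) \<le> B1" using B1' by blast
    thus ?thesis by linarith
  qed (simp add: gz)
  obtain B2 where B2: "\<And>p. \<bar>\<eta> p\<bar> \<le> B2" using test_fun_bounded[OF \<eta>] by blast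
  show thesis
    using B1 B2 by (intro that[OF K z gz, of "max \<bar>B1\<bar> B2"]) (auto simp: le_max_iff_disj)
qed

lemma has_derivative_tensor_sum:
  assumes "\<And>k y. 0 < y \<Longrightarrow> (e k has_real_derivative e' k y) (at y)" and "0 < y"
  shows "((\<lambda>y. tensor_sum u e \<phi> I (x, y, t)) has_real_derivative tensor_sum u e' \<phi> I (x, y, t)) (at y)"
  unfolding tensor_sum_def case_prod_conv real_scaleR_def
  by (intro DERIV_sum DERIV_cmult_right DERIV_cmult assms)

text \<open>For partial sums the weak derivative is the classical one. The series for \<open>U\<close> and for \<open>V\<close> may converge
with respect to different weights, as only local convergence matters.\<close>

lemma weak_dy_of_series:
  fixes \<Omega> :: "(real^'n::finite) set" and e :: "nat \<Rightarrow> nat \<Rightarrow> real \<Rightarrow> real"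
  assumes \<Omega>: "open \<Omega>" and U: "zero_ext (cyl \<Omega> T) U \<in> borel_measurable borel" and V: "V \<in> borel_measurable borel"
    and mS: "\<And>j N. tensor_sum u (e j) \<phi> {..<N} \<in> borel_measurable borel"
    and locS: "\<And>j N. loc_integrable (cyl \<Omega> T) (tensor_sum u (e j) \<phi> {..<N})"
    and de: "\<And>j k y. 0 < y \<Longrightarrow> (e j k has_real_derivative e (Suc j) k y) (at y)"
    and limU: "(\<lambda>N. \<integral>\<^sup>+ p. ennreal ((norm (tensor_sum u (e 0) \<phi> {..<N} p - zero_ext (cyl \<Omega> T) U p))\<^sup>2) \<partial>wmeas \<Omega> T \<beta>0 \<theta>0) \<longlonglongrightarrow> 0"
    and locU: "loc_integrable (cyl \<Omega> T) (zero_ext (cyl \<Omega> T) U)"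
    and limV: "(\<lambda>N. \<integral>\<^sup>+ p. ennreal ((norm (tensor_sum u (e m) \<phi> {..<N} p - V p))\<^sup>2) \<partial>wmeas \<Omega> T \<beta> \<theta>) \<longlonglongrightarrow> 0"
    and locV: "loc_integrable (cyl \<Omega> T) V"
  shows "weak_dy m (cyl \<Omega> T) U V"
  unfolding weak_dy_def
proof (intro conjI allI impI locV)
  let ?U = "zero_ext (cyl \<Omega> T) U"
  show "loc_integrable (cyl \<Omega> T) U"
    unfolding loc_integrable_def set_integrable_def
  proof (intro allI impI, elim conjE)
    fix K :: "'n spacetime set" assume K: "compact K" "K \<subseteq> cyl \<Omega> T"
    have "(\<lambda>p. indicator K p *\<^sub>R U p) = (\<lambda>p. indicator K p *\<^sub>R ?U p)"
      using K(2) by (intro ext) (auto simp: indicator_def)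
    thus "integrable lborel (\<lambda>p. indicator K p *\<^sub>R U p)"
      using loc_integrable_compact[OF locU K] by (simp add: set_integrable_def)
  qed
  fix \<eta> assume \<eta>: "test_fun (cyl \<Omega> T) \<eta>"
  note \<eta>m = test_fun_d_y_pow[OF \<eta>, of m]
  have "(\<lambda>N. \<integral>p. tensor_sum u (e 0) \<phi> {..<N} p * (d_y ^^ m) \<eta> p \<partial>lborel) \<longlonglongrightarrow> (\<integral>p. ?U p * (d_y ^^ m) \<eta> p \<partial>lborel)"
    by (rule integral_test_fun_limit[OF \<Omega> \<eta>m mS U limU locS locU])
  moreover have "(\<integral>p. tensor_sum u (e 0) \<phi> {..<N} p * (d_y ^^ m) \<eta> p \<partial>lborel)
     = (-1) ^ m * (\<integral>p. tensor_sum u (e m) \<phi> {..<N} p * \<eta> p \<partial>lborel)" for N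
  proof -
    have "((\<lambda>y. tensor_sum u (e j) \<phi> {..<N} (x, y, t)) has_real_derivative tensor_sum u (e (Suc j)) \<phi> {..<N} (x, y, t)) (at y)"
      if "0 < y" for j x y t
      by (rule has_derivative_tensor_sum[where e = "e j" and e' = "e (Suc j)", OF de that])
    from integral_d_y_pow_by_parts[where F = "\<lambda>j. tensor_sum u (e j) \<phi> {..<N}" and j = 0, OF mS locS this \<eta>]
    show ?thesis by simp
  qed
  ultimately have "(\<lambda>N. (-1) ^ m * (\<integral>p. tensor_sum u (e m) \<phi> {..<N} p * \<eta> p \<partial>lborel)) \<longlonglongrightarrow> (\<integral>p. ?U p * (d_y ^^ m) \<eta> p \<partial>lborel)"
    by simp
  moreover have "(\<lambda>N. (-1) ^ m * (\<integral>p. tensor_sum u (e m) \<phi> {..<N} p * \<eta> p \<partial>lborel)) \<longlonglongrightarrow> (-1) ^ m * (\<integral>p. V p * \<eta> p \<partial>lborel)"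
    by (intro tendsto_mult_left integral_test_fun_limit[OF \<Omega> \<eta> mS V limV locS locV])
  ultimately have "(\<integral>p. ?U p * (d_y ^^ m) \<eta> p \<partial>lborel) = (-1) ^ m * (\<integral>p. V p * \<eta> p \<partial>lborel)"
    by (rule LIMSEQ_unique)
  moreover have "(LINT p:cyl \<Omega> T|lborel. U p * (d_y ^^ m) \<eta> p) = (\<integral>p. ?U p * (d_y ^^ m) \<eta> p \<partial>lborel)"
    unfolding set_lebesgue_integral_def by (intro Bochner_Integration.integral_cong) (auto simp: zero_ext_def)
  moreover have "(LINT p:cyl \<Omega> T|lborel. V p * \<eta> p) = (\<integral>p. V p * \<eta> p \<partial>lborel)"
    by (rule set_integral_zero_outside) (simp add: test_fun_zero_outside[OF \<eta>])
  ultimately show "(LINT p:cyl \<Omega> T|lborel. U p * (d_y ^^ m) \<eta> p) = (-1) ^ m * (LINT p:cyl \<Omega> T|lborel. V p * \<eta> p)"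
    by simp
qed

text \<open>For partial sums, integrate first over \<open>x\<close> with \<open>(y, t)\<close> fixed and apply \<open>H01_integral_by_parts\<close> to each
\<open>\<phi> k\<close>.\<close>

lemma weak_grad_x_of_series:
  fixes \<Omega> :: "(real^'n::finite) set"
  assumes \<Omega>: "open \<Omega>" and V: "V \<in> borel_measurable borel" and W: "W \<in> borel_measurable borel"
    and H: "\<And>k. H01_grad \<Omega> (\<phi> k) (G k)"
    and mS: "\<And>N. tensor_sum u e (\<lambda>k. zero_ext \<Omega> (\<phi> k)) {..<N} \<in> borel_measurable borel"
      "\<And>N. tensor_sum u e (\<lambda>k. zero_ext \<Omega> (G k)) {..<N} \<in> borel_measurable borel"
    and locS: "\<And>N. loc_integrable (cyl \<Omega> T) (tensor_sum u e (\<lambda>k. zero_ext \<Omega> (\<phi> k)) {..<N})"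
      "\<And>N. loc_integrable (cyl \<Omega> T) (tensor_sum u e (\<lambda>k. zero_ext \<Omega> (G k)) {..<N})"
    and limV: "(\<lambda>N. \<integral>\<^sup>+ p. ennreal ((norm (tensor_sum u e (\<lambda>k. zero_ext \<Omega> (\<phi> k)) {..<N} p - V p))\<^sup>2) \<partial>wmeas \<Omega> T \<beta> \<theta>) \<longlonglongrightarrow> 0"
    and locV: "loc_integrable (cyl \<Omega> T) V"
    and limW: "(\<lambda>N. \<integral>\<^sup>+ p. ennreal ((norm (tensor_sum u e (\<lambda>k. zero_ext \<Omega> (G k)) {..<N} p - W p))\<^sup>2) \<partial>wmeas \<Omega> T \<beta>' \<theta>') \<longlonglongrightarrow> 0"
    and locW: "loc_integrable (cyl \<Omega> T) W"
  shows "weak_grad_x (cyl \<Omega> T) V W"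
  unfolding weak_grad_x_def
proof (intro conjI allI impI locV locW)
  fix \<eta> assume \<eta>: "test_fun (cyl \<Omega> T) \<eta>"
  let ?S = "\<lambda>N. tensor_sum u e (\<lambda>k. zero_ext \<Omega> (\<phi> k)) {..<N}" and ?SW = "\<lambda>N. tensor_sum u e (\<lambda>k. zero_ext \<Omega> (G k)) {..<N}"
  obtain K B where K: "compact K" "K \<subseteq> cyl \<Omega> T" and z: "\<And>p. p \<notin> K \<Longrightarrow> \<eta> p = 0" "\<And>p. p \<notin> K \<Longrightarrow> grad_x \<eta> p = 0"
    and B: "\<And>p. norm (grad_x \<eta> p) \<le> B" "\<And>p. \<bar>\<eta> p\<bar> \<le> B"
    using grad_x_support[OF \<eta>] by blast
  have m\<eta>: "\<eta> \<in> borel_measurable borel" "grad_x \<eta> \<in> borel_measurable borel"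
    using borel_measurable_test_fun[OF \<eta>] borel_measurable_continuous_onI[OF continuous_grad_x[OF \<eta>]] by auto
  note bl1 = bounded_bilinear_scaleR and bl2 = bounded_bilinear.flip[OF bounded_bilinear_scaleR]
  note ctrl = local_L1_bound[OF \<Omega> K]
  have lim1: "(\<lambda>N. \<integral>p. ?S N p *\<^sub>R grad_x \<eta> p \<partial>lborel) \<longlonglongrightarrow> (\<integral>p. V p *\<^sub>R grad_x \<eta> p \<partial>lborel)"
    by (rule L2_tendsto_integral_bilinear[OF bl1 K(1) ctrl mS(1) V loc_integrable_compact[OF locS(1) K]
          loc_integrable_compact[OF locV K] _ _ z(2) limV, where B = B]) (use m\<eta> B in auto)
  have lim2: "(\<lambda>N. \<integral>p. \<eta> p *\<^sub>R ?SW N p \<partial>lborel) \<longlonglongrightarrow> (\<integral>p. \<eta> p *\<^sub>R W p \<partial>lborel)"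
    by (rule L2_tendsto_integral_bilinear[OF bl2 K(1) ctrl mS(2) W loc_integrable_compact[OF locS(2) K]
          loc_integrable_compact[OF locW K] _ _ z(1) limW, where B = B]) (use m\<eta> B in auto)
  have "(\<integral>p. ?S N p *\<^sub>R grad_x \<eta> p \<partial>lborel) = - (\<integral>p. \<eta> p *\<^sub>R ?SW N p \<partial>lborel)" for N
  proof -
    have i1: "integrable lborel (\<lambda>p. ?S N p *\<^sub>R grad_x \<eta> p)"
      by (rule integrable_bilinear_compact_support[OF bl1 loc_integrable_compact[OF locS(1) K] _ _ z(2), where B = B])
        (use m\<eta> B mS(1)[of N] in auto)
    have i2: "integrable lborel (\<lambda>p. \<eta> p *\<^sub>R ?SW N p)"
      by (rule integrable_bilinear_compact_support[OF bl2 loc_integrable_compact[OF locS(2) K] _ _ z(1), where B = B])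
        (use m\<eta> B mS(2)[of N] in auto)
    have "(\<integral>p. ?S N p *\<^sub>R grad_x \<eta> p + \<eta> p *\<^sub>R ?SW N p \<partial>lborel) = 0"
    proof (rule integral_zero_of_slices)
      show "integrable lborel (\<lambda>p. ?S N p *\<^sub>R grad_x \<eta> p + \<eta> p *\<^sub>R ?SW N p)" using i1 i2 by simp
      fix q :: "real \<times> real"
      let ?v = "\<lambda>x. \<eta> (x, q)" and ?a = "\<lambda>k. u k (snd q) * e k (fst q)"
      note v = test_fun_slice(1)[OF \<eta>, of q]
      note ibp = H01_integral_by_parts[OF \<Omega> H v]
      have "?S N (x, q) *\<^sub>R grad_x \<eta> (x, q) + \<eta> (x, q) *\<^sub>R ?SW N (x, q)
         = (\<Sum>k<N. ?a k *\<^sub>R (zero_ext \<Omega> (\<phi> k) x *\<^sub>R grad ?v x + ?v x *\<^sub>R zero_ext \<Omega> (G k) x))" for x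
        unfolding test_fun_slice(2)[OF \<eta>] tensor_sum_def case_prod_beta fst_conv snd_conv
        by (simp add: scaleR_sum_left scaleR_sum_right scaleR_add_right sum.distrib mult_ac)
      hence "(\<integral>x. ?S N (x, q) *\<^sub>R grad_x \<eta> (x, q) + \<eta> (x, q) *\<^sub>R ?SW N (x, q) \<partial>lborel)
         = (\<integral>x. (\<Sum>k<N. ?a k *\<^sub>R (zero_ext \<Omega> (\<phi> k) x *\<^sub>R grad ?v x + ?v x *\<^sub>R zero_ext \<Omega> (G k) x)) \<partial>lborel)"
        by presburger
      also have "\<dots> = (\<Sum>k<N. ?a k *\<^sub>R ((\<integral>x. zero_ext \<Omega> (\<phi> k) x *\<^sub>R grad ?v x \<partial>lborel) + (\<integral>x. ?v x *\<^sub>R zero_ext \<Omega> (G k) x \<partial>lborel)))"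
        using ibp(1,2) by (subst Bochner_Integration.integral_sum) auto
      also have "\<dots> = 0" by (simp add: ibp(3))
      finally show "(\<integral>x. ?S N (x, q) *\<^sub>R grad_x \<eta> (x, q) + \<eta> (x, q) *\<^sub>R ?SW N (x, q) \<partial>lborel) = 0" .
    qed
    thus ?thesis using i1 i2 by (simp add: eq_neg_iff_add_eq_0)
  qed
  hence "(\<lambda>N. \<integral>p. ?S N p *\<^sub>R grad_x \<eta> p \<partial>lborel) \<longlonglongrightarrow> - (\<integral>p. \<eta> p *\<^sub>R W p \<partial>lborel)"
    using tendsto_minus[OF lim2] by simp
  from LIMSEQ_unique[OF lim1 this]
  have "(\<integral>p. V p *\<^sub>R grad_x \<eta> p \<partial>lborel) = - (\<integral>p. \<eta> p *\<^sub>R W p \<partial>lborel)" .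
  moreover have "(LINT p:cyl \<Omega> T|lborel. V p *\<^sub>R grad_x \<eta> p) = (\<integral>p. V p *\<^sub>R grad_x \<eta> p \<partial>lborel)"
    by (rule set_integral_zero_outside) (use z(2) K(2) in auto)
  moreover have "(LINT p:cyl \<Omega> T|lborel. \<eta> p *\<^sub>R W p) = (\<integral>p. \<eta> p *\<^sub>R W p \<partial>lborel)"
    by (rule set_integral_zero_outside) (simp add: test_fun_zero_outside[OF \<eta>])
  ultimately show "(LINT p:cyl \<Omega> T|lborel. V p *\<^sub>R grad_x \<eta> p) = - (LINT p:cyl \<Omega> T|lborel. \<eta> p *\<^sub>R W p)"
    by simp
qed

lemma AE_fst_lborel:
  assumes "AE x in (lborel :: 'a::euclidean_space measure). P x"
  shows "AE p in (lborel :: ('a \<times> 'b::euclidean_space) measure). P (fst p)"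
proof -
  obtain N where N: "{x. \<not> P x} \<subseteq> N" "N \<in> null_sets (lborel :: 'a measure)"
    using assms unfolding eventually_ae_filter by auto
  have "emeasure (lborel \<Otimes>\<^sub>M (lborel :: 'b measure)) (N \<times> UNIV) = emeasure lborel N * emeasure (lborel :: 'b measure) UNIV"
    using N(2) by (intro lborel.emeasure_pair_measure_Times) (auto dest: null_setsD2)
  also have "\<dots> = 0" using N(2) by (simp add: null_setsD1)
  finally have "N \<times> UNIV \<in> null_sets (lborel \<Otimes>\<^sub>M (lborel :: 'b measure))"
    using N(2) by (intro null_setsI) (auto dest: null_setsD2)
  hence "N \<times> UNIV \<in> null_sets (lborel :: ('a \<times> 'b) measure)" by (simp add: lborel_prod)
  thus ?thesis by (rule AE_I') (use N(1) in auto)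
qed

lemma symmetric_matrix_inner:
  fixes M :: "real^'n^'n"
  assumes "transpose M = M"
  shows "(M *v x) \<bullet> y = x \<bullet> (M *v y)"
  by (metis assms dot_lmul_matrix transpose_matrix_vector)

text \<open>On each slice the eigenvalue equation is tested with the slice of \<open>\<eta>\<close>. The matrix is moved to
\<open>\<nabla>\<eta>\<close> by symmetry, so that the sequence enters the limit only through the inner product with a fixed bounded field.\<close>

lemma weak_Lx_of_series:
  fixes \<Omega> :: "(real^'n::finite) set"
  assumes \<Omega>: "open \<Omega>" "bounded \<Omega>" and adm: "admissible_coeffs \<Omega> A c"
    and V: "V \<in> borel_measurable borel" and W: "W \<in> borel_measurable borel" and Z: "Z \<in> borel_measurable borel"
    and H: "\<And>k. H01_grad \<Omega> (\<phi> k) (G k)"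
    and eig: "\<And>k v H. H01_grad \<Omega> v H \<Longrightarrow>
      (LINT x:\<Omega>|lborel. (A x *v G k x) \<bullet> H x + c x * \<phi> k x * v x) = lam k * (LINT x:\<Omega>|lborel. \<phi> k x * v x)"
    and mS: "\<And>N. tensor_sum u e (\<lambda>k. zero_ext \<Omega> (\<phi> k)) {..<N} \<in> borel_measurable borel"
      "\<And>N. tensor_sum u e (\<lambda>k. zero_ext \<Omega> (G k)) {..<N} \<in> borel_measurable borel"
      "\<And>N. tensor_sum u e (\<lambda>k x. lam k * zero_ext \<Omega> (\<phi> k) x) {..<N} \<in> borel_measurable borel"
    and locS: "\<And>N. loc_integrable (cyl \<Omega> T) (tensor_sum u e (\<lambda>k. zero_ext \<Omega> (\<phi> k)) {..<N})"
      "\<And>N. loc_integrable (cyl \<Omega> T) (tensor_sum u e (\<lambda>k. zero_ext \<Omega> (G k)) {..<N})"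
      "\<And>N. loc_integrable (cyl \<Omega> T) (tensor_sum u e (\<lambda>k x. lam k * zero_ext \<Omega> (\<phi> k) x) {..<N})"
    and limV: "(\<lambda>N. \<integral>\<^sup>+ p. ennreal ((norm (tensor_sum u e (\<lambda>k. zero_ext \<Omega> (\<phi> k)) {..<N} p - V p))\<^sup>2) \<partial>wmeas \<Omega> T \<beta> \<theta>) \<longlonglongrightarrow> 0"
    and locV: "loc_integrable (cyl \<Omega> T) V"
    and limW: "(\<lambda>N. \<integral>\<^sup>+ p. ennreal ((norm (tensor_sum u e (\<lambda>k. zero_ext \<Omega> (G k)) {..<N} p - W p))\<^sup>2) \<partial>wmeas \<Omega> T \<beta>' \<theta>') \<longlonglongrightarrow> 0"
    and locW: "loc_integrable (cyl \<Omega> T) W"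
    and limZ: "(\<lambda>N. \<integral>\<^sup>+ p. ennreal ((norm (tensor_sum u e (\<lambda>k x. lam k * zero_ext \<Omega> (\<phi> k) x) {..<N} p - Z p))\<^sup>2) \<partial>wmeas \<Omega> T \<beta>'' \<theta>'') \<longlonglongrightarrow> 0"
    and locZ: "loc_integrable (cyl \<Omega> T) Z"
  shows "weak_Lx A c (cyl \<Omega> T) V Z"
  unfolding weak_Lx_def
proof (intro conjI locZ exI[of _ W] allI impI)
  show "weak_grad_x (cyl \<Omega> T) V W"
    by (rule weak_grad_x_of_series[OF \<Omega>(1) V W H mS(1,2) locS(1,2) limV locV limW locW])
  fix \<eta> assume \<eta>: "test_fun (cyl \<Omega> T) \<eta>"
  let ?S = "\<lambda>N. tensor_sum u e (\<lambda>k. zero_ext \<Omega> (\<phi> k)) {..<N}"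
    and ?SW = "\<lambda>N. tensor_sum u e (\<lambda>k. zero_ext \<Omega> (G k)) {..<N}"
    and ?SZ = "\<lambda>N. tensor_sum u e (\<lambda>k x. lam k * zero_ext \<Omega> (\<phi> k) x) {..<N}"
  define g1 where "g1 p = zero_ext \<Omega> A (fst p) *v grad_x \<eta> p" for p
  define g2 where "g2 p = zero_ext \<Omega> c (fst p) * \<eta> p" for p
  have S: "\<Omega> \<in> sets borel" using \<Omega> by simp
  note L = H[unfolded H01_grad_def, THEN conjunct1] H[unfolded H01_grad_def, THEN conjunct2, THEN conjunct1]
  note ac = admissible_coeffs_zero_ext[OF \<Omega> adm]
  have sym: "transpose (A x) = A x" if "x \<in> \<Omega>" for x using adm that unfolding admissible_coeffs_def by blast
  have symz: "(zero_ext \<Omega> A x *v a) \<bullet> b = a \<bullet> (zero_ext \<Omega> A x *v b)" for x a b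
    by (cases "x \<in> \<Omega>") (simp_all add: symmetric_matrix_inner[OF sym])
  obtain MA where MA: "\<And>x. norm (zero_ext \<Omega> A x) \<le> MA" using ac(3) by blast
  obtain Mc where Mc: "AE x in lborel. norm (zero_ext \<Omega> c x) \<le> Mc" using ac(4) by blast
  obtain C where C: "0 < C" "\<And>(M :: real^'n^'n) x. norm (M *v x) \<le> norm M * norm x * C"
    using bounded_bilinear.pos_bounded[OF bounded_bilinear_matrix_vector] by blast
  obtain K B where K: "compact K" "K \<subseteq> cyl \<Omega> T" and z: "\<And>p. p \<notin> K \<Longrightarrow> \<eta> p = 0" "\<And>p. p \<notin> K \<Longrightarrow> grad_x \<eta> p = 0"
    and B: "\<And>p. norm (grad_x \<eta> p) \<le> B" "\<And>p. \<bar>\<eta> p\<bar> \<le> B"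
    using grad_x_support[OF \<eta>] by blast
  have m\<eta>: "\<eta> \<in> borel_measurable borel" "grad_x \<eta> \<in> borel_measurable borel"
    using borel_measurable_test_fun[OF \<eta>] borel_measurable_continuous_onI[OF continuous_grad_x[OF \<eta>]] by auto
  have mfst: "(fst :: 'n spacetime \<Rightarrow> _) \<in> borel_measurable borel"
    by (intro borel_measurable_continuous_onI continuous_intros)
  have mg: "g1 \<in> borel_measurable borel" "g2 \<in> borel_measurable borel"
    using measurable_compose[OF mfst ac(1)] measurable_compose[OF mfst ac(2)] m\<eta>
    unfolding g1_def g2_def by simp_all
  have zg: "g1 p = 0" "g2 p = 0" if "p \<notin> K" for p using z[OF that] by (simp_all add: g1_def g2_def)
  have b1: "norm (g1 p) \<le> MA * B * C" for p
  proof -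
    have "norm (g1 p) \<le> norm (zero_ext \<Omega> A (fst p)) * norm (grad_x \<eta> p) * C" unfolding g1_def by (rule C)
    also have "\<dots> \<le> MA * B * C"
      using C MA[of "fst p"] B(1)[of p] by (intro mult_right_mono mult_mono) (auto intro: order_trans[OF norm_ge_zero])
    finally show ?thesis .
  qed
  hence b1: "AE p in lborel. norm (g1 p) \<le> MA * B * C" by simp
  have b2: "AE p in lborel. norm (g2 p) \<le> Mc * B"
    using AE_fst_lborel[OF Mc]
  proof eventually_elim
    case (elim p)
    have "norm (g2 p) = norm (zero_ext \<Omega> c (fst p)) * \<bar>\<eta> p\<bar>" by (simp add: g2_def abs_mult)
    also have "\<dots> \<le> Mc * B" using elim B(2)[of p] by (intro mult_mono) (auto intro: order_trans[OF norm_ge_zero])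
    finally show ?case .
  qed
  note ctrl = local_L1_bound[OF \<Omega>(1) K] and bin = bounded_bilinear_inner and bmul = bounded_bilinear_mult
  have min: "(\<lambda>p. w p \<bullet> g1 p) \<in> borel_measurable borel" if "w \<in> borel_measurable borel" for w
    using that mg by simp
  have mmul: "(\<lambda>p. w p * g2 p) \<in> borel_measurable borel" if "w \<in> borel_measurable borel" for w :: "_ \<Rightarrow> real"
    using that mg by simp
  have intW: "integrable lborel (\<lambda>p. w p \<bullet> g1 p)"
    if "w \<in> borel_measurable borel" "loc_integrable (cyl \<Omega> T) w" for w
    by (rule integrable_bilinear_compact_support[OF bin loc_integrable_compact[OF that(2) K] min[OF that(1)] b1 zg(1)])
  have intV: "integrable lborel (\<lambda>p. w p * g2 p)"
    if "w \<in> borel_measurable borel" "loc_integrable (cyl \<Omega> T) w" for w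
    by (rule integrable_bilinear_compact_support[OF bmul loc_integrable_compact[OF that(2) K] mmul[OF that(1)] b2 zg(2)])
  have limits: "(\<lambda>N. \<integral>p. ?SW N p \<bullet> g1 p \<partial>lborel) \<longlonglongrightarrow> (\<integral>p. W p \<bullet> g1 p \<partial>lborel)"
    "(\<lambda>N. \<integral>p. ?S N p * g2 p \<partial>lborel) \<longlonglongrightarrow> (\<integral>p. V p * g2 p \<partial>lborel)"
    "(\<lambda>N. \<integral>p. ?SZ N p * \<eta> p \<partial>lborel) \<longlonglongrightarrow> (\<integral>p. Z p * \<eta> p \<partial>lborel)"
  proof -
    show "(\<lambda>N. \<integral>p. ?SW N p \<bullet> g1 p \<partial>lborel) \<longlonglongrightarrow> (\<integral>p. W p \<bullet> g1 p \<partial>lborel)"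
      by (rule L2_tendsto_integral_bilinear[OF bin K(1) ctrl mS(2) W loc_integrable_compact[OF locS(2) K]
          loc_integrable_compact[OF locW K] min b1 zg(1) limW])
    show "(\<lambda>N. \<integral>p. ?S N p * g2 p \<partial>lborel) \<longlonglongrightarrow> (\<integral>p. V p * g2 p \<partial>lborel)"
      by (rule L2_tendsto_integral_bilinear[OF bmul K(1) ctrl mS(1) V loc_integrable_compact[OF locS(1) K]
          loc_integrable_compact[OF locV K] mmul b2 zg(2) limV])
    show "(\<lambda>N. \<integral>p. ?SZ N p * \<eta> p \<partial>lborel) \<longlonglongrightarrow> (\<integral>p. Z p * \<eta> p \<partial>lborel)"
      by (rule integral_test_fun_limit[OF \<Omega>(1) \<eta> mS(3) Z limZ locS(3) locZ])
  qed
  have "(\<integral>p. ?SW N p \<bullet> g1 p \<partial>lborel) + (\<integral>p. ?S N p * g2 p \<partial>lborel) = (\<integral>p. ?SZ N p * \<eta> p \<partial>lborel)" for N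
  proof -
    have i: "integrable lborel (\<lambda>p. ?SW N p \<bullet> g1 p)" "integrable lborel (\<lambda>p. ?S N p * g2 p)"
      "integrable lborel (\<lambda>p. ?SZ N p * \<eta> p)"
      by (rule intW[OF mS(2) locS(2)], rule intV[OF mS(1) locS(1)], rule integrable_mult_test_fun[OF mS(3) locS(3) \<eta>])
    have "(\<integral>p. (?SW N p \<bullet> g1 p + ?S N p * g2 p) - ?SZ N p * \<eta> p \<partial>lborel) = 0"
    proof (rule integral_zero_of_slices)
      show "integrable lborel (\<lambda>p. (?SW N p \<bullet> g1 p + ?S N p * g2 p) - ?SZ N p * \<eta> p)" using i by simp
      fix q :: "real \<times> real"
      let ?v = "\<lambda>x. \<eta> (x, q)" and ?a = "\<lambda>k. u k (snd q) * e k (fst q)"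
      note v = test_fun_slice(1)[OF \<eta>, of q]
      have Hv: "H01_grad \<Omega> ?v (grad ?v)" by (rule H01_grad_test_fun[OF v S])
      hence Lv: "L2 \<Omega> ?v" "L2 \<Omega> (grad ?v)" unfolding H01_grad_def by auto
      have vz: "zero_ext \<Omega> ?v x = ?v x" for x
        by (cases "x \<in> \<Omega>") (simp_all add: test_fun_zero_outside[OF v])
      let ?E = "\<lambda>k. energy_density \<Omega> A c (\<phi> k) (G k) ?v (grad ?v)"
      have iE: "integrable lborel (?E k)" for k by (rule integrable_energy_density[OF \<Omega> adm L Lv])
      have iv: "integrable lborel (\<lambda>x. zero_ext \<Omega> (\<phi> k) x * ?v x)" for k
        by (rule integrable_of_L2_bound[OF L(1) Lv(1) S, where C = 1])
          (use L2_zero_ext(1)[OF L(1) S] borel_measurable_test_fun[OF v] vz in \<open>auto simp: abs_mult\<close>)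
      have E: "?E k x = zero_ext \<Omega> (G k) x \<bullet> (zero_ext \<Omega> A x *v grad ?v x) + zero_ext \<Omega> (\<phi> k) x * (zero_ext \<Omega> c x * ?v x)" for k x
        by (cases "x \<in> \<Omega>") (simp_all add: energy_density_def symz[symmetric] symmetric_matrix_inner[OF sym] mult_ac)
      have "(?SW N (x, q) \<bullet> g1 (x, q) + ?S N (x, q) * g2 (x, q)) - ?SZ N (x, q) * \<eta> (x, q)
         = (\<Sum>k<N. ?a k * (?E k x - lam k * (zero_ext \<Omega> (\<phi> k) x * ?v x)))" for x
        unfolding g1_def g2_def test_fun_slice(2)[OF \<eta>, symmetric] fst_conv E tensor_sum_def case_prod_beta snd_conv
        by (simp add: inner_sum_left sum_distrib_left sum_distrib_right sum.distrib[symmetric] sum_subtractf[symmetric] algebra_simps)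
      hence "(\<integral>x. (?SW N (x, q) \<bullet> g1 (x, q) + ?S N (x, q) * g2 (x, q)) - ?SZ N (x, q) * \<eta> (x, q) \<partial>lborel)
         = (\<integral>x. (\<Sum>k<N. ?a k * (?E k x - lam k * (zero_ext \<Omega> (\<phi> k) x * ?v x))) \<partial>lborel)"
        by presburger
      also have "\<dots> = (\<Sum>k<N. ?a k * ((\<integral>x. ?E k x \<partial>lborel) - lam k * (\<integral>x. zero_ext \<Omega> (\<phi> k) x * ?v x \<partial>lborel)))"
        using iE iv by (subst Bochner_Integration.integral_sum) auto
      also have "\<dots> = 0"
      proof -
        have "(\<integral>x. ?E k x \<partial>lborel) = lam k * (\<integral>x. zero_ext \<Omega> (\<phi> k) x * ?v x \<partial>lborel)" for k
          using eig[OF Hv, of k] unfolding energy_integral integral_zero_ext_mult vz .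
        thus ?thesis by simp
      qed
      finally show "(\<integral>x. (?SW N (x, q) \<bullet> g1 (x, q) + ?S N (x, q) * g2 (x, q)) - ?SZ N (x, q) * \<eta> (x, q) \<partial>lborel) = 0" .
    qed
    thus ?thesis using i by simp
  qed
  hence "(\<lambda>N. \<integral>p. ?SZ N p * \<eta> p \<partial>lborel) \<longlonglongrightarrow> (\<integral>p. W p \<bullet> g1 p \<partial>lborel) + (\<integral>p. V p * g2 p \<partial>lborel)"
    using tendsto_add[OF limits(1,2)] by simp
  from LIMSEQ_unique[OF this limits(3)]
  have "(\<integral>p. W p \<bullet> g1 p + V p * g2 p \<partial>lborel) = (\<integral>p. Z p * \<eta> p \<partial>lborel)"
    using intW[OF W locW] intV[OF V locV] by simp
  moreover have "(LINT p:cyl \<Omega> T|lborel. (A (fst p) *v W p) \<bullet> grad_x \<eta> p + c (fst p) * V p * \<eta> p)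
     = (\<integral>p. W p \<bullet> g1 p + V p * g2 p \<partial>lborel)"
    unfolding set_lebesgue_integral_def
  proof (intro Bochner_Integration.integral_cong refl)
    fix p
    show "indicator (cyl \<Omega> T) p *\<^sub>R ((A (fst p) *v W p) \<bullet> grad_x \<eta> p + c (fst p) * V p * \<eta> p) = W p \<bullet> g1 p + V p * g2 p"
    proof (cases "p \<in> cyl \<Omega> T")
      case True
      hence "fst p \<in> \<Omega>" by (auto simp: cyl_def)
      thus ?thesis using True by (simp add: g1_def g2_def symmetric_matrix_inner[OF sym])
    next
      case False
      hence "p \<notin> K" using K(2) by blast
      thus ?thesis using False zg[of p] by simp
    qed
  qed
  moreover have "(LINT p:cyl \<Omega> T|lborel. Z p * \<eta> p) = (\<integral>p. Z p * \<eta> p \<partial>lborel)"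
    by (rule set_integral_zero_outside) (simp add: test_fun_zero_outside[OF \<eta>])
  ultimately show "(LINT p:cyl \<Omega> T|lborel. (A (fst p) *v W p) \<bullet> grad_x \<eta> p + c (fst p) * V p * \<eta> p)
      = (LINT p:cyl \<Omega> T|lborel. Z p * \<eta> p)" by simp
qed

section \<open>The regularity estimates\<close>

lemma loc_integrable_tensor_sum:
  fixes \<Phi> :: "nat \<Rightarrow> real^'n::finite \<Rightarrow> 'b::euclidean_space"
  assumes \<Omega>: "open \<Omega>" and u: "\<And>k. u k \<in> borel_measurable borel" and e: "\<And>k. e k \<in> borel_measurable borel"
    and \<Phi>: "\<And>k. \<Phi> k \<in> borel_measurable borel"
    and bessel: "bessel_bound \<mu> \<Phi>"
    and \<mu>: "\<And>k. 0 \<le> \<mu> k" and I: "finite I"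
    and fin: "\<And>k. (\<integral>\<^sup>+ y\<in>{0<..}. ennreal (weight \<beta> \<theta> y * (e k y)\<^sup>2) \<partial>lborel) < \<infinity>"
      "\<And>k. (\<integral>\<^sup>+ t\<in>{0<..<T}. ennreal ((u k t)\<^sup>2) \<partial>lborel) < \<infinity>"
  shows "loc_integrable (cyl \<Omega> T) (tensor_sum u e \<Phi> I)"
proof (rule loc_integrable_of_weighted_L2[OF \<Omega> borel_measurable_tensor_sum[OF u e \<Phi>]])
  have "(\<Sum>k\<in>I. ennreal (\<mu> k) * (\<integral>\<^sup>+ y\<in>{0<..}. ennreal (weight \<beta> \<theta> y * (e k y)\<^sup>2) \<partial>lborel)
        * (\<integral>\<^sup>+ t\<in>{0<..<T}. ennreal ((u k t)\<^sup>2) \<partial>lborel)) < \<infinity>"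
    using I fin by (simp add: ennreal_mult_less_top)
  with tensor_sum_weighted_bound[OF \<Omega> u e \<Phi> bessel \<mu> I]
  show "(\<integral>\<^sup>+ p. ennreal ((norm (tensor_sum u e \<Phi> I p))\<^sup>2) \<partial>wmeas \<Omega> T \<beta> \<theta>) < \<infinity>"
    by (rule le_less_trans)
qed

text \<open>The form in which the separated bounds are used: \<open>B\<close> collects the factor from \<open>y\<close> that does not
depend on \<open>k\<close>, and \<open>w k\<close> is the power of \<open>lam k\<close> that matches the norms of the data.\<close>

lemma tensor_series_estimate:
  fixes \<Phi> :: "nat \<Rightarrow> real^'n::finite \<Rightarrow> 'b::euclidean_space"
  assumes \<Omega>: "open \<Omega>" and u: "\<And>k. u k \<in> borel_measurable borel" and e: "\<And>k. e k \<in> borel_measurable borel"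
    and \<Phi>: "\<And>k. \<Phi> k \<in> borel_measurable borel"
    and bessel: "bessel_bound \<mu> \<Phi>"
    and \<mu>: "\<And>k. 0 \<le> \<mu> k" and B: "0 \<le> B" and w: "\<And>k. 0 \<le> w k"
    and N: "\<And>k. ennreal (\<mu> k) * (\<integral>\<^sup>+ y\<in>{0<..}. ennreal (weight \<beta> \<theta> y * (e k y)\<^sup>2) \<partial>lborel) \<le> ennreal (B * w k)"
    and R: "(\<Sum>k. ennreal (w k) * (\<integral>\<^sup>+ t\<in>{0<..<T}. ennreal ((u k t)\<^sup>2) \<partial>lborel)) \<le> R" "R < \<infinity>"
  shows "\<exists>V\<in>borel_measurable borel. loc_integrable (cyl \<Omega> T) V \<and> wnorm2 \<Omega> T \<beta> \<theta> V \<le> ennreal B * R \<and>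
      (\<lambda>N. \<integral>\<^sup>+ p. ennreal ((norm (tensor_sum u e \<Phi> {..<N} p - V p))\<^sup>2) \<partial>wmeas \<Omega> T \<beta> \<theta>) \<longlonglongrightarrow> 0"
proof -
  let ?J = "\<lambda>k. \<integral>\<^sup>+ t\<in>{0<..<T}. ennreal ((u k t)\<^sup>2) \<partial>lborel"
  define b where "b k = ennreal (B * w k) * ?J k" for k
  have "(\<Sum>k. b k) = (\<Sum>k. ennreal B * (ennreal (w k) * ?J k))"
    unfolding b_def using B w by (simp add: ennreal_mult mult.assoc)
  also have "\<dots> = ennreal B * (\<Sum>k. ennreal (w k) * ?J k)" by (rule ennreal_suminf_cmult)
  also have "\<dots> \<le> ennreal B * R" by (intro mult_left_mono R) auto
  finally have b: "(\<Sum>k. b k) \<le> ennreal B * R" .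
  have fin: "(\<Sum>k. b k) < \<infinity>"
    by (rule le_less_trans[OF b]) (use R(2) in \<open>simp add: ennreal_mult_less_top\<close>)
  have bk: "ennreal (\<mu> k) * (\<integral>\<^sup>+ y\<in>{0<..}. ennreal (weight \<beta> \<theta> y * (e k y)\<^sup>2) \<partial>lborel) * ?J k \<le> b k" for k
    unfolding b_def by (intro mult_right_mono N) auto
  obtain V where V: "V \<in> borel_measurable borel"
      "(\<integral>\<^sup>+ p. ennreal ((norm (V p))\<^sup>2) \<partial>wmeas \<Omega> T \<beta> \<theta>) \<le> (\<Sum>k. b k)"
      "(\<lambda>N. \<integral>\<^sup>+ p. ennreal ((norm (tensor_sum u e \<Phi> {..<N} p - V p))\<^sup>2) \<partial>wmeas \<Omega> T \<beta> \<theta>) \<longlonglongrightarrow> 0"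
    using tensor_series_converges(1)[OF \<Omega> u e \<Phi> bessel \<mu> bk fin] by blast
  have "loc_integrable (cyl \<Omega> T) V"
    by (rule loc_integrable_of_weighted_L2[OF \<Omega> V(1) le_less_trans[OF V(2) fin]])
  moreover have "wnorm2 \<Omega> T \<beta> \<theta> V \<le> ennreal B * R"
    unfolding wnorm2_eq[OF \<Omega> V(1)] using V(2) b by (rule order_trans)
  ultimately show ?thesis using V by blast
qed

lemma powr_le_smaller_base:
  fixes l l0 :: real
  assumes "0 < l0" "l0 \<le> l" "0 \<le> d"
  shows "l powr q \<le> l0 powr (- d) * l powr (q + d)"
proof -
  have "l powr q = l powr (- d) * l powr (q + d)" using assms by (simp add: powr_add[symmetric])
  also have "\<dots> \<le> l0 powr (- d) * l powr (q + d)"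
    using assms by (intro mult_right_mono powr_mono2') auto
  finally show ?thesis .
qed

text \<open>The witnesses: \<open>\<kappa> = K\<close> is the constant of the derivative bounds for the profile, and \<open>C\<close> collects the Gamma
integrals \<open>C1\<close> (for \<open>\<sigma>\<close>) and \<open>C2\<close> (for \<open>\<nu>\<close>), the ellipticity constant \<open>a\<close> and the factor \<open>CT\<close> from the
time variable.\<close>

theorem corollary4p7:
  fixes \<Omega> :: "(real^'n::finite) set"
    and A :: "real^'n \<Rightarrow> real^'n^'n"
    and c :: "real^'n \<Rightarrow> real"
    and lam :: "nat \<Rightarrow> real"
    and \<phi> :: "nat \<Rightarrow> real^'n \<Rightarrow> real"
    and \<psi> :: "nat \<Rightarrow> real \<Rightarrow> real"
    and s T \<theta> \<sigma> \<nu> :: real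
  assumes "open \<Omega>" and "bounded \<Omega>" and "convex \<Omega>"
    and "admissible_coeffs \<Omega> A c"
    and "eigensystem \<Omega> A c lam \<phi>"
    and "0 < s" and "s < 1"
    and "\<And>k. profile s (lam k) (\<psi> k)"
    and "0 < T"
    and "0 \<le> \<theta>" and "\<theta> < 2 * sqrt (lam 0)"
    and "0 \<le> \<sigma>" and "\<sigma> < s"
    and "0 \<le> \<nu>" and "\<nu> < 1 + s"
  shows "\<exists>\<kappa>>1. \<exists>C>0. \<forall>f g h U.
    L2 (\<Omega> \<times> {0<..<T}) f \<longrightarrow> L2 \<Omega> g \<longrightarrow> L2 \<Omega> h \<longrightarrow>
    weak_solution \<Omega> A c s T f g h U \<longrightarrow>
    series_solution \<Omega> lam \<phi> \<psi> s T f g h U \<longrightarrow>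
    (\<forall>l::nat.
      (let R = Hnorm2 \<Omega> lam \<phi> (\<sigma> + s) g + Hnorm2 \<Omega> lam \<phi> \<sigma> h + L2Hnorm2 \<Omega> lam \<phi> T \<sigma> f
       in R < \<infinity> \<longrightarrow>
         (\<exists>V. weak_dy (l + 1) (cyl \<Omega> T) U V \<and>
            wnorm2 \<Omega> T (alpha s + 2 * real l - 2 * \<sigma>) \<theta> V
              \<le> ennreal (C * \<kappa> ^ (2 * (l + 1)) * (fact (l + 1))\<^sup>2) * R)) \<and>
      (let R = Hnorm2 \<Omega> lam \<phi> (\<nu> + s) g + Hnorm2 \<Omega> lam \<phi> \<nu> h + L2Hnorm2 \<Omega> lam \<phi> T \<nu> f
       in R < \<infinity> \<longrightarrow>
         (\<exists>V W. weak_dy (l + 1) (cyl \<Omega> T) U V \<and> weak_grad_x (cyl \<Omega> T) V W \<and>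
            wnorm2 \<Omega> T (alpha s + 2 * real (l + 1) - 2 * \<nu>) \<theta> W
              \<le> ennreal (C * \<kappa> ^ (2 * (l + 1)) * (fact (l + 1))\<^sup>2) * R)) \<and>
      (let R = Hnorm2 \<Omega> lam \<phi> (1 + \<nu> + s) g + Hnorm2 \<Omega> lam \<phi> (1 + \<nu>) h
                 + L2Hnorm2 \<Omega> lam \<phi> T (1 + \<nu>) f
       in R < \<infinity> \<longrightarrow>
         (\<exists>V Z. weak_dy (l + 1) (cyl \<Omega> T) U V \<and> weak_Lx A c (cyl \<Omega> T) V Z \<and>
            wnorm2 \<Omega> T (alpha s + 2 * real (l + 1) - 2 * \<nu>) \<theta> Z
              \<le> ennreal (C * \<kappa> ^ (2 * (l + 1)) * (fact (l + 1))\<^sup>2) * R)))"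
proof -
  note \<Omega> = assms(1,2) and adm = assms(4) and s = assms(6,7) and T = \<open>0 < T\<close>
  have S: "\<Omega> \<in> sets borel" using \<Omega> by simp
  have lam: "0 < lam k" "lam 0 \<le> lam k" and pair: "eigenpair \<Omega> A c (lam k) (\<phi> k)"
    and \<phi>: "orthonormal_basis_L2 \<Omega> \<phi>" for k
    using assms(5) unfolding eigensystem_def by auto
  have "\<forall>k. \<exists>G. H01_grad \<Omega> (\<phi> k) G \<and> (\<forall>v H. H01_grad \<Omega> v H \<longrightarrow>
      (LINT x:\<Omega>|lborel. (A x *v G x) \<bullet> H x + c x * \<phi> k x * v x) = lam k * (LINT x:\<Omega>|lborel. \<phi> k x * v x))"
    using pair unfolding eigenpair_def by blast
  from choice[OF this] obtain G where G: "\<forall>k. H01_grad \<Omega> (\<phi> k) (G k) \<and> (\<forall>v H. H01_grad \<Omega> v H \<longrightarrow>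
      (LINT x:\<Omega>|lborel. (A x *v G k x) \<bullet> H x + c x * \<phi> k x * v x) = lam k * (LINT x:\<Omega>|lborel. \<phi> k x * v x))"
    by blast
  have H: "H01_grad \<Omega> (\<phi> k) (G k)" for k using G by blast
  have eig: "(LINT x:\<Omega>|lborel. (A x *v G k x) \<bullet> H x + c x * \<phi> k x * v x) = lam k * (LINT x:\<Omega>|lborel. \<phi> k x * v x)"
    if "H01_grad \<Omega> v H" for k v H using G that by blast
  have L: "L2 \<Omega> (\<phi> k)" "L2 \<Omega> (G k)" for k using H[of k] unfolding H01_grad_def by auto
  let ?\<phi> = "\<lambda>k. zero_ext \<Omega> (\<phi> k)" and ?G = "\<lambda>k. zero_ext \<Omega> (G k)" and ?L\<phi> = "\<lambda>k x. lam k * zero_ext \<Omega> (\<phi> k) x"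
  note m\<phi> = L2_zero_ext(1)[OF L(1) S] and mG = L2_zero_ext(1)[OF L(2) S]
  have mL\<phi>: "?L\<phi> k \<in> borel_measurable borel" for k using m\<phi>[of k] by simp
  have bessel\<phi>: "bessel_bound (\<lambda>_. 1) ?\<phi>"
    unfolding bessel_bound_def using basis_sum_norm[OF \<phi> S] by simp
  have besselL: "bessel_bound (\<lambda>k. (lam k)\<^sup>2) ?L\<phi>"
    unfolding bessel_bound_def
  proof (intro allI impI)
    fix I :: "nat set" and d :: "nat \<Rightarrow> real" assume "finite I"
    from basis_sum_norm[OF \<phi> S this, of "\<lambda>k. d k * lam k"]
    show "(\<integral>\<^sup>+ x. ennreal ((norm (\<Sum>k\<in>I. d k *\<^sub>R ?L\<phi> k x))\<^sup>2) \<partial>lborel) \<le> ennreal (\<Sum>k\<in>I. (lam k)\<^sup>2 * (d k)\<^sup>2)"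
      by (simp add: power_mult_distrib mult_ac)
  qed
  from gradient_sum_norm[where \<phi> = \<phi> and G = G and lam = lam, OF \<Omega> adm \<phi> H eig]
  obtain a where a: "0 < a" and besselG: "bessel_bound (\<lambda>k. lam k / a) ?G"
    unfolding bessel_bound_def by blast
  from profile_family_derivs[where lam = lam and \<psi> = \<psi> and \<theta> = \<theta>, OF s lam assms(8) assms(10,11)]
  obtain E K where K: "1 < K"
    and dE': "\<forall>k m. \<forall>y>0. (E k m has_real_derivative E k (Suc m) y) (at y)"
    and E0': "\<forall>k. \<forall>y>0. E k 0 y = \<psi> k y \<and> \<bar>\<psi> k y\<bar> \<le> 1"
    and Ebound': "\<forall>p>0. \<exists>C>0. \<forall>k. \<forall>m\<ge>1.
      (\<integral>\<^sup>+ y\<in>{0<..}. ennreal (weight (p - 1 - 4 * s + 2 * real m) \<theta> y * (E k m y)\<^sup>2) \<partial>lborel)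
       \<le> ennreal (C * K ^ (2 * m) * (fact m)\<^sup>2 * lam k powr (2 * s - p / 2))"
    by (elim exE conjE)
  note dE = dE'[rule_format] and Ebound = Ebound'[rule_format]
  have E0: "E k 0 y = \<psi> k y" "\<bar>\<psi> k y\<bar> \<le> 1" if "0 < y" for k y using E0' that by auto
  define e where "e m k y = indicator {0<..} y * E k m y" for m k and y :: real
  have me: "e m k \<in> borel_measurable borel" for m k
  proof -
    have "continuous_on {0<..} (E k m)"
      using dE by (auto intro!: continuous_at_imp_continuous_on DERIV_isCont)
    from borel_measurable_continuous_on_indicator[OF _ this] show ?thesis unfolding e_def by simp
  qed
  have de: "(e j k has_real_derivative e (Suc j) k y) (at y)" if "0 < y" for j k y
  proof (rule has_field_derivative_transform_within_open[of "E k j" _ y "{0<..}"])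
    show "(E k j has_real_derivative e (Suc j) k y) (at y)" using dE[OF that] that by (simp add: e_def)
  qed (use that in \<open>auto simp: e_def\<close>)
  define N where "N \<beta> \<theta> m k = (\<integral>\<^sup>+ y\<in>{0<..}. ennreal (weight \<beta> \<theta> y * (e m k y)\<^sup>2) \<partial>lborel)" for \<beta> \<theta> m k
  have NE: "N \<beta> \<theta>' m k = (\<integral>\<^sup>+ y\<in>{0<..}. ennreal (weight \<beta> \<theta>' y * (E k m y)\<^sup>2) \<partial>lborel)" for \<beta> \<theta>' m k
    unfolding N_def e_def by (intro nn_integral_cong) (auto simp: indicator_def)
  \<comment> \<open>For \<open>U\<close> itself the weight \<open>e\<^sup>-\<^sup>y\<close> is used, for which \<open>\<bar>\<psi>\<^sub>k\<bar> \<le> 1\<close> suffices.\<close>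
  have N0: "N 0 (-1) 0 k \<le> 1" for k
  proof -
    have "N 0 (-1) 0 k \<le> (\<integral>\<^sup>+ y\<in>{0<..}. ennreal (y powr (1 - 1) * exp (- 1 * y)) \<partial>lborel)"
      unfolding NE
    proof (rule nn_integral_mono)
      fix y :: real
      have "weight 0 (-1) y * (E k 0 y)\<^sup>2 \<le> y powr (1 - 1) * exp (- 1 * y)" if "0 < y"
        using mult_left_mono[of "(E k 0 y)\<^sup>2" 1 "exp (- y)"] E0[OF that, of k] that
        by (simp add: weight_def abs_square_le_1)
      thus "ennreal (weight 0 (- 1) y * (E k 0 y)\<^sup>2) * indicator {0<..} y
         \<le> ennreal (y powr (1 - 1) * exp (- 1 * y)) * indicator {0<..} y"
        by (cases "0 < y") (auto intro: ennreal_leI)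
    qed
    also have "\<dots> = ennreal (Gamma 1 * 1 powr (- 1))" by (rule nn_integral_powr_exp) auto
    finally show ?thesis by simp
  qed
  obtain C1 where C1: "0 < C1" "\<And>k m. 1 \<le> m \<Longrightarrow> N ((2 * s - 2 * \<sigma>) - 1 - 4 * s + 2 * real m) \<theta> m k
       \<le> ennreal (C1 * K ^ (2 * m) * (fact m)\<^sup>2 * lam k powr (2 * s - (2 * s - 2 * \<sigma>) / 2))"
  proof -
    have "0 < 2 * s - 2 * \<sigma>" using \<open>\<sigma> < s\<close> by simp
    from Ebound[OF this] show thesis using that unfolding NE by blast
  qed
  obtain C2 where C2: "0 < C2" "\<And>k m. 1 \<le> m \<Longrightarrow> N ((2 * s + 2 - 2 * \<nu>) - 1 - 4 * s + 2 * real m) \<theta> m k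
       \<le> ennreal (C2 * K ^ (2 * m) * (fact m)\<^sup>2 * lam k powr (2 * s - (2 * s + 2 - 2 * \<nu>) / 2))"
  proof -
    have "0 < 2 * s + 2 - 2 * \<nu>" using \<open>\<nu> < 1 + s\<close> by simp
    from Ebound[OF this] show thesis using that unfolding NE by blast
  qed
  \<comment> \<open>For each order \<open>j\<close> some weight makes the derivatives square integrable for all \<open>k\<close>; this gives local integrability of the partial sums.\<close>
  have N_fin: "\<exists>\<beta> \<theta>'. \<forall>k. N \<beta> \<theta>' j k < \<infinity>" for j
  proof (cases "j = 0")
    case True
    have "N 0 (-1) j k < \<infinity>" for k using le_less_trans[OF N0[of k], of \<infinity>] True by simp
    thus ?thesis by blast
  next
    case False
    have "N ((2 * s + 2 - 2 * \<nu>) - 1 - 4 * s + 2 * real j) \<theta> j k < \<infinity>" for k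
      by (rule le_less_trans[OF C2(2)]) (use False in auto)
    thus ?thesis by blast
  qed
  define CT where "CT = 3 * T * (1 + T)"
  have CT: "0 < CT" using T by (simp add: CT_def)
  define C where "C = CT * (C1 + C2 / a + C2)"
  have C: "0 < C" "CT * C1 \<le> C" "CT * (C2 / a) \<le> C" "CT * C2 \<le> C"
  proof -
    define q where "q = C2 / a"
    have p: "0 < q" using C2(1) a by (simp add: q_def)
    show "0 < C" unfolding C_def q_def[symmetric] by (intro mult_pos_pos add_pos_pos CT C1(1) C2(1) p)
    show "CT * C1 \<le> C" "CT * (C2 / a) \<le> C" "CT * C2 \<le> C"
      unfolding C_def q_def[symmetric] using CT C1(1) C2(1) p by (auto intro: mult_left_mono)
  qed
  show ?thesis
  proof (rule exI[of _ K], rule conjI[OF K], rule exI[of _ C], rule conjI[OF C(1)], intro allI impI conjI)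
    fix f g h U and l :: nat
    assume f: "L2 (\<Omega> \<times> {0<..<T}) f" and weak: "weak_solution \<Omega> A c s T f g h U"
      and ser: "series_solution \<Omega> lam \<phi> \<psi> s T f g h U"
    define u where "u k t = indicator {0<..<T} t * mode \<Omega> lam \<phi> s f g h k t" for k t
    have mu: "u k \<in> borel_measurable borel" for k
      unfolding u_def by (rule borel_measurable_mode[OF \<Omega>(1) f L(1)])
    define J where "J k = (\<integral>\<^sup>+ t\<in>{0<..<T}. ennreal ((u k t)\<^sup>2) \<partial>lborel)" for k
    define R where "R r = Hnorm2 \<Omega> lam \<phi> (r + s) g + Hnorm2 \<Omega> lam \<phi> r h + L2Hnorm2 \<Omega> lam \<phi> T r f" for r
    have J: "(\<Sum>k. ennreal (lam k powr (r + s)) * J k) \<le> ennreal CT * R r" for r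
    proof -
      have "J k = (\<integral>\<^sup>+ t\<in>{0<..<T}. ennreal ((mode \<Omega> lam \<phi> s f g h k t)\<^sup>2) \<partial>lborel)" for k
        unfolding J_def u_def by (intro nn_integral_cong) (auto simp: indicator_def)
      thus ?thesis using mode_L2_sum[where \<phi> = \<phi> and lam = lam and r = r and s = s and g = g and h = h, OF \<Omega>(1) f L(1) T lam(1)] unfolding CT_def R_def by simp
    qed
    have U: "zero_ext (cyl \<Omega> T) U \<in> borel_measurable borel"
    proof -
      have "zero_ext (cyl \<Omega> T) U = (\<lambda>p. indicator (cyl \<Omega> T) p *\<^sub>R U p)" by (auto simp: zero_ext_def)
      thus ?thesis using weak by (simp add: weak_solution_def set_borel_measurable_def)
    qed
    let ?m = "l + 1"
    define Q where "Q = K ^ (2 * ?m) * (fact ?m)\<^sup>2"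
    have Q: "0 \<le> Q" using K by (simp add: Q_def)
    \<comment> \<open>The weights of the statement correspond to \<open>p = 2s - 2\<sigma>\<close> and \<open>p = 2s + 2 - 2\<nu>\<close>.\<close>
    have expo: "alpha s + 2 * real l - 2 * \<sigma> = (2 * s - 2 * \<sigma>) - 1 - 4 * s + 2 * real ?m"
      "alpha s + 2 * real ?m - 2 * \<nu> = (2 * s + 2 - 2 * \<nu>) - 1 - 4 * s + 2 * real ?m"
      "2 * s - (2 * s - 2 * \<sigma>) / 2 = \<sigma> + s" "2 * s - (2 * s + 2 - 2 * \<nu>) / 2 = \<nu> + s - 1"
      by (simp_all add: alpha_def field_simps)
    have N1: "N (alpha s + 2 * real l - 2 * \<sigma>) \<theta> ?m k \<le> ennreal (C1 * Q * lam k powr (\<sigma> + s))" for k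
      using C1(2)[of ?m k] unfolding expo(1,3) Q_def by (simp add: mult.assoc)
    have N2: "N (alpha s + 2 * real ?m - 2 * \<nu>) \<theta> ?m k \<le> ennreal (C2 * Q * lam k powr (\<nu> + s - 1))" for k
      using C2(2)[of ?m k] unfolding expo(2,4) Q_def by (simp add: mult.assoc)
    have N2': "ennreal q * N (alpha s + 2 * real ?m - 2 * \<nu>) \<theta> ?m k \<le> ennreal (B * lam k powr p)"
      if "0 \<le> q" "C2 * Q * (q * lam k powr (\<nu> + s - 1)) \<le> B * lam k powr p" for k q B p
    proof -
      have "ennreal q * N (alpha s + 2 * real ?m - 2 * \<nu>) \<theta> ?m k \<le> ennreal q * ennreal (C2 * Q * lam k powr (\<nu> + s - 1))"
        by (intro mult_left_mono N2) auto
      also have "\<dots> = ennreal (C2 * Q * (q * lam k powr (\<nu> + s - 1)))"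
        using that(1) C2(1) Q by (simp add: ennreal_mult[symmetric] mult_ac)
      also have "\<dots> \<le> ennreal (B * lam k powr p)" by (rule ennreal_leI[OF that(2)])
      finally show ?thesis .
    qed
    \<comment> \<open>The eigenvalues are bounded below by \<open>lam 0 > 0\<close>, so lower powers of them are controlled by higher ones.\<close>
    have Jsum: "(\<Sum>k. J k) < \<infinity>" if "0 \<le> r" "R r < \<infinity>" for r
    proof -
      have "(\<Sum>k. J k) \<le> (\<Sum>k. ennreal (lam 0 powr (- (r + s))) * (ennreal (lam k powr (r + s)) * J k))"
      proof (intro suminf_le allI)
        fix k
        have "1 * J k \<le> ennreal (lam 0 powr (- (r + s)) * lam k powr (r + s)) * J k"
          using powr_le_smaller_base[OF lam, of "r + s" k 0] that s lam(1)[of k]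
          by (intro mult_right_mono) (auto simp flip: ennreal_1 intro!: ennreal_leI)
        thus "J k \<le> ennreal (lam 0 powr (- (r + s))) * (ennreal (lam k powr (r + s)) * J k)"
          by (simp add: ennreal_mult mult.assoc)
      qed auto
      also have "\<dots> = ennreal (lam 0 powr (- (r + s))) * (\<Sum>k. ennreal (lam k powr (r + s)) * J k)"
        by (rule ennreal_suminf_cmult)
      also have "\<dots> \<le> ennreal (lam 0 powr (- (r + s))) * (ennreal CT * R r)" by (intro mult_left_mono J) auto
      also have "\<dots> < \<infinity>" using that by (simp add: ennreal_mult_less_top)
      finally show ?thesis .
    qed
    have Jfin: "J k < \<infinity>" if "(\<Sum>k. J k) < \<infinity>" for k
      using ennreal_suminf_lessD[OF that] .
    have one: "\<And>k::nat. 0 \<le> (1::real)" and lamG: "\<And>k. 0 \<le> lam k / a" and lamsq: "\<And>k. 0 \<le> (lam k)\<^sup>2"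
      using lam(1) a by (auto simp: less_imp_le)
    have loc: "loc_integrable (cyl \<Omega> T) (tensor_sum u (e j) ?\<phi> {..<n})"
      "loc_integrable (cyl \<Omega> T) (tensor_sum u (e j) ?G {..<n})"
      "loc_integrable (cyl \<Omega> T) (tensor_sum u (e j) ?L\<phi> {..<n})" if fin: "(\<Sum>k. J k) < \<infinity>" for j n
    proof -
      obtain \<beta> \<theta>' where fN: "\<And>k. N \<beta> \<theta>' j k < \<infinity>" using N_fin by blast
      note fN = fN[unfolded N_def] and fJ = Jfin[OF fin, unfolded J_def]
      show "loc_integrable (cyl \<Omega> T) (tensor_sum u (e j) ?\<phi> {..<n})"
        by (rule loc_integrable_tensor_sum[OF \<Omega>(1) mu me m\<phi> bessel\<phi> one finite_lessThan fN fJ])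
      show "loc_integrable (cyl \<Omega> T) (tensor_sum u (e j) ?G {..<n})"
        by (rule loc_integrable_tensor_sum[OF \<Omega>(1) mu me mG besselG lamG finite_lessThan fN fJ])
      show "loc_integrable (cyl \<Omega> T) (tensor_sum u (e j) ?L\<phi> {..<n})"
        by (rule loc_integrable_tensor_sum[OF \<Omega>(1) mu me mL\<phi> besselL lamsq finite_lessThan fN fJ])
    qed
    have mS: "tensor_sum u (e j) ?\<phi> I \<in> borel_measurable borel" "tensor_sum u (e j) ?G I \<in> borel_measurable borel"
      "tensor_sum u (e j) ?L\<phi> I \<in> borel_measurable borel" for j I
      by (intro borel_measurable_tensor_sum mu me m\<phi>, intro borel_measurable_tensor_sum mu me mG,
          intro borel_measurable_tensor_sum mu me mL\<phi>)
    have dy: "weak_dy ?m (cyl \<Omega> T) U V"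
      if fin: "(\<Sum>k. J k) < \<infinity>" and V: "V \<in> borel_measurable borel" "loc_integrable (cyl \<Omega> T) V"
        and lim: "(\<lambda>n. \<integral>\<^sup>+ p. ennreal ((norm (tensor_sum u (e ?m) ?\<phi> {..<n} p - V p))\<^sup>2) \<partial>wmeas \<Omega> T \<beta> \<theta>) \<longlonglongrightarrow> 0"
      for V \<beta> \<theta>
    proof -
      have NJ: "N 0 (-1) 0 k * J k \<le> J k" for k using mult_right_mono[OF N0[of k], of "J k"] by simp
      have "(\<Sum>k. N 0 (-1) 0 k * J k) \<le> (\<Sum>k. J k)" by (intro suminf_le allI NJ) auto
      hence finNJ: "(\<Sum>k. N 0 (-1) 0 k * J k) < \<infinity>" using fin by (rule le_less_trans)
      have limU: "(\<lambda>n. \<integral>\<^sup>+ p. ennreal ((norm (tensor_sum u (e 0) ?\<phi> {..<n} p - zero_ext (cyl \<Omega> T) U p))\<^sup>2) \<partial>wmeas \<Omega> T 0 (-1)) \<longlonglongrightarrow> 0"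
        by (rule solution_series_converges[OF \<Omega>(1) \<phi> U mu me _ _ ser])
          (use finNJ E0(1) in \<open>simp_all add: N_def J_def u_def e_def\<close>)
      have "ennreal 1 * (\<integral>\<^sup>+ y\<in>{0<..}. ennreal (weight 0 (-1) y * (e 0 k y)\<^sup>2) \<partial>lborel)
          * (\<integral>\<^sup>+ t\<in>{0<..<T}. ennreal ((u k t)\<^sup>2) \<partial>lborel) \<le> J k" for k
        using NJ[of k] unfolding N_def J_def by simp
      note finS = tensor_series_converges(2)[where u = u and e = "e 0" and \<Phi> = ?\<phi> and b = J,
          OF \<Omega>(1) mu me m\<phi> bessel\<phi> one this fin]
      have "(\<integral>\<^sup>+ p. ennreal ((norm (zero_ext (cyl \<Omega> T) U p))\<^sup>2) \<partial>wmeas \<Omega> T 0 (-1)) < \<infinity>"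
        by (rule finite_weighted_L2_limit[OF _ _ limU finS]) (simp_all add: mS U)
      hence locU: "loc_integrable (cyl \<Omega> T) (zero_ext (cyl \<Omega> T) U)"
        by (rule loc_integrable_of_weighted_L2[OF \<Omega>(1) U])
      show ?thesis by (rule weak_dy_of_series[OF \<Omega>(1) U V(1) mS(1) loc(1)[OF fin] de limU locU lim V(2)])
    qed
    have final: "ennreal B * (ennreal CT * R r) \<le> ennreal (C * K ^ (2 * ?m) * (fact ?m)\<^sup>2) * R r"
      if "0 \<le> B" "CT * B \<le> C * Q" for B r
    proof -
      have "ennreal B * (ennreal CT * R r) = ennreal (CT * B) * R r"
        using that(1) CT by (simp add: ennreal_mult mult_ac)
      also have "\<dots> \<le> ennreal (C * Q) * R r" by (intro mult_right_mono ennreal_leI that) auto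
      finally show ?thesis by (simp add: Q_def mult.assoc)
    qed
    have le_CQ: "CT * (x * Q) \<le> C * Q" if "CT * x \<le> C" for x
      using mult_right_mono[OF that Q] by (simp add: mult.assoc)
    note est\<phi> = tensor_series_estimate[where u = u and e = "e ?m" and \<Phi> = ?\<phi>, OF \<Omega>(1) mu me m\<phi> bessel\<phi> one]
      and estG = tensor_series_estimate[where u = u and e = "e ?m" and \<Phi> = ?G, OF \<Omega>(1) mu me mG besselG lamG]
      and estL = tensor_series_estimate[where u = u and e = "e ?m" and \<Phi> = ?L\<phi>, OF \<Omega>(1) mu me mL\<phi> besselL lamsq]
    have case1: "\<exists>V. weak_dy ?m (cyl \<Omega> T) U V \<and> wnorm2 \<Omega> T (alpha s + 2 * real l - 2 * \<sigma>) \<theta> V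
          \<le> ennreal (C * K ^ (2 * ?m) * (fact ?m)\<^sup>2) * R \<sigma>" if fin: "R \<sigma> < \<infinity>"
    proof -
      have R: "ennreal CT * R \<sigma> < \<infinity>" using fin by (simp add: ennreal_mult_less_top)
      note Jf = Jsum[OF \<open>0 \<le> \<sigma>\<close> fin]
      have B: "0 \<le> C1 * Q" using C1(1) Q by simp
      have "ennreal 1 * N (alpha s + 2 * real l - 2 * \<sigma>) \<theta> ?m k \<le> ennreal (C1 * Q * lam k powr (\<sigma> + s))" for k
        using N1[of k] by simp
      from est\<phi>[where w = "\<lambda>k. lam k powr (\<sigma> + s)", OF B powr_ge_zero this[unfolded N_def] J[of \<sigma>, unfolded J_def] R]
      obtain V where V: "V \<in> borel_measurable borel" "loc_integrable (cyl \<Omega> T) V"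
        "wnorm2 \<Omega> T (alpha s + 2 * real l - 2 * \<sigma>) \<theta> V \<le> ennreal (C1 * Q) * (ennreal CT * R \<sigma>)"
        "(\<lambda>n. \<integral>\<^sup>+ p. ennreal ((norm (tensor_sum u (e ?m) ?\<phi> {..<n} p - V p))\<^sup>2)
          \<partial>wmeas \<Omega> T (alpha s + 2 * real l - 2 * \<sigma>) \<theta>) \<longlonglongrightarrow> 0" by blast
      show ?thesis
        using dy[OF Jf V(1,2,4)] order_trans[OF V(3) final[OF B le_CQ[OF C(2)]]] by blast
    qed
    let ?\<beta> = "alpha s + 2 * real ?m - 2 * \<nu>"
    have case2: "\<exists>V W. weak_dy ?m (cyl \<Omega> T) U V \<and> weak_grad_x (cyl \<Omega> T) V W \<and> wnorm2 \<Omega> T ?\<beta> \<theta> W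
          \<le> ennreal (C * K ^ (2 * ?m) * (fact ?m)\<^sup>2) * R \<nu>" if fin: "R \<nu> < \<infinity>"
    proof -
      have R: "ennreal CT * R \<nu> < \<infinity>" using fin by (simp add: ennreal_mult_less_top)
      note Jf = Jsum[OF \<open>0 \<le> \<nu>\<close> fin]
      have B: "0 \<le> C2 * Q / lam 0" "0 \<le> C2 / a * Q" using C2(1) Q a lam(1)[of 0] by simp_all
      have "ennreal 1 * N ?\<beta> \<theta> ?m k \<le> ennreal (C2 * Q / lam 0 * lam k powr (\<nu> + s))" for k
      proof (rule N2')
        have "lam k powr (\<nu> + s - 1) \<le> lam 0 powr (- 1) * lam k powr (\<nu> + s - 1 + 1)"
          by (rule powr_le_smaller_base[OF lam]) simp
        from mult_left_mono[OF this, of "C2 * Q"]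
        show "C2 * Q * (1 * lam k powr (\<nu> + s - 1)) \<le> C2 * Q / lam 0 * lam k powr (\<nu> + s)"
          using C2(1) Q lam(1)[of 0] by (simp add: powr_minus_divide)
      qed simp
      from est\<phi>[where w = "\<lambda>k. lam k powr (\<nu> + s)", OF B(1) powr_ge_zero this[unfolded N_def] J[of \<nu>, unfolded J_def] R]
      obtain V where V: "V \<in> borel_measurable borel" "loc_integrable (cyl \<Omega> T) V"
        "(\<lambda>n. \<integral>\<^sup>+ p. ennreal ((norm (tensor_sum u (e ?m) ?\<phi> {..<n} p - V p))\<^sup>2) \<partial>wmeas \<Omega> T ?\<beta> \<theta>) \<longlonglongrightarrow> 0"
        by blast
      have "ennreal (lam k / a) * N ?\<beta> \<theta> ?m k \<le> ennreal (C2 / a * Q * lam k powr (\<nu> + s))" for k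
        by (rule N2'[OF lamG]) (use lam(1)[of k] in \<open>simp add: powr_diff\<close>)
      from estG[where w = "\<lambda>k. lam k powr (\<nu> + s)", OF B(2) powr_ge_zero this[unfolded N_def] J[of \<nu>, unfolded J_def] R]
      obtain W where W: "W \<in> borel_measurable borel" "loc_integrable (cyl \<Omega> T) W"
        "wnorm2 \<Omega> T ?\<beta> \<theta> W \<le> ennreal (C2 / a * Q) * (ennreal CT * R \<nu>)"
        "(\<lambda>n. \<integral>\<^sup>+ p. ennreal ((norm (tensor_sum u (e ?m) ?G {..<n} p - W p))\<^sup>2) \<partial>wmeas \<Omega> T ?\<beta> \<theta>) \<longlonglongrightarrow> 0"
        by blast
      have "weak_grad_x (cyl \<Omega> T) V W"
        by (rule weak_grad_x_of_series[OF \<Omega>(1) V(1) W(1) H mS(1,2) loc(1,2)[OF Jf] V(3,2) W(4,2)])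
      thus ?thesis
        using dy[OF Jf V] order_trans[OF W(3) final[OF B(2) le_CQ[OF C(3)]]] by blast
    qed
    have case3: "\<exists>V Z. weak_dy ?m (cyl \<Omega> T) U V \<and> weak_Lx A c (cyl \<Omega> T) V Z \<and> wnorm2 \<Omega> T ?\<beta> \<theta> Z
          \<le> ennreal (C * K ^ (2 * ?m) * (fact ?m)\<^sup>2) * R (1 + \<nu>)" if fin: "R (1 + \<nu>) < \<infinity>"
    proof -
      have R: "ennreal CT * R (1 + \<nu>) < \<infinity>" using fin by (simp add: ennreal_mult_less_top)
      have "0 \<le> 1 + \<nu>" using \<open>0 \<le> \<nu>\<close> by simp
      note Jf = Jsum[OF this fin]
      have B: "0 \<le> C2 * Q * lam 0 powr (- 2)" "0 \<le> C2 / a * Q / lam 0" "0 \<le> C2 * Q"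
        using C2(1) Q a lam(1)[of 0] by simp_all
      have "ennreal 1 * N ?\<beta> \<theta> ?m k \<le> ennreal (C2 * Q * lam 0 powr (- 2) * lam k powr (1 + \<nu> + s))" for k
      proof (rule N2')
        have "lam k powr (\<nu> + s - 1) \<le> lam 0 powr (- 2) * lam k powr (\<nu> + s - 1 + 2)"
          by (rule powr_le_smaller_base[OF lam]) simp
        also have "\<nu> + s - 1 + 2 = 1 + \<nu> + s" by simp
        finally have "lam k powr (\<nu> + s - 1) \<le> lam 0 powr (- 2) * lam k powr (1 + \<nu> + s)" .
        from mult_left_mono[OF this, of "C2 * Q"]
        show "C2 * Q * (1 * lam k powr (\<nu> + s - 1)) \<le> C2 * Q * lam 0 powr (- 2) * lam k powr (1 + \<nu> + s)"
          using B(3) by (simp add: mult.assoc)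
      qed simp
      from est\<phi>[where w = "\<lambda>k. lam k powr (1 + \<nu> + s)", OF B(1) powr_ge_zero this[unfolded N_def] J[of "1 + \<nu>", unfolded J_def] R]
      obtain V where V: "V \<in> borel_measurable borel" "loc_integrable (cyl \<Omega> T) V"
        "(\<lambda>n. \<integral>\<^sup>+ p. ennreal ((norm (tensor_sum u (e ?m) ?\<phi> {..<n} p - V p))\<^sup>2) \<partial>wmeas \<Omega> T ?\<beta> \<theta>) \<longlonglongrightarrow> 0"
        by blast
      have "ennreal (lam k / a) * N ?\<beta> \<theta> ?m k \<le> ennreal (C2 / a * Q / lam 0 * lam k powr (1 + \<nu> + s))" for k
      proof (rule N2'[OF lamG])
        have "lam 0 * lam k powr (\<nu> + s) \<le> lam k * lam k powr (\<nu> + s)" by (intro mult_right_mono lam) auto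
        hence "lam k powr (\<nu> + s) \<le> lam k powr (1 + \<nu> + s) / lam 0"
          using lam(1)[of 0] lam(1)[of k] by (simp add: field_simps powr_add)
        from mult_left_mono[OF this, of "C2 / a * Q"]
        show "C2 * Q * (lam k / a * lam k powr (\<nu> + s - 1)) \<le> C2 / a * Q / lam 0 * lam k powr (1 + \<nu> + s)"
          using C2(1) Q a lam(1)[of k] by (simp add: powr_diff)
      qed
      from estG[where w = "\<lambda>k. lam k powr (1 + \<nu> + s)", OF B(2) powr_ge_zero this[unfolded N_def] J[of "1 + \<nu>", unfolded J_def] R]
      obtain W where W: "W \<in> borel_measurable borel" "loc_integrable (cyl \<Omega> T) W"
        "(\<lambda>n. \<integral>\<^sup>+ p. ennreal ((norm (tensor_sum u (e ?m) ?G {..<n} p - W p))\<^sup>2) \<partial>wmeas \<Omega> T ?\<beta> \<theta>) \<longlonglongrightarrow> 0"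
        by blast
      have "ennreal ((lam k)\<^sup>2) * N ?\<beta> \<theta> ?m k \<le> ennreal (C2 * Q * lam k powr (1 + \<nu> + s))" for k
      proof (rule N2'[OF lamsq])
        have "(lam k)\<^sup>2 * lam k powr (\<nu> + s - 1) = lam k powr 2 * lam k powr (\<nu> + s - 1)"
          using lam(1)[of k] by (simp add: powr_numeral)
        also have "\<dots> = lam k powr (1 + \<nu> + s)" by (simp add: powr_add[symmetric] algebra_simps)
        finally show "C2 * Q * ((lam k)\<^sup>2 * lam k powr (\<nu> + s - 1)) \<le> C2 * Q * lam k powr (1 + \<nu> + s)" by simp
      qed
      from estL[where w = "\<lambda>k. lam k powr (1 + \<nu> + s)", OF B(3) powr_ge_zero this[unfolded N_def] J[of "1 + \<nu>", unfolded J_def] R]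
      obtain Z where Z: "Z \<in> borel_measurable borel" "loc_integrable (cyl \<Omega> T) Z"
        "wnorm2 \<Omega> T ?\<beta> \<theta> Z \<le> ennreal (C2 * Q) * (ennreal CT * R (1 + \<nu>))"
        "(\<lambda>n. \<integral>\<^sup>+ p. ennreal ((norm (tensor_sum u (e ?m) ?L\<phi> {..<n} p - Z p))\<^sup>2) \<partial>wmeas \<Omega> T ?\<beta> \<theta>) \<longlonglongrightarrow> 0"
        by blast
      have "weak_Lx A c (cyl \<Omega> T) V Z"
        by (rule weak_Lx_of_series[OF \<Omega> adm V(1) W(1) Z(1) H eig mS loc[OF Jf] V(3,2) W(3,2) Z(4,2)])
      thus ?thesis
        using dy[OF Jf V] order_trans[OF Z(3) final[OF B(3) le_CQ[OF C(4)]]] by blast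
    qed
    show "(let R = Hnorm2 \<Omega> lam \<phi> (\<sigma> + s) g + Hnorm2 \<Omega> lam \<phi> \<sigma> h + L2Hnorm2 \<Omega> lam \<phi> T \<sigma> f
       in R < \<infinity> \<longrightarrow> (\<exists>V. weak_dy (l + 1) (cyl \<Omega> T) U V \<and>
            wnorm2 \<Omega> T (alpha s + 2 * real l - 2 * \<sigma>) \<theta> V \<le> ennreal (C * K ^ (2 * (l + 1)) * (fact (l + 1))\<^sup>2) * R))"
      using case1 unfolding Let_def R_def by blast
    show "(let R = Hnorm2 \<Omega> lam \<phi> (\<nu> + s) g + Hnorm2 \<Omega> lam \<phi> \<nu> h + L2Hnorm2 \<Omega> lam \<phi> T \<nu> f
       in R < \<infinity> \<longrightarrow> (\<exists>V W. weak_dy (l + 1) (cyl \<Omega> T) U V \<and> weak_grad_x (cyl \<Omega> T) V W \<and>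
            wnorm2 \<Omega> T (alpha s + 2 * real (l + 1) - 2 * \<nu>) \<theta> W \<le> ennreal (C * K ^ (2 * (l + 1)) * (fact (l + 1))\<^sup>2) * R))"
      using case2 unfolding Let_def R_def by blast
    show "(let R = Hnorm2 \<Omega> lam \<phi> (1 + \<nu> + s) g + Hnorm2 \<Omega> lam \<phi> (1 + \<nu>) h + L2Hnorm2 \<Omega> lam \<phi> T (1 + \<nu>) f
       in R < \<infinity> \<longrightarrow> (\<exists>V Z. weak_dy (l + 1) (cyl \<Omega> T) U V \<and> weak_Lx A c (cyl \<Omega> T) V Z \<and>
            wnorm2 \<Omega> T (alpha s + 2 * real (l + 1) - 2 * \<nu>) \<theta> Z \<le> ennreal (C * K ^ (2 * (l + 1)) * (fact (l + 1))\<^sup>2) * R))"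
      using case3 unfolding Let_def R_def by blast
  qed
qed

end
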